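(* Let $Z$ be the total space of an affine line bundle on (the total space of) $\mathcal O(1)$ with trivial underlying translation bundle whose patching is $$\hat T=T+f,$$ where $f$ represents a cohomology class in $\check H^1\left(\mathcal O(1),\mathcal O_{\mathcal O(1)}\right)$. The three-parameter family of global sections $X_x$ have normal bundle $N_x=\mathcal O\oplus\mathcal O(1)$, and the moduli space $M$ of those sections is a complex three-dimensional manifold equipped with a family of torsional Newton-Cartan structures parametrised by two arbitrary one-forms on $M$, two functions on $M$, and an element of $\mathrm{GL}(2,\mathbb{C})$.
   Context: Notation. Cover $\mathbb{P}^1$ by $U,\hat U$ with coordinates $\lambda$ and $\hat\lambda=\lambda^{-1}$. $\mathcal O(1)\to\mathbb{P}^1$ has fibre coordinate $\Omega$ over $U$, $\hat\Omega$ over $\hat U$, with $\hat\Omega=\lambda^{-1}\Omega$; $f=f(\Omega,\lambda)$ is holomorphic on the part of $\mathcal O(1)$ over $U\cap\hat U$. Thus $Z$ has fibre coordinates $w=(T,\Omega)$, $\hat w=(\hat T,\hat\Omega)$ over $\mathbb{P}^1$ with patching $\hat T=T+f(\Omega,\lambda)$, $\hat\Omega=\lambda^{-1}\Omega$. The global sections $X_x$ of $Z\to\mathbb{P}^1$ have $\Omega|=y+z\lambda$ and, writing $f(y+z\lambda,\lambda)=\sum_{n\in\mathbb{Z}}\gamma_n(y,z)\lambda^n$, $T|=t-\sum_{n\ge1}\gamma_n\lambda^n$, so that $x^a=(t,y,z)$ are coordinates on $M$. All objects are holomorphic, and a vertical slash denotes restriction to $X_x$. The normal bundle $N_x$ of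 $X_x$ has patching $\mathcal F^\mu_{\ \nu}=\frac{\partial\hat w^\mu}{\partial w^\nu}|$. Torsional Newton-Cartan structure (complex, three-dimensional): a triple $(h,\theta,\nabla)$ where $h$ is a symmetric contravariant 2-tensor field of rank two (the metric), $\theta$ is a one-form, not required to be closed, spanning the kernel of $h$ (the clock), and $\nabla$ is an affine connection, which may have torsion, with $\nabla h=0$, $\nabla\theta=0$. Index convention: $\nabla_b\theta_a=\partial_b\theta_a-\Gamma^c_{\ ab}\theta_c$. The family on $M$ is induced from $Z$ as follows. Frame section: $v=H^{-1}dw|$ ($d$ is the exterior derivative on $M$ at fixed $\lambda$), where $\mathcal F=\hat H\,\mathrm{diag}(1,\lambda^{-1})H^{-1}$ with $H$, $\hat H$ holomorphic maps from $U$, $\hat U$ to $\mathrm{GL}(2,\mathbb{C})$ for each $x$; $H$ is determined only up to an invertible global section of $N_x\otimes N_x^*$, varying arbitrarily with $x$. The first ($\mathcal O$-valued) component of $v$ is the clock $\theta$. Torsion $\Xi$-connections: connections $\nabla$ with symbols given by $\Gamma^c_{\ ab}\partial_cw^\mu|=\partial_a\partial_bw^\mu|+\rho^\mu_{\ \nu\,b}\,\partial_aw^\nu|$, where $\{\rho,\hat\rho\}$ is, for each $x\in M$, any pair, holomorphic over $U$ and $\hat U$ respectively, solving $\partial_b\mathcal F^\mu_{\ \nu}=-\hat\rho^\mu_{\ \alpha\,b}\mathcal F^\alpha_{\ \nu}+\mathcal F^\mu_{\ \beta}\rho^\beta_{\ \nu\,b}$. The structures are obtained by taking $\theta$ from a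 frame section, $\nabla$ a torsion $\Xi$-connection, imposing $\nabla\theta=0$, and constructing $h$ from the conditions $h(\theta,\cdot)=0$ and $\nabla h=0$. *)

theory Defs
  imports "HOL-Complex_Analysis.Complex_Analysis"
begin

text \<open>Holomorphic functions of several complex variables on an open subset of
  \<open>complex ^ 'n\<close>: Frechet differentiable with complex-linear derivative.\<close>

definition mholomorphic_on :: "(complex ^ 'n \<Rightarrow> complex) \<Rightarrow> (complex ^ 'n) set \<Rightarrow> bool"
    (infixl "mholomorphic'_on" 50) where
  "F mholomorphic_on S \<longleftrightarrow>
     (\<forall>p\<in>S. \<exists>D. (F has_derivative D) (at p) \<and> (\<forall>c v. D (c *s v) = c * D v))"

definition partial :: "'n \<Rightarrow> (complex ^ 'n \<Rightarrow> complex) \<Rightarrow> complex ^ 'n \<Rightarrow> complex" where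
  "partial i F p = deriv (\<lambda>s. F (p + axis i s)) 0"

text \<open>
  Conventions. \<open>U\<close> is the complex plane with coordinate \<open>l\<close> and \<open>U'\<close> the complex plane with
  coordinate \<open>m = 1 / l\<close>, so a holomorphic object over \<open>U\<close> or \<open>U'\<close> is an entire one.
  The function \<open>f Om l\<close> is holomorphic where \<open>l \<noteq> 0\<close>; its values at \<open>l = 0\<close> are never used.
  Fibre coordinates \<open>w = (T, Om)\<close> of \<open>Z\<close> are vectors in \<open>complex ^ 2\<close>.
  The coordinates \<open>(t, y, z)\<close> of a point \<open>x\<close> of the moduli space are \<open>x $ 1\<close>, \<open>x $ 2\<close>, \<open>x $ 3\<close>.
\<close>

definition twistor_patch :: "(complex \<Rightarrow> complex \<Rightarrow> complex) \<Rightarrow> complex \<Rightarrow> complex ^ 2 \<Rightarrow> complex ^ 2"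
  where "twistor_patch f l w = vector [w $ 1 + f (w $ 2) l, w $ 2 / l]"

text \<open>Global sections of \<open>Z\<close> over the projective line, given by their expressions
  \<open>w = W l\<close> and \<open>w' = Wh m\<close> in the two charts.\<close>

definition global_sections ::
    "(complex \<Rightarrow> complex \<Rightarrow> complex) \<Rightarrow> ((complex \<Rightarrow> complex ^ 2) \<times> (complex \<Rightarrow> complex ^ 2)) set"
  where
  "global_sections f = {(W, Wh).
     (\<forall>\<mu>. (\<lambda>l. W l $ \<mu>) holomorphic_on UNIV) \<and> (\<forall>\<mu>. (\<lambda>m. Wh m $ \<mu>) holomorphic_on UNIV) \<and>
     (\<forall>l. l \<noteq> 0 \<longrightarrow> Wh (1 / l) = twistor_patch f l (W l))}"

text \<open>Coefficients of the Laurent expansion of a function on the punctured plane.\<close>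

definition laurent_coeffs :: "(complex \<Rightarrow> complex) \<Rightarrow> int \<Rightarrow> complex" where
  "laurent_coeffs g = (THE c. \<forall>l. l \<noteq> 0 \<longrightarrow> ((\<lambda>n. c n * l powi n) has_sum g l) UNIV)"

definition gam :: "(complex \<Rightarrow> complex \<Rightarrow> complex) \<Rightarrow> int \<Rightarrow> complex \<Rightarrow> complex \<Rightarrow> complex" where
  "gam f n y z = laurent_coeffs (\<lambda>l. f (y + z * l) l) n"

text \<open>The section \<open>X\<^sub>x\<close> in the two charts. The second expression is the image of the first
  under the patching: the positive powers in \<open>T\<close> cancel those of \<open>f\<close>.\<close>

definition sec :: "(complex \<Rightarrow> complex \<Rightarrow> complex) \<Rightarrow> complex ^ 3 \<Rightarrow> complex \<Rightarrow> complex ^ 2" where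
  "sec f x l = vector
     [x $ 1 - (\<Sum>\<^sub>\<infinity>n\<in>{1..}. gam f n (x $ 2) (x $ 3) * l powi n),
      x $ 2 + x $ 3 * l]"

definition sec_hat :: "(complex \<Rightarrow> complex \<Rightarrow> complex) \<Rightarrow> complex ^ 3 \<Rightarrow> complex \<Rightarrow> complex ^ 2" where
  "sec_hat f x m = vector
     [x $ 1 + (\<Sum>\<^sub>\<infinity>n\<in>{..0}. gam f n (x $ 2) (x $ 3) * m powi (- n)),
      x $ 2 * m + x $ 3]"

text \<open>A function on (moduli space) \<open>\<times>\<close> (affine chart of the projective line) that is
  holomorphic in all four variables jointly.\<close>

definition holomorphic_family :: "(complex ^ 3 \<Rightarrow> complex \<Rightarrow> complex) \<Rightarrow> bool" where
  "holomorphic_family F \<longleftrightarrow>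
     (\<lambda>p :: complex ^ 4. F (vector [p $ 1, p $ 2, p $ 3]) (p $ 4)) mholomorphic_on UNIV"

definition dsec :: "(complex \<Rightarrow> complex \<Rightarrow> complex) \<Rightarrow> complex ^ 3 \<Rightarrow> complex \<Rightarrow> 3 \<Rightarrow> complex ^ 2" where
  "dsec f x l a = (\<chi> \<mu>. partial a (\<lambda>x. sec f x l $ \<mu>) x)"

definition ddsec ::
    "(complex \<Rightarrow> complex \<Rightarrow> complex) \<Rightarrow> complex ^ 3 \<Rightarrow> complex \<Rightarrow> 3 \<Rightarrow> 3 \<Rightarrow> complex ^ 2" where
  "ddsec f x l a b = (\<chi> \<mu>. partial a (\<lambda>x. dsec f x l b $ \<mu>) x)"

definition normal_patch ::
    "(complex \<Rightarrow> complex \<Rightarrow> complex) \<Rightarrow> complex ^ 3 \<Rightarrow> complex \<Rightarrow> complex ^ 2 ^ 2" where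
  "normal_patch f x l = (\<chi> \<mu> \<nu>. partial \<nu> (\<lambda>w. twistor_patch f l w $ \<mu>) (sec f x l))"

text \<open>Global holomorphic sections of the normal bundle, in the chart over \<open>U\<close>.\<close>

definition normal_sections ::
    "(complex \<Rightarrow> complex \<Rightarrow> complex) \<Rightarrow> complex ^ 3 \<Rightarrow> (complex \<Rightarrow> complex ^ 2) set" where
  "normal_sections f x = {s. (\<forall>\<mu>. (\<lambda>l. s l $ \<mu>) holomorphic_on UNIV) \<and>
     (\<exists>sh. (\<forall>\<mu>. (\<lambda>m. sh m $ \<mu>) holomorphic_on UNIV) \<and>
           (\<forall>l. l \<noteq> 0 \<longrightarrow> sh (1 / l) = normal_patch f x l *v s l))}"

definition holomorphic_matrix :: "(complex \<Rightarrow> complex ^ 2 ^ 2) \<Rightarrow> bool" where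
  "holomorphic_matrix A \<longleftrightarrow> (\<forall>\<mu> \<nu>. (\<lambda>l. A l $ \<mu> $ \<nu>) holomorphic_on UNIV)"

text \<open>\<open>(H, Hh)\<close> is an isomorphism of the normal bundle of \<open>X\<^sub>x\<close> with \<open>\<O> \<oplus> \<O>(1)\<close>; the latter
  has patching \<open>diag (1, 1 / l)\<close>.\<close>

definition normal_splitting ::
    "(complex \<Rightarrow> complex \<Rightarrow> complex) \<Rightarrow> complex ^ 3 \<Rightarrow>
     (complex \<Rightarrow> complex ^ 2 ^ 2) \<Rightarrow> (complex \<Rightarrow> complex ^ 2 ^ 2) \<Rightarrow> bool" where
  "normal_splitting f x H Hh \<longleftrightarrow>
     holomorphic_matrix H \<and> holomorphic_matrix Hh \<and>
     (\<forall>l. invertible (H l)) \<and> (\<forall>m. invertible (Hh m)) \<and>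
     (\<forall>l. l \<noteq> 0 \<longrightarrow> normal_patch f x l =
        Hh (1 / l) ** vector [vector [1, 0], vector [0, 1 / l]] ** matrix_inv (H l))"

text \<open>Tensor fields and connections on the moduli space in the coordinates \<open>x\<^sup>a\<close>:
  one-forms \<open>\<theta> x $ a\<close>, contravariant 2-tensors \<open>h x $ a $ b\<close>,
  and connection symbols \<open>\<Gamma> x c a b\<close>, where \<open>b\<close> is the index of differentiation.\<close>

type_synonym one_form = "complex ^ 3 \<Rightarrow> complex ^ 3"
type_synonym bivector = "complex ^ 3 \<Rightarrow> complex ^ 3 ^ 3"
type_synonym connection = "complex ^ 3 \<Rightarrow> 3 \<Rightarrow> 3 \<Rightarrow> 3 \<Rightarrow> complex"

definition holomorphic_one_form :: "one_form \<Rightarrow> bool" where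
  "holomorphic_one_form \<theta> \<longleftrightarrow> (\<forall>a. (\<lambda>x. \<theta> x $ a) mholomorphic_on UNIV)"

definition holomorphic_bivector :: "bivector \<Rightarrow> bool" where
  "holomorphic_bivector h \<longleftrightarrow> (\<forall>a b. (\<lambda>x. h x $ a $ b) mholomorphic_on UNIV)"

definition holomorphic_connection :: "connection \<Rightarrow> bool" where
  "holomorphic_connection \<Gamma> \<longleftrightarrow> (\<forall>c a b. (\<lambda>x. \<Gamma> x c a b) mholomorphic_on UNIV)"

definition parallel_one_form :: "connection \<Rightarrow> one_form \<Rightarrow> bool" where
  "parallel_one_form \<Gamma> \<theta> \<longleftrightarrow>
     (\<forall>x a b. partial b (\<lambda>x. \<theta> x $ a) x - (\<Sum>c\<in>UNIV. \<Gamma> x c a b * \<theta> x $ c) = 0)"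

definition parallel_bivector :: "connection \<Rightarrow> bivector \<Rightarrow> bool" where
  "parallel_bivector \<Gamma> h \<longleftrightarrow>
     (\<forall>x a b c. partial c (\<lambda>x. h x $ a $ b) x
        + (\<Sum>d\<in>UNIV. \<Gamma> x a d c * h x $ d $ b) + (\<Sum>d\<in>UNIV. \<Gamma> x b d c * h x $ a $ d) = 0)"

definition metric :: "bivector \<Rightarrow> bool" where
  "metric h \<longleftrightarrow> holomorphic_bivector h \<and> (\<forall>x. transpose (h x) = h x \<and> rank (h x) = 2)"

definition torsional_newton_cartan :: "bivector \<Rightarrow> one_form \<Rightarrow> connection \<Rightarrow> bool" where
  "torsional_newton_cartan h \<theta> \<Gamma> \<longleftrightarrow>
     metric h \<and> holomorphic_one_form \<theta> \<and> holomorphic_connection \<Gamma> \<and>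
     (\<forall>x. {\<alpha>. h x *v \<alpha> = 0} = range (\<lambda>k. k *s \<theta> x)) \<and>
     parallel_bivector \<Gamma> h \<and> parallel_one_form \<Gamma> \<theta>"

text \<open>Clocks: the first component of a frame section \<open>v = H\<^sup>-\<^sup>1 dw\<close>. The splitting \<open>H\<close> may vary
  arbitrarily with \<open>x\<close>, subject to the resulting one-form being holomorphic.\<close>

definition frame_clock :: "(complex \<Rightarrow> complex \<Rightarrow> complex) \<Rightarrow> one_form \<Rightarrow> bool" where
  "frame_clock f \<theta> \<longleftrightarrow> holomorphic_one_form \<theta> \<and>
     (\<exists>H Hh. (\<forall>x. normal_splitting f x (H x) (Hh x)) \<and>
             (\<forall>x l a. (matrix_inv (H x l) *v dsec f x l a) $ 1 = \<theta> x $ a))"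

text \<open>Torsion \<open>\<Xi>\<close>-connections. The matrix \<open>(\<rho>\<^sup>\<mu>\<^sub>\<nu>)\<^sub>b\<close> at the point \<open>x\<close> is \<open>\<rho> x b l\<close>, and
  \<open>\<rho>h x b m\<close> is its partner in the other chart.\<close>

definition torsion_Xi_connection :: "(complex \<Rightarrow> complex \<Rightarrow> complex) \<Rightarrow> connection \<Rightarrow> bool" where
  "torsion_Xi_connection f \<Gamma> \<longleftrightarrow> holomorphic_connection \<Gamma> \<and>
     (\<exists>\<rho> \<rho>h.
        (\<forall>x b. holomorphic_matrix (\<rho> x b) \<and> holomorphic_matrix (\<rho>h x b)) \<and>
        (\<forall>x b l. l \<noteq> 0 \<longrightarrow>
           (\<chi> \<mu> \<nu>. partial b (\<lambda>x. normal_patch f x l $ \<mu> $ \<nu>) x) =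
             - (\<rho>h x b (1 / l) ** normal_patch f x l) + normal_patch f x l ** \<rho> x b l) \<and>
        (\<forall>x l a b. (\<Sum>c\<in>UNIV. \<Gamma> x c a b *s dsec f x l c) =
           ddsec f x l a b + \<rho> x b l *v dsec f x l a))"

definition induced_structures ::
    "(complex \<Rightarrow> complex \<Rightarrow> complex) \<Rightarrow> (bivector \<times> one_form \<times> connection) set" where
  "induced_structures f = {(h, \<theta>, \<Gamma>).
     frame_clock f \<theta> \<and> torsion_Xi_connection f \<Gamma> \<and> parallel_one_form \<Gamma> \<theta> \<and>
     metric h \<and> (\<forall>x. h x *v \<theta> x = 0) \<and> parallel_bivector \<Gamma> h}"

text \<open>The parametrisation. Let \<open>\<theta>\<^sub>0 = dt + (\<partial>\<gamma>\<^sub>0/\<partial>y) dy\<close>, which is the clock of the frame section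
  \<open>v = (\<theta>\<^sub>0, dy + l dz)\<close>. The parameters are one-forms \<open>A, B\<close>, functions \<open>\<phi>, \<psi>\<close> and a constant
  matrix \<open>G\<close> in \<open>GL(2)\<close>; the structure is
    \<open>\<theta> = e\<^sup>\<phi> \<theta>\<^sub>0\<close>,
    \<open>\<nabla>\<theta> = 0\<close>, \<open>\<nabla>dy = - A \<theta> - d\<psi> dy\<close>, \<open>\<nabla>dz = - B \<theta> - d\<psi> dz\<close>,
    \<open>h = e\<^sup>(\<^sup>-\<^sup>2\<^sup>\<psi>\<^sup>) (G G\<^sup>T)\<^sup>i\<^sup>j E\<^sub>i E\<^sub>j\<close>,
  where \<open>E\<^sub>1 = \<partial>\<^sub>y - (\<partial>\<gamma>\<^sub>0/\<partial>y) \<partial>\<^sub>t\<close> and \<open>E\<^sub>2 = \<partial>\<^sub>z\<close> span the kernel of \<open>\<theta>\<close> and are dual to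
  \<open>dy, dz\<close>. So, up to the factor \<open>e\<^sup>-\<^sup>\<psi>\<close>,
  the columns of \<open>G\<close> are an orthonormal basis of that kernel with respect to the frame \<open>(E\<^sub>1, E\<^sub>2)\<close>.
  Nowhere vanishing functions are written as exponentials, so \<open>\<phi>\<close> and \<open>\<psi>\<close> are arbitrary.\<close>

definition dgam0 :: "(complex \<Rightarrow> complex \<Rightarrow> complex) \<Rightarrow> complex ^ 3 \<Rightarrow> complex" where
  "dgam0 f x = deriv (\<lambda>y. gam f 0 y (x $ 3)) (x $ 2)"

definition param_clock ::
    "(complex \<Rightarrow> complex \<Rightarrow> complex) \<Rightarrow> (complex ^ 3 \<Rightarrow> complex) \<Rightarrow> one_form" where
  "param_clock f \<phi> x = exp (\<phi> x) *s vector [1, dgam0 f x, 0]"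

definition param_connection ::
    "(complex \<Rightarrow> complex \<Rightarrow> complex) \<Rightarrow> one_form \<Rightarrow> one_form \<Rightarrow>
     (complex ^ 3 \<Rightarrow> complex) \<Rightarrow> (complex ^ 3 \<Rightarrow> complex) \<Rightarrow> connection" where
  "param_connection f A B \<phi> \<psi> x c a b =
     (let \<theta> = param_clock f \<phi>;
          \<Gamma>y = A x $ b * \<theta> x $ a + (if a = 2 then partial b \<psi> x else 0);
          \<Gamma>z = B x $ b * \<theta> x $ a + (if a = 3 then partial b \<psi> x else 0);
          \<Gamma>t = exp (- \<phi> x) * partial b (\<lambda>x. \<theta> x $ a) x - dgam0 f x * \<Gamma>y
      in if c = 1 then \<Gamma>t else if c = 2 then \<Gamma>y else \<Gamma>z)"

definition param_metric ::
    "(complex \<Rightarrow> complex \<Rightarrow> complex) \<Rightarrow> (complex ^ 3 \<Rightarrow> complex) \<Rightarrow> complex ^ 2 ^ 2 \<Rightarrow> bivector" where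
  "param_metric f \<psi> G x =
     (let E = vector [vector [- dgam0 f x, 0], vector [1, 0], vector [0, 1]] :: complex ^ 2 ^ 3
      in \<chi> a b. exp (- 2 * \<psi> x) * (E ** (G ** transpose G) ** transpose E) $ a $ b)"

end

theory Submission
  imports Defs
begin

no_notation fps_nth (infixl "$" 75)

text \<open>
  Along the sections, \<open>f (y + z l) l = P x l + Q x (1 / l)\<close> with \<open>P\<close> and \<open>Q\<close> entire in the second
  argument and \<open>Q x 0 = 0\<close>; both are Cauchy integrals over circles, hence jointly holomorphic. A global
  section of \<open>Z\<close> or of \<open>N\<^sub>x\<close> is then determined by Liouville's theorem. Since \<open>\<partial>f/\<partial>z = l \<partial>f/\<partial>y\<close>, the
  matrix \<open>H\<close> with rows \<open>(1, - \<partial>P/\<partial>y)\<close>, \<open>(0, 1)\<close> splits the normal bundle as \<open>\<O> \<oplus> \<O>(1)\<close>, and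
  \<open>H\<^sup>-\<^sup>1 dw = (\<theta>\<^sub>0, dy + l dz)\<close>. All other splittings and all solutions \<open>\<rho>\<close> differ from a standard one
  by endomorphisms of \<open>\<O> \<oplus> \<O>(1)\<close>, which are lower triangular with entries \<open>\<alpha>\<close>, \<open>\<beta> + \<gamma> l\<close>, \<open>\<delta>\<close>. Hence
  clocks are multiples of \<open>\<theta>\<^sub>0\<close>, and \<open>\<nabla>\<theta>\<^sub>0 = - \<alpha> \<theta>\<^sub>0\<close>, \<open>\<nabla>dy = - \<beta> \<theta>\<^sub>0 - \<delta> dy\<close>, \<open>\<nabla>dz = - \<gamma> \<theta>\<^sub>0 - \<delta> dz\<close>.
  The condition \<open>\<nabla>\<theta> = 0\<close> fixes \<open>\<alpha>\<close>. The condition \<open>\<nabla>h = 0\<close> says \<open>dh\<^sup>i\<^sup>j = - 2 \<delta> h\<^sup>i\<^sup>j\<close> on the block dual to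
  \<open>dy, dz\<close>; taking determinants shows \<open>\<delta> = d\<psi>\<close>, so \<open>e\<^sup>2\<^sup>\<psi> h\<^sup>i\<^sup>j\<close> is a constant symmetric invertible
  matrix, of the form \<open>G G\<^sup>T\<close>.
\<close>

section \<open>Holomorphic functions of several variables\<close>

text \<open>Two obstacles shape the proof. The Laurent coefficients are defined by a definite
  description for each fixed pair (y, z), so their dependence on x is not visible; the split into P
  and Q is therefore built from contour integrals, and the coefficients are identified afterwards by
  uniqueness. And all objects live in several variables, where the usable criterion is Osgood's:
  continuity plus holomorphy along the coordinate axes.

  Why the parameters come out as they do: beta and gamma are the two coefficients of a section of
  O(1), so each is a free one-form; alpha is tied to the clock; delta is free until a metric exists,
  which forces it to be exact. Both phi and psi come from logarithms of nowhere vanishing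
  holomorphic functions, global because the moduli space is C^3, which is contractible. With D the
  determinant of the block, psi is -(log D) / 4, where 4 is 2, for the two indices of h, times 2,
  the size of the block. Over the complex numbers every nondegenerate symmetric matrix is G G^T, so
  no signature enters.\<close>

lemma contour_integral_circlepath_integral:
  "contour_integral (circlepath z r) f =
     integral {0..1} (\<lambda>t. f (circlepath z r t) * (2 * pi * \<i> * r * exp (2 * of_real pi * \<i> * t)))"
  by (simp add: contour_integral_integral vector_derivative_circlepath)

text \<open>On a small ball about s0 the derivative at s is an integral of G(u, v) / (u - s)^2 over
  one fixed circle, with an integrand continuous in s, v and the circle parameter together. As v
  enters only through continuity, it may range over pairs (x, l).\<close>

lemma continuous_on_deriv_param:
  fixes G :: "complex \<Rightarrow> 'b::t2_space \<Rightarrow> complex"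
  assumes U: "open U" and cont: "continuous_on (U \<times> V) (\<lambda>(s, v). G s v)"
    and hol: "\<And>v. v \<in> V \<Longrightarrow> (\<lambda>s. G s v) holomorphic_on U"
  shows "continuous_on (U \<times> V) (\<lambda>(s, v). deriv (\<lambda>s. G s v) s)"
  unfolding continuous_on_eq_continuous_within
proof
  fix p assume "p \<in> U \<times> V"
  then obtain s0 v0 where p: "p = (s0, v0)" "s0 \<in> U" "v0 \<in> V" by auto
  obtain R where R: "R > 0" "cball s0 R \<subseteq> U" using U p open_contains_cball by blast
  \<comment> \<open>Half the radius keeps s off the circle of radius \<open>R\<close>, so the kernel
    has no pole.\<close>
  define r where "r = R / 2"
  have r: "0 < r" "r < R" using R by (auto simp: r_def)
  let ?c = "circlepath s0 R"
  let ?K = "\<lambda>q t. G (?c t) (snd q) / (?c t - fst q)\<^sup>2 * (2 * pi * \<i> * R * exp (2 * of_real pi * \<i> * of_real t))"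
  have c_in: "?c t \<in> U" for t
    using R by (auto simp: circlepath norm_mult dist_norm)
  have c_ne: "?c t \<noteq> s" if "s \<in> ball s0 r" for s t
    using that R r by (auto simp: circlepath dist_norm norm_mult)
  have "continuous_on ((ball s0 r \<times> V) \<times> cbox 0 1) (\<lambda>(q, t). ?K q t)"
  proof -
    have c: "continuous_on X (\<lambda>x. ?c (snd x))" for X :: "((complex \<times> 'b) \<times> real) set"
      unfolding circlepath by (intro continuous_intros)
    have "continuous_on ((ball s0 r \<times> V) \<times> cbox 0 1) (\<lambda>x. (\<lambda>(s, v). G s v) (?c (snd x), snd (fst x)))"
      by (intro continuous_on_compose2[OF cont] continuous_on_Pair c continuous_intros) (auto simp: c_in)
    then show ?thesis
      unfolding case_prod_unfold prod.sel
      by (intro continuous_on_mult continuous_on_divide continuous_on_power continuous_on_diff c)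
        (auto simp: c_ne intro!: continuous_intros)
  qed
  then have "continuous_on (ball s0 r \<times> V) (\<lambda>q. integral (cbox 0 1) (?K q))"
    by (rule integral_continuous_on_param)
  then have "continuous_on (ball s0 r \<times> V) (\<lambda>q. 1 / (2 * of_real pi * \<i>) * integral (cbox 0 1) (?K q))"
    by (intro continuous_intros)
  moreover have "1 / (2 * of_real pi * \<i>) * integral (cbox 0 1) (?K q) = deriv (\<lambda>s. G s (snd q)) (fst q)"
    if "q \<in> ball s0 r \<times> V" for q
  proof -
    have "(\<lambda>s. G s (snd q)) holomorphic_on cball s0 R"
      using hol[of "snd q"] that R(2) by (auto intro: holomorphic_on_subset)
    then have "((\<lambda>s. G s (snd q)) has_field_derivative
      (1 / (2 * of_real pi * \<i>) * contour_integral ?c (\<lambda>u. G u (snd q) / (u - fst q)\<^sup>2))) (at (fst q))"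
      using that r by (intro Cauchy_derivative_integral_circlepath)
        (auto intro: holomorphic_on_imp_continuous_on holomorphic_on_subset)
    then show ?thesis
      by (simp add: DERIV_imp_deriv contour_integral_circlepath_integral)
  qed
  ultimately have "continuous_on (ball s0 r \<times> V) (\<lambda>(s, v). deriv (\<lambda>s. G s v) s)"
    by (subst continuous_on_cong[OF refl]) (auto simp: case_prod_unfold)
  then have "continuous (at p within ball s0 r \<times> V) (\<lambda>(s, v). deriv (\<lambda>s. G s v) s)"
    using p r by (auto simp: continuous_on_eq_continuous_within)
  moreover have "at p within ball s0 r \<times> V = at p within U \<times> V"
    using p r R by (intro at_within_nhd[where S = "ball s0 r \<times> UNIV"])
      (auto intro: open_Times simp: subset_iff)
  ultimately show "continuous (at p within U \<times> V) (\<lambda>(s, v). deriv (\<lambda>s. G s v) s)"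
    by simp
qed

text \<open>Differentiation under the integral sign; the joint continuity of the derivative that it
  requires comes from \<open>continuous_on_deriv_param\<close>. The argument is local because the
  Leibniz rule asks for a convex set.\<close>

lemma holomorphic_on_integral_param:
  fixes G :: "complex \<Rightarrow> real \<Rightarrow> complex"
  assumes U: "open U" and cont: "continuous_on (U \<times> {a..b}) (\<lambda>(s, t). G s t)"
    and hol: "\<And>t. t \<in> {a..b} \<Longrightarrow> (\<lambda>s. G s t) holomorphic_on U"
  shows "(\<lambda>s. integral {a..b} (G s)) holomorphic_on U"
proof -
  have "\<exists>r>0. (\<lambda>s. integral {a..b} (G s)) holomorphic_on ball s0 r" if "s0 \<in> U" for s0
  proof -
    obtain r where r: "r > 0" "ball s0 r \<subseteq> U" by (rule openE[OF U \<open>s0 \<in> U\<close>])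
    have "(\<lambda>s. integral (cbox a b) (G s)) holomorphic_on ball s0 r"
    proof (rule leibniz_rule_holomorphic)
      fix x t assume "x \<in> ball s0 r" "t \<in> cbox a b"
      then show "((\<lambda>x. G x t) has_field_derivative deriv (\<lambda>x. G x t) x) (at x within ball s0 r)"
        using r by (intro holomorphic_derivI[OF hol U]) auto
    next
      fix x assume x: "x \<in> ball s0 r"
      have "continuous_on (cbox a b) (\<lambda>t. (\<lambda>(s, t). G s t) (x, t))"
        using x r by (intro continuous_on_compose2[OF cont] continuous_intros) auto
      then show "G x integrable_on cbox a b" by (auto intro: integrable_continuous_interval)
    next
      show "continuous_on (ball s0 r \<times> cbox a b) (\<lambda>(x, t). deriv (\<lambda>x. G x t) x)"
        using r by (intro continuous_on_subset[OF continuous_on_deriv_param[OF U cont hol]]) auto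
    qed auto
    then show ?thesis using r by auto
  qed
  then show ?thesis
    unfolding holomorphic_on_open[OF U] by (meson centre_in_ball holomorphic_on_open open_ball)
qed

text \<open>By Cauchy's formula the derivative in \<open>s\<close> is an integral of functions holomorphic in \<open>v\<close>.\<close>

lemma holomorphic_on_deriv_param:
  fixes G :: "complex \<Rightarrow> complex \<Rightarrow> complex"
  assumes U: "open U" "s0 \<in> U" and V: "open V" and cont: "continuous_on (U \<times> V) (\<lambda>(s, v). G s v)"
    and hol1: "\<And>v. v \<in> V \<Longrightarrow> (\<lambda>s. G s v) holomorphic_on U"
    and hol2: "\<And>s. s \<in> U \<Longrightarrow> (\<lambda>v. G s v) holomorphic_on V"
  shows "(\<lambda>v. deriv (\<lambda>s. G s v) s0) holomorphic_on V"
proof -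
  obtain R where R: "R > 0" "cball s0 R \<subseteq> U" using U by (meson open_contains_cball)
  let ?c = "circlepath s0 R"
  let ?K = "\<lambda>v t. G (?c t) v / (?c t - s0)\<^sup>2 * (2 * pi * \<i> * R * exp (2 * of_real pi * \<i> * of_real t))"
  have c_in: "?c t \<in> U" for t
    using R by (auto simp: circlepath norm_mult dist_norm)
  have c_ne: "?c t \<noteq> s0" for t
    using R by (auto simp: circlepath)
  have "(\<lambda>v. 1 / (2 * of_real pi * \<i>) * integral {0..1} (?K v)) holomorphic_on V"
  proof (intro holomorphic_intros holomorphic_on_integral_param V)
    have c: "continuous_on X (\<lambda>x. ?c (snd x))" for X :: "(complex \<times> real) set"
      unfolding circlepath by (intro continuous_intros)
    have "continuous_on (V \<times> {0..1}) (\<lambda>x. (\<lambda>(s, v). G s v) (?c (snd x), fst x))"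
      by (intro continuous_on_compose2[OF cont] continuous_on_Pair c continuous_intros) (auto simp: c_in)
    then show "continuous_on (V \<times> {0..1}) (\<lambda>(v, t). ?K v t)"
      unfolding case_prod_unfold prod.sel
      by (intro continuous_on_mult continuous_on_divide continuous_on_power continuous_on_diff c)
        (auto simp: c_ne intro!: continuous_intros)
  qed (use c_ne in \<open>auto intro!: hol2 c_in holomorphic_intros\<close>)
  moreover have "1 / (2 * of_real pi * \<i>) * integral {0..1} (?K v) = deriv (\<lambda>s. G s v) s0"
    if "v \<in> V" for v
  proof -
    have "(\<lambda>s. G s v) holomorphic_on cball s0 R"
      using hol1[of v] that R(2) by (auto intro: holomorphic_on_subset)
    then have "((\<lambda>s. G s v) has_field_derivative
      (1 / (2 * of_real pi * \<i>) * contour_integral ?c (\<lambda>u. G u v / (u - s0)\<^sup>2))) (at s0)"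
      using R by (intro Cauchy_derivative_integral_circlepath)
        (auto intro: holomorphic_on_imp_continuous_on holomorphic_on_subset)
    then show ?thesis
      by (simp add: DERIV_imp_deriv contour_integral_circlepath_integral)
  qed
  ultimately show ?thesis
    by (rule holomorphic_transform)
qed

text \<open>Cauchy's formula turns the v-derivative at \<open>b\<close> into an integral over the
  unit circle about \<open>b\<close>. The s-derivative passes inside and leaves a function
  holomorphic in v, so the same formula read backwards gives the other order.\<close>

lemma deriv_commute:
  fixes G :: "complex \<Rightarrow> complex \<Rightarrow> complex"
  assumes cont: "continuous_on (UNIV \<times> UNIV) (\<lambda>(s, v). G s v)"
    and hol1: "\<And>v. (\<lambda>s. G s v) holomorphic_on UNIV"
    and hol2: "\<And>s. (\<lambda>v. G s v) holomorphic_on UNIV"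
  shows "deriv (\<lambda>s. deriv (\<lambda>v. G s v) b) a = deriv (\<lambda>v. deriv (\<lambda>s. G s v) a) b"
proof -
  let ?c = "circlepath b 1"
  \<comment> \<open>Reciprocal of the Cauchy kernel times the velocity of the circle, so that every
    integrand below is a plain quotient.\<close>
  let ?J = "\<lambda>t :: real. (?c t - b)\<^sup>2 / (2 * pi * \<i> * exp (2 * of_real pi * \<i> * t))"
  have c_ne: "?c t - b \<noteq> 0" for t by (simp add: circlepath)
  have c: "continuous_on X (\<lambda>x. ?c (snd x))" for X :: "(complex \<times> real) set"
    unfolding circlepath by (intro continuous_intros)
  have cauchy: "deriv F b = 1 / (2 * of_real pi * \<i>) * integral (cbox 0 1) (\<lambda>t. F (?c t) / ?J t)"
    if "F holomorphic_on UNIV" for F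
  proof -
    have "(F has_field_derivative
      (1 / (2 * of_real pi * \<i>) * contour_integral ?c (\<lambda>u. F u / (u - b)\<^sup>2))) (at b)"
      using that by (intro Cauchy_derivative_integral_circlepath)
        (auto intro: holomorphic_on_imp_continuous_on holomorphic_on_subset)
    then show ?thesis
      by (simp add: DERIV_imp_deriv contour_integral_circlepath_integral)
  qed
  have contJ: "continuous_on (UNIV \<times> cbox 0 1) (\<lambda>(s, t). K s (?c t) / ?J t)"
    if "continuous_on (UNIV \<times> UNIV) (\<lambda>(s, v). K s v)" for K :: "complex \<Rightarrow> complex \<Rightarrow> complex"
  proof -
    have "continuous_on (UNIV \<times> cbox 0 1) (\<lambda>x. (\<lambda>(s, v). K s v) (fst x, ?c (snd x)))"
      by (intro continuous_on_compose2[OF that] continuous_on_Pair c continuous_intros) auto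
    moreover have "continuous_on ((UNIV :: complex set) \<times> cbox 0 1) (\<lambda>x. ?J (snd x))"
      using c_ne by (intro continuous_intros c) auto
    ultimately have "continuous_on (UNIV \<times> cbox 0 1) (\<lambda>x. (\<lambda>(s, v). K s v) (fst x, ?c (snd x)) / ?J (snd x))"
      by (rule continuous_on_divide) (use c_ne in simp)
    then show ?thesis by (simp only: case_prod_unfold fst_conv snd_conv)
  qed
  have cont': "continuous_on (UNIV \<times> UNIV) (\<lambda>(s, v). deriv (\<lambda>s. G s v) s)"
    by (rule continuous_on_deriv_param[OF open_UNIV cont hol1])
  have "((\<lambda>s. integral (cbox 0 1) (\<lambda>t. G s (?c t) / ?J t)) has_field_derivative
      integral (cbox 0 1) (\<lambda>t. deriv (\<lambda>s. G s (?c t)) a / ?J t)) (at a within UNIV)"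
  proof (rule leibniz_rule_field_derivative)
    fix x :: complex and t :: real
    show "((\<lambda>x. G x (?c t) / ?J t) has_field_derivative deriv (\<lambda>s. G s (?c t)) x / ?J t) (at x within UNIV)"
      by (intro DERIV_cdivide holomorphic_derivI[OF hol1]) auto
    have "continuous_on (cbox 0 1) (\<lambda>t. (\<lambda>(s, t). G s (?c t) / ?J t) (x, t))"
      by (intro continuous_on_compose2[OF contJ[OF cont]] continuous_intros) auto
    then show "(\<lambda>t. G x (?c t) / ?J t) integrable_on cbox 0 1"
      by (intro integrable_continuous) simp
  qed (use contJ[OF cont'] in auto)
  then have "deriv (\<lambda>s. deriv (\<lambda>v. G s v) b) a =
      1 / (2 * of_real pi * \<i>) * integral (cbox 0 1) (\<lambda>t. deriv (\<lambda>s. G s (?c t)) a / ?J t)"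
    unfolding cauchy[OF hol2] by (intro DERIV_imp_deriv DERIV_cmult) simp
  also have "\<dots> = deriv (\<lambda>v. deriv (\<lambda>s. G s v) a) b"
    by (rule cauchy[symmetric], rule holomorphic_on_deriv_param[OF open_UNIV UNIV_I open_UNIV cont hol1 hol2])
  finally show ?thesis .
qed

lemma axis_zero [simp]: "axis i 0 = 0"
  by (simp add: axis_def vec_eq_iff)

lemma linear_axis: "linear (axis i :: complex \<Rightarrow> complex ^ 'n)"
  by (rule linearI) (auto simp: axis_def vec_eq_iff)

lemma continuous_on_axis: "continuous_on X (axis k :: complex \<Rightarrow> complex ^ 'n)"
  using linear_axis linear_continuous_on linear_conv_bounded_linear by blast

lemma continuous_on_compose_axis:
  assumes "continuous_on X g" shows "continuous_on X (\<lambda>x. axis k (g x) :: complex ^ 'n)"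
  by (rule continuous_on_compose2[OF continuous_on_axis[of UNIV] assms]) auto

lemma mholomorphic_on_imp_continuous_on:
  "F mholomorphic_on S \<Longrightarrow> continuous_on S F"
  unfolding mholomorphic_on_def
  by (meson continuous_at_imp_continuous_on has_derivative_continuous)

text \<open>Complex linearity makes \<open>D\<close> on an axis multiplication by the number
  \<open>D (axis i 1)\<close>, which turns a Frechet derivative into a complex one.
  \<open>partial\<close> differentiates at 0, hence the shift of the base point by
  \<open>s0\<close>.\<close>

lemma mholomorphic_on_axis_DERIV:
  assumes "F mholomorphic_on S" "p + axis i s0 \<in> S"
  shows "((\<lambda>s. F (p + axis i s)) has_field_derivative partial i F (p + axis i s0)) (at s0)"
proof -
  define q where "q = p + axis i s0"
  obtain D where D: "(F has_derivative D) (at q)" and lin: "\<And>c v. D (c *s v) = c * D v"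
    using assms by (auto simp: mholomorphic_on_def q_def)
  have "((\<lambda>s. q + axis i s) has_derivative axis i) (at 0)"
    using linear_axis[of i] by (auto intro!: derivative_eq_intros linear_imp_has_derivative)
  moreover have "(F has_derivative D) (at (q + axis i 0))"
    using D by simp
  ultimately have "((\<lambda>s. F (q + axis i s)) has_derivative (\<lambda>s. D (axis i s))) (at 0)"
    by (rule has_derivative_compose)
  moreover have "D (axis i s) = D (axis i 1) * s" for s
  proof -
    have "axis i s = s *s axis i 1" by (auto simp: axis_def vec_eq_iff)
    then show ?thesis using lin by simp
  qed
  then have "(\<lambda>s. D (axis i s)) = (*) (D (axis i 1))"
    by (intro ext)
  ultimately have "((\<lambda>s. F (q + axis i s)) has_field_derivative D (axis i 1)) (at 0)"
    unfolding has_field_derivative_def by metis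
  then have 1: "((\<lambda>s. F (q + axis i s)) has_field_derivative partial i F q) (at 0)"
    by (simp add: partial_def DERIV_imp_deriv)
  have "q + axis i s = p + axis i (s + s0)" for s
    by (auto simp: q_def vec_eq_iff axis_def)
  then have "((\<lambda>s. F (p + axis i (s + s0))) has_field_derivative partial i F q) (at 0)"
    using 1 by simp
  then show ?thesis
    unfolding q_def[symmetric] using DERIV_shift[of "\<lambda>s. F (p + axis i s)" _ 0 s0] by simp
qed

lemma mholomorphic_on_partial_DERIV:
  assumes "F mholomorphic_on S" "p \<in> S"
  shows "((\<lambda>s. F (p + axis i s)) has_field_derivative partial i F p) (at 0)"
  using mholomorphic_on_axis_DERIV[of F S p i 0] assms by simp

lemma mholomorphic_on_axis_holomorphic_on:
  assumes "F mholomorphic_on UNIV"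
  shows "(\<lambda>s. F (p + axis i s)) holomorphic_on UNIV"
  using mholomorphic_on_axis_DERIV[OF assms UNIV_I]
  by (auto simp: holomorphic_on_open)

text \<open>Osgood's lemma: the partial derivatives are continuous by Cauchy's formula, and the mean value
  inequality, applied to one coordinate after the other, yields the total derivative.\<close>

lemma partial_continuous:
  fixes F :: "complex ^ 'n \<Rightarrow> complex"
  assumes cont: "continuous_on UNIV F" and hol: "\<And>p. (\<lambda>s. F (p + axis i s)) holomorphic_on UNIV"
  shows "continuous_on UNIV (partial i F)"
proof -
  have "continuous_on (UNIV \<times> UNIV) (\<lambda>(s, p). F (p + axis i s))"
    unfolding case_prod_unfold
    by (intro continuous_on_compose2[OF cont] continuous_on_add continuous_on_compose_axis continuous_intros) auto
  from continuous_on_deriv_param[OF open_UNIV this hol]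
  have "continuous_on UNIV (\<lambda>(s, p). deriv (\<lambda>s. F (p + axis i s)) s)" by simp
  then have "continuous_on UNIV (\<lambda>p. (\<lambda>(s, p). deriv (\<lambda>s. F (p + axis i s)) s) (0, p))"
    by (rule continuous_on_compose2) (auto intro!: continuous_intros)
  then show ?thesis by (simp add: partial_def[abs_def])
qed

lemma osgood_has_derivative:
  fixes F :: "complex ^ 'n \<Rightarrow> complex"
  assumes cont: "continuous_on UNIV F" and hol: "\<And>i p. (\<lambda>s. F (p + axis i s)) holomorphic_on UNIV"
  shows "(F has_derivative (\<lambda>v. \<Sum>i\<in>UNIV. v $ i * partial i F p)) (at p)"
proof -
  \<comment> \<open>Increments supported on the coordinates in \<open>I\<close>; the induction below
    switches on one coordinate at a time.\<close>
  define pr where "pr I h = (\<chi> i. if i \<in> I then h $ i else 0)" for I and h :: "complex ^ 'n"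
  have pr_le: "norm (pr I h) \<le> norm h" for I h
    by (rule norm_le_componentwise_cart) (auto simp: pr_def)
  have D: "((\<lambda>s. F (q + axis i s)) has_field_derivative partial i F (q + axis i s)) (at s)" for q i s
  proof -
    have "q + axis i s + axis i t = q + axis i (t + s)" for t
      by (auto simp: vec_eq_iff axis_def)
    then have 1: "partial i F (q + axis i s) = deriv (\<lambda>t. F (q + axis i (t + s))) 0"
      unfolding partial_def by presburger
    have 2: "((\<lambda>t. F (q + axis i t)) has_field_derivative deriv (\<lambda>t. F (q + axis i t)) s) (at s)"
      by (rule holomorphic_derivI[OF hol[of q i]]) auto
    then have "((\<lambda>t. F (q + axis i (t + s))) has_field_derivative deriv (\<lambda>t. F (q + axis i t)) s) (at 0)"
      using DERIV_shift[of "\<lambda>t. F (q + axis i t)" _ 0 s] by simp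
    from DERIV_imp_deriv[OF this] 2 show ?thesis
      by (simp only: 1)
  qed
  have "((\<lambda>h. F (p + pr I h)) has_derivative (\<lambda>v. \<Sum>i\<in>I. v $ i * partial i F p)) (at 0)" for I
  proof (induction I rule: finite_induct[OF finite])
    case 1
    show ?case by (simp add: pr_def zero_vec_def[symmetric])
  next
    case (2 j I)
    have "((\<lambda>h. F (p + pr I h + axis j (h $ j)) - F (p + pr I h)) has_derivative
          (\<lambda>v. v $ j * partial j F p)) (at 0)"
      unfolding has_derivative_within_alt
    proof (intro conjI allI impI)
      have "linear (\<lambda>v. v $ j * partial j F p)"
        by (rule linearI) (auto simp: algebra_simps)
      then show "bounded_linear (\<lambda>v. v $ j * partial j F p)"
        by (simp add: linear_conv_bounded_linear)
    next
      fix e :: real assume "e > 0"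
      then obtain d where d: "d > 0" "\<And>q. dist q p < d \<Longrightarrow> dist (partial j F q) (partial j F p) < e"
        using partial_continuous[OF cont hol, of j] unfolding continuous_on_iff by (metis UNIV_I)
      show "\<exists>d>0. \<forall>y\<in>UNIV. norm (y - 0) < d \<longrightarrow>
          norm (F (p + pr I y + axis j (y $ j)) - F (p + pr I y) - (F (p + pr I 0 + axis j (0 $ j)) - F (p + pr I 0))
             - (y - 0) $ j * partial j F p) \<le> e * norm (y - 0)"
      \<comment> \<open>Both \<open>pr I h\<close> and \<open>axis j s\<close> have norm at most
        that of \<open>h\<close>, so their sum stays within \<open>d\<close> of the base
        point.\<close>
      proof (intro exI[of _ "d / 2"] conjI ballI impI)
        fix h :: "complex ^ 'n" assume h: "norm (h - 0) < d / 2"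
        define q where "q = p + pr I h"
        \<comment> \<open>Subtracting the linear term leaves a function with small derivative, so
          the mean value inequality bounds the error of the new coordinate.\<close>
        let ?f = "\<lambda>s. F (q + axis j s) - s * partial j F p"
        have "norm (?f (h $ j) - ?f 0) \<le> e * norm (h $ j - 0)"
        proof (rule field_differentiable_bound[where S = "cball 0 (norm (h $ j))"])
          fix s :: complex assume s: "s \<in> cball 0 (norm (h $ j))"
          show "(?f has_field_derivative partial j F (q + axis j s) - partial j F p)
             (at s within cball 0 (norm (h $ j)))"
            by (rule has_field_derivative_at_within) (auto intro!: derivative_eq_intros D)
          have "norm (axis j s :: complex ^ 'n) \<le> norm h"
            by (intro norm_le_componentwise_cart) (use s in \<open>auto simp: axis_def\<close>)
          then have "dist (q + axis j s) p < d"
            using h pr_le[of I h] norm_triangle_ineq[of "pr I h" "axis j s"]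
            by (simp add: dist_norm q_def)
          then show "norm (partial j F (q + axis j s) - partial j F p) \<le> e"
            using d(2) by (fastforce simp: dist_norm)
        qed auto
        also have "\<dots> \<le> e * norm (h - 0)"
          using \<open>e > 0\<close> Finite_Cartesian_Product.norm_nth_le[of h j] by (auto intro!: mult_left_mono)
        finally show "norm (F (p + pr I h + axis j (h $ j)) - F (p + pr I h) - (F (p + pr I 0 + axis j (0 $ j)) - F (p + pr I 0))
             - (h - 0) $ j * partial j F p) \<le> e * norm (h - 0)"
          by (simp add: q_def linear_0[OF linear_axis] algebra_simps)
      qed (use d in auto)
    qed
    from has_derivative_add[OF this 2(3)]
    have "((\<lambda>h. F (p + pr I h + axis j (h $ j))) has_derivative
        (\<lambda>v. \<Sum>i\<in>insert j I. v $ i * partial i F p)) (at 0)"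
      using 2 by simp
    moreover have "p + pr I h + axis j (h $ j) = p + pr (insert j I) h" for h
      using 2 by (auto simp: vec_eq_iff axis_def pr_def)
    ultimately show ?case by simp
  qed
  from this[of UNIV] have "((\<lambda>h. F (p + h)) has_derivative (\<lambda>v. \<Sum>i\<in>UNIV. v $ i * partial i F p)) (at 0)"
    by (simp add: pr_def)
  moreover have "((\<lambda>q. q - p) has_derivative (\<lambda>v. v)) (at p)"
    by (auto intro!: derivative_eq_intros)
  ultimately show ?thesis
    using has_derivative_compose[of "\<lambda>q. q - p" "\<lambda>v. v" p UNIV "\<lambda>h. F (p + h)"] by simp
qed

text \<open>Osgood's criterion reduces the closure rules below to continuity and one-variable
  holomorphy.\<close>

lemma mholomorphic_on_UNIV_iff:
  "F mholomorphic_on UNIV \<longleftrightarrow>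
     continuous_on UNIV F \<and> (\<forall>i p. (\<lambda>s. F (p + axis i s)) holomorphic_on UNIV)"
  (is "_ \<longleftrightarrow> ?R")
proof
  assume ?R
  show "F mholomorphic_on UNIV"
    unfolding mholomorphic_on_def
  proof (intro ballI exI conjI allI)
    fix p
    show "(F has_derivative (\<lambda>v. \<Sum>i\<in>UNIV. v $ i * partial i F p)) (at p)"
      using \<open>?R\<close> by (blast intro: osgood_has_derivative)
  qed (simp add: sum_distrib_left mult.assoc)
qed (auto intro: mholomorphic_on_imp_continuous_on mholomorphic_on_axis_holomorphic_on)

lemma mholomorphic_on_const [simp]: "(\<lambda>x. c) mholomorphic_on UNIV"
  by (auto simp: mholomorphic_on_UNIV_iff)

lemma mholomorphic_on_nth [simp]: "(\<lambda>x. x $ i) mholomorphic_on UNIV"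
proof -
  have "(\<lambda>s. (p + axis k s) $ i) holomorphic_on UNIV" for p k
    by (cases "k = i") (auto simp: axis_def intro!: holomorphic_intros)
  then show ?thesis
    by (auto simp: mholomorphic_on_UNIV_iff intro!: continuous_intros)
qed

lemma mholomorphic_on_add:
  "F mholomorphic_on UNIV \<Longrightarrow> G mholomorphic_on UNIV \<Longrightarrow> (\<lambda>x. F x + G x) mholomorphic_on UNIV"
  by (auto simp: mholomorphic_on_UNIV_iff intro!: continuous_intros holomorphic_intros)

lemma mholomorphic_on_minus:
  "F mholomorphic_on UNIV \<Longrightarrow> (\<lambda>x. - F x) mholomorphic_on UNIV"
  by (auto simp: mholomorphic_on_UNIV_iff intro!: continuous_intros holomorphic_intros)

lemma mholomorphic_on_diff:
  "F mholomorphic_on UNIV \<Longrightarrow> G mholomorphic_on UNIV \<Longrightarrow> (\<lambda>x. F x - G x) mholomorphic_on UNIV"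
  by (auto simp: mholomorphic_on_UNIV_iff intro!: continuous_intros holomorphic_intros)

lemma mholomorphic_on_mult:
  "F mholomorphic_on UNIV \<Longrightarrow> G mholomorphic_on UNIV \<Longrightarrow> (\<lambda>x. F x * G x) mholomorphic_on UNIV"
  by (auto simp: mholomorphic_on_UNIV_iff intro!: continuous_intros holomorphic_intros)

lemma mholomorphic_on_exp:
  "F mholomorphic_on UNIV \<Longrightarrow> (\<lambda>x. exp (F x)) mholomorphic_on UNIV"
  by (auto simp: mholomorphic_on_UNIV_iff intro!: continuous_intros holomorphic_intros
    holomorphic_on_compose_gen[unfolded o_def, of _ _ exp UNIV])

lemma mholomorphic_on_partial:
  fixes F :: "complex ^ 'n \<Rightarrow> complex"
  assumes F: "F mholomorphic_on UNIV"
  shows "partial i F mholomorphic_on UNIV"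
  unfolding mholomorphic_on_UNIV_iff
proof (intro conjI allI)
  have cont: "continuous_on UNIV F" and hol: "\<And>i p. (\<lambda>s. F (p + axis i s)) holomorphic_on UNIV"
    using F by (auto simp: mholomorphic_on_UNIV_iff)
  show "continuous_on UNIV (partial i F)"
    by (rule partial_continuous[OF cont hol])
  fix j p
  have "(\<lambda>v. deriv (\<lambda>s. F (p + axis j v + axis i s)) 0) holomorphic_on UNIV"
  proof (rule holomorphic_on_deriv_param[OF open_UNIV UNIV_I open_UNIV])
    show "continuous_on (UNIV \<times> UNIV) (\<lambda>(s, v). F (p + axis j v + axis i s))"
      unfolding case_prod_unfold
      by (intro continuous_on_compose2[OF cont] continuous_on_add continuous_on_compose_axis
        continuous_on_const continuous_on_fst continuous_on_snd continuous_on_id) auto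
    show "(\<lambda>v. F (p + axis j v + axis i s)) holomorphic_on UNIV" for s
      using hol[of "p + axis i s" j] by (simp add: add.assoc add.commute[of "axis j _"])
  qed (rule hol)
  then show "(\<lambda>s. partial i F (p + axis j s)) holomorphic_on UNIV"
    by (simp add: partial_def)
qed

lemma partial_commute:
  assumes "F mholomorphic_on UNIV"
  shows "partial i (partial j F) p = partial j (partial i F) p"
proof -
  have cont: "continuous_on UNIV F" and hol: "\<And>i p. (\<lambda>s. F (p + axis i s)) holomorphic_on UNIV"
    using assms by (auto simp: mholomorphic_on_UNIV_iff)
  have ac: "p + axis i s + axis j v = p + axis j v + axis i s" for s v
    by (simp add: add.assoc add.commute[of "axis i _"])
  have "continuous_on (UNIV \<times> UNIV) (\<lambda>(s, v). F (p + axis i s + axis j v))"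
    unfolding case_prod_unfold
    by (intro continuous_on_compose2[OF cont] continuous_intros continuous_on_compose_axis) auto
  from deriv_commute[OF this, of 0 0]
  have "deriv (\<lambda>s. deriv (\<lambda>v. F (p + axis i s + axis j v)) 0) 0 =
      deriv (\<lambda>v. deriv (\<lambda>s. F (p + axis i s + axis j v)) 0) 0"
    using hol hol[of "p + axis j _" i, folded ac] by blast
  then show ?thesis unfolding partial_def ac .
qed

text \<open>For fixed (y, z) the point (y + z l, l) runs along a straight complex line in the domain
  of \<open>f\<close>. There \<open>l = 0\<close> is excluded and the criterion on
  \<open>UNIV\<close> does not apply.\<close>

lemma mholomorphic_on_line:
  assumes "F mholomorphic_on S" "p + l *s v \<in> S"
  shows "(\<lambda>l. F (p + l *s v)) field_differentiable (at l)"
proof -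
  obtain D where D: "(F has_derivative D) (at (p + l *s v))" and lin: "\<And>c v. D (c *s v) = c * D v"
    using assms by (auto simp: mholomorphic_on_def)
  have "linear (\<lambda>l. l *s v)"
    by (rule linearI) (simp_all add: vec_eq_iff algebra_simps)
  then have "((\<lambda>l. p + l *s v) has_derivative (\<lambda>l. l *s v)) (at l)"
    by (auto intro!: derivative_eq_intros linear_imp_has_derivative)
  from has_derivative_compose[OF this D]
  have "((\<lambda>l. F (p + l *s v)) has_derivative (*) (D v)) (at l)"
    by (simp add: lin mult.commute[of _ "D v"])
  then show ?thesis
    unfolding field_differentiable_def has_field_derivative_def by blast
qed

lemma mholomorphic_has_derivative:
  assumes "F mholomorphic_on UNIV"
  shows "(F has_derivative (\<lambda>v. \<Sum>i\<in>UNIV. v $ i * partial i F p)) (at p)"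
  using assms osgood_has_derivative by (auto simp: mholomorphic_on_UNIV_iff)

lemma mholomorphic_partial_zero_imp_const:
  assumes "F mholomorphic_on UNIV" "\<And>i p. partial i F p = 0"
  shows "F p = F q"
proof -
  have "(F has_derivative (\<lambda>_. 0)) (at x)" for x
    using mholomorphic_has_derivative[OF assms(1)] assms(2) by simp
  then obtain c where "\<And>x. F x = c"
    using has_derivative_zero_unique by (metis has_derivative_zero_constant convex_UNIV UNIV_I)
  then show ?thesis by simp
qed

section \<open>Partial derivatives of elementary expressions\<close>

lemma partial_const [simp]: "partial i (\<lambda>x. c) p = 0"
  by (simp add: partial_def)

lemma partial_nth: "partial i (\<lambda>x. x $ j) p = (if i = j then 1 else 0)"
proof (cases "i = j")
  case True
  have "((\<lambda>s. p $ j + s) has_field_derivative 1) (at 0)" by (auto intro!: derivative_eq_intros)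
  then show ?thesis using True by (simp add: partial_def axis_def DERIV_imp_deriv)
qed (simp add: partial_def axis_def)

lemma partial_add:
  "F mholomorphic_on UNIV \<Longrightarrow> G mholomorphic_on UNIV \<Longrightarrow> partial i (\<lambda>x. F x + G x) p = partial i F p + partial i G p"
  unfolding partial_def[of i "\<lambda>x. F x + G x"]
  by (rule DERIV_imp_deriv) (auto intro!: derivative_eq_intros mholomorphic_on_partial_DERIV)

lemma partial_diff:
  "F mholomorphic_on UNIV \<Longrightarrow> G mholomorphic_on UNIV \<Longrightarrow> partial i (\<lambda>x. F x - G x) p = partial i F p - partial i G p"
  unfolding partial_def[of i "\<lambda>x. F x - G x"]
  by (rule DERIV_imp_deriv) (auto intro!: derivative_eq_intros mholomorphic_on_partial_DERIV)

lemma partial_minus: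
  "F mholomorphic_on UNIV \<Longrightarrow> partial i (\<lambda>x. - F x) p = - partial i F p"
  unfolding partial_def[of i "\<lambda>x. - F x"]
  by (rule DERIV_imp_deriv) (auto intro!: derivative_eq_intros mholomorphic_on_partial_DERIV)

lemma partial_mult:
  "F mholomorphic_on UNIV \<Longrightarrow> G mholomorphic_on UNIV \<Longrightarrow>
    partial i (\<lambda>x. F x * G x) p = partial i F p * G p + F p * partial i G p"
  unfolding partial_def[of i "\<lambda>x. F x * G x"]
  by (rule DERIV_imp_deriv)
    (rule derivative_eq_intros mholomorphic_on_partial_DERIV | assumption | simp)+

lemma partial_cmult:
  "F mholomorphic_on UNIV \<Longrightarrow> partial i (\<lambda>x. c * F x) p = c * partial i F p"
  by (subst partial_mult) auto

lemma partial_exp: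
  "F mholomorphic_on UNIV \<Longrightarrow> partial i (\<lambda>x. exp (F x)) p = exp (F p) * partial i F p"
  unfolding partial_def[of i "\<lambda>x. exp (F x)"]
  by (rule DERIV_imp_deriv)
    (rule derivative_eq_intros mholomorphic_on_partial_DERIV | assumption | simp)+

text \<open>Near any \<open>s0\<close> the difference \<open>g s - g s0\<close> has imaginary part
  below pi in modulus by continuity, so the principal logarithm of its exponential, a holomorphic
  function, recovers it.\<close>

lemma holomorphic_on_continuous_log:
  assumes cont: "continuous_on UNIV g" and hol: "(\<lambda>s. exp (g s)) holomorphic_on UNIV"
  shows "g holomorphic_on UNIV"
  unfolding holomorphic_on_open[OF open_UNIV]
proof
  fix s0 :: complex
  define E where "E s = exp (g s - g s0)" for s
  have E: "E holomorphic_on UNIV"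
    unfolding E_def exp_diff by (intro holomorphic_intros hol) auto
  have "isCont g s0" using cont by (simp add: continuous_on_eq_continuous_at)
  then obtain d where d: "d > 0" "\<And>s. dist s s0 < d \<Longrightarrow> dist (g s) (g s0) < pi"
    using pi_gt_zero unfolding continuous_at_eps_delta by blast
  have g: "g s = g s0 + Ln (E s)" if "s \<in> ball s0 d" for s
  proof -
    have "\<bar>Im (g s - g s0)\<bar> < pi"
      using d(2)[of s] that abs_Im_le_cmod[of "g s - g s0"] by (simp add: dist_norm norm_minus_commute)
    then show ?thesis unfolding E_def by (subst Ln_exp) auto
  qed
  have E0: "E s0 = 1" by (simp add: E_def)
  have "((\<lambda>s. Ln (E s)) has_field_derivative inverse (E s0) * deriv E s0) (at s0)"
    by (intro DERIV_chain2[OF has_field_derivative_Ln] holomorphic_derivI[OF E]) (simp_all add: E0)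
  from DERIV_add[OF DERIV_const[of "g s0"] this]
  have "((\<lambda>s. g s0 + Ln (E s)) has_field_derivative deriv E s0) (at s0)"
    by (simp add: E0)
  then have "(g has_field_derivative deriv E s0) (at s0)"
    by (rule has_field_derivative_transform_within_open[where S = "ball s0 d"]) (simp_all add: d(1) g[symmetric])
  then show "\<exists>f'. (g has_field_derivative f') (at s0)" by blast
qed

text \<open>A contractible domain gives a continuous logarithm, which is holomorphic along every
  axis by the previous lemma. This is what allows arbitrary functions as parameters of clocks and
  metrics.\<close>

lemma mholomorphic_logarithm:
  fixes F :: "complex ^ 'n \<Rightarrow> complex"
  assumes F: "F mholomorphic_on UNIV" and nz: "\<And>x. F x \<noteq> 0"
  obtains \<phi> where "\<phi> mholomorphic_on UNIV" "\<And>x. F x = exp (\<phi> x)"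
proof -
  obtain g where g: "continuous_on UNIV g" "\<And>x. x \<in> UNIV \<Longrightarrow> F x = exp (g x)"
    using continuous_logarithm_on_contractible[of UNIV F] nz
      mholomorphic_on_imp_continuous_on[OF F] convex_imp_contractible[OF convex_UNIV] by blast
  have "g mholomorphic_on UNIV"
    unfolding mholomorphic_on_UNIV_iff
  proof (intro conjI allI)
    fix p i
    show "(\<lambda>s. g (p + axis i s)) holomorphic_on UNIV"
    proof (rule holomorphic_on_continuous_log)
      show "continuous_on UNIV (\<lambda>s. g (p + axis i s))"
        by (intro continuous_on_compose2[OF g(1)] continuous_on_add continuous_on_const continuous_on_axis) auto
      show "(\<lambda>s. exp (g (p + axis i s))) holomorphic_on UNIV"
        using mholomorphic_on_axis_holomorphic_on[OF F, of p i] g(2) by simp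
    qed
  qed (rule g)
  then show ?thesis using that g(2) by auto
qed

section \<open>Holomorphic families over subsets of an affine chart\<close>

definition holomorphic_family_on :: "(complex ^ 'n \<Rightarrow> complex \<Rightarrow> complex) \<Rightarrow> complex set \<Rightarrow> bool" where
  "holomorphic_family_on F S \<longleftrightarrow> continuous_on (UNIV \<times> S) (\<lambda>(x, l). F x l) \<and>
     (\<forall>l\<in>S. (\<lambda>x. F x l) mholomorphic_on UNIV) \<and> (\<forall>x. F x holomorphic_on S)"

lemma vector_3_axis: "(vector [a, b, c] :: complex ^ 3) = axis 1 a + axis 2 b + axis 3 c"
  by (simp add: vec_eq_iff forall_3 axis_def)

text \<open>Along each of the four axes only one of \<open>x\<close> and \<open>l\<close> moves, so
  the separate conditions suffice for Osgood's criterion. They are stated over a variable set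
  \<open>S\<close> because the pullback of \<open>f\<close> lives on the punctured plane.\<close>

lemma holomorphic_family_on_imp_holomorphic_family:
  assumes "holomorphic_family_on F UNIV"
  shows "holomorphic_family F"
  unfolding holomorphic_family_def mholomorphic_on_UNIV_iff
proof (intro conjI allI)
  have cont: "continuous_on (UNIV \<times> UNIV) (\<lambda>(x, l). F x l)"
    and hol: "\<And>l i p. (\<lambda>s. F (p + axis i s) l) holomorphic_on UNIV" "\<And>x. F x holomorphic_on UNIV"
    using assms by (auto simp: holomorphic_family_on_def mholomorphic_on_UNIV_iff)
  have "continuous_on UNIV (\<lambda>p :: complex ^ 4. (\<lambda>(x, l). F x l) (vector [p $ 1, p $ 2, p $ 3], p $ 4))"
    unfolding vector_3_axis
    by (intro continuous_on_compose2[OF cont] continuous_intros continuous_on_compose_axis) auto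
  then show "continuous_on UNIV (\<lambda>p :: complex ^ 4. F (vector [p $ 1, p $ 2, p $ 3]) (p $ 4))"
    by simp
  fix i :: 4 and p :: "complex ^ 4"
  let ?q = "vector [p $ 1, p $ 2, p $ 3] :: complex ^ 3"
  let ?f = "\<lambda>s. F (vector [(p + axis i s) $ 1, (p + axis i s) $ 2, (p + axis i s) $ 3]) ((p + axis i s) $ 4)"
  have e1: "?f = (\<lambda>s. F (?q + axis 1 s) (p $ 4))" if "i = 1"
    using that by (auto simp: fun_eq_iff axis_def vec_eq_iff forall_3 intro!: arg_cong2[of _ _ _ _ F])
  have e2: "?f = (\<lambda>s. F (?q + axis 2 s) (p $ 4))" if "i = 2"
    using that by (auto simp: fun_eq_iff axis_def vec_eq_iff forall_3 intro!: arg_cong2[of _ _ _ _ F])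
  have e3: "?f = (\<lambda>s. F (?q + axis 3 s) (p $ 4))" if "i = 3"
    using that by (auto simp: fun_eq_iff axis_def vec_eq_iff forall_3 intro!: arg_cong2[of _ _ _ _ F])
  have e4: "?f = (\<lambda>s. F ?q (p $ 4 + s))" if "i = 4"
    using that by (auto simp: fun_eq_iff axis_def vec_eq_iff forall_3 intro!: arg_cong2[of _ _ _ _ F])
  have h4: "(\<lambda>s. F ?q (p $ 4 + s)) holomorphic_on UNIV"
  proof -
    have "(\<lambda>s. p $ 4 + s) holomorphic_on UNIV" by (intro holomorphic_intros)
    from holomorphic_on_compose_gen[OF this hol(2)[of ?q]] show ?thesis by (simp add: o_def)
  qed
  consider "i = 1" | "i = 2" | "i = 3" | "i = 4" using exhaust_4[of i] by blast
  then show "?f holomorphic_on UNIV"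
  proof cases
    case 1 show ?thesis unfolding e1[OF 1] by (rule hol(1))
  next
    case 2 show ?thesis unfolding e2[OF 2] by (rule hol(1))
  next
    case 3 show ?thesis unfolding e3[OF 3] by (rule hol(1))
  next
    case 4 show ?thesis unfolding e4[OF 4] by (rule h4)
  qed
qed

lemma holomorphic_family_onD:
  assumes "holomorphic_family_on F S"
  shows "continuous_on (UNIV \<times> S) (\<lambda>(x, l). F x l)"
    and "l \<in> S \<Longrightarrow> (\<lambda>x. F x l) mholomorphic_on UNIV" and "F x holomorphic_on S"
    and "l \<in> S \<Longrightarrow> (\<lambda>s. F (p + axis i s) l) holomorphic_on UNIV"
  using assms by (auto simp: holomorphic_family_on_def mholomorphic_on_UNIV_iff)

lemma holomorphic_family_on_base:
  "A mholomorphic_on UNIV \<Longrightarrow> holomorphic_family_on (\<lambda>x l. A x) S"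
  by (auto simp: holomorphic_family_on_def case_prod_unfold
    intro!: continuous_on_compose2[OF mholomorphic_on_imp_continuous_on] continuous_intros)

lemma holomorphic_family_on_fibre:
  assumes "g holomorphic_on S" shows "holomorphic_family_on (\<lambda>x l. g l) S"
proof -
  have "continuous_on (UNIV \<times> S) (\<lambda>p. g (snd p))"
    by (rule continuous_on_compose2[OF holomorphic_on_imp_continuous_on[OF assms]])
      (auto intro!: continuous_intros)
  then show ?thesis
    using assms by (auto simp: holomorphic_family_on_def case_prod_unfold)
qed

lemma holomorphic_family_on_add:
  "holomorphic_family_on F S \<Longrightarrow> holomorphic_family_on G S \<Longrightarrow> holomorphic_family_on (\<lambda>x l. F x l + G x l) S"
  by (auto simp: holomorphic_family_on_def case_prod_unfold
    intro!: continuous_on_add holomorphic_intros mholomorphic_on_add)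

lemma holomorphic_family_on_diff:
  "holomorphic_family_on F S \<Longrightarrow> holomorphic_family_on G S \<Longrightarrow> holomorphic_family_on (\<lambda>x l. F x l - G x l) S"
  by (auto simp: holomorphic_family_on_def case_prod_unfold
    intro!: continuous_on_diff holomorphic_intros mholomorphic_on_diff)

lemma holomorphic_family_on_mult:
  "holomorphic_family_on F S \<Longrightarrow> holomorphic_family_on G S \<Longrightarrow> holomorphic_family_on (\<lambda>x l. F x l * G x l) S"
  by (auto simp: holomorphic_family_on_def case_prod_unfold
    intro!: continuous_on_mult holomorphic_intros mholomorphic_on_mult)

text \<open>With the pair (x, l) as continuous parameter, joint continuity comes from
  \<open>continuous_on_deriv_param\<close>; holomorphy in \<open>l\<close> comes from its version
  with a holomorphic parameter.\<close>

lemma holomorphic_family_on_partial: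
  fixes F :: "complex ^ 'n \<Rightarrow> complex \<Rightarrow> complex"
  assumes F: "holomorphic_family_on F S" and S: "open S"
  shows "holomorphic_family_on (\<lambda>x l. partial i (\<lambda>x. F x l) x) S"
  unfolding holomorphic_family_on_def
proof (intro conjI ballI allI)
  note D = holomorphic_family_onD[OF F]
  have "continuous_on (UNIV \<times> (UNIV \<times> S)) (\<lambda>q :: complex \<times> (complex ^ 'n) \<times> complex.
      (\<lambda>(x, l). F x l) (fst (snd q) + axis i (fst q), snd (snd q)))"
    by (intro continuous_on_compose2[OF D(1)] continuous_intros continuous_on_compose_axis) auto
  then have "continuous_on (UNIV \<times> (UNIV \<times> S)) (\<lambda>(s, v). F (fst v + axis i s) (snd v))"
    by (simp add: case_prod_unfold)
  from continuous_on_deriv_param[OF open_UNIV this]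
  have "continuous_on (UNIV \<times> (UNIV \<times> S)) (\<lambda>(s, v). deriv (\<lambda>s. F (fst v + axis i s) (snd v)) s)"
    using D(4) by auto
  then have "continuous_on (UNIV \<times> S) (\<lambda>v. (\<lambda>(s, v). deriv (\<lambda>s. F (fst v + axis i s) (snd v)) s) (0, v))"
    by (rule continuous_on_compose2) (auto intro!: continuous_intros)
  then show "continuous_on (UNIV \<times> S) (\<lambda>(x, l). partial i (\<lambda>x. F x l) x)"
    by (simp add: partial_def case_prod_unfold)
  show "(\<lambda>x. partial i (\<lambda>x. F x l) x) mholomorphic_on UNIV" if "l \<in> S" for l
    using mholomorphic_on_partial[OF D(2)[OF that], of i] by simp
  show "(\<lambda>l. partial i (\<lambda>x. F x l) x) holomorphic_on S" for x
    unfolding partial_def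
  proof (rule holomorphic_on_deriv_param[OF open_UNIV UNIV_I S])
    have "continuous_on (UNIV \<times> S) (\<lambda>q. (\<lambda>(x, l). F x l) (x + axis i (fst q), snd q))"
      by (intro continuous_on_compose2[OF D(1)] continuous_intros continuous_on_compose_axis) auto
    then show "continuous_on (UNIV \<times> S) (\<lambda>(s, l). F (x + axis i s) l)"
      by (simp add: case_prod_unfold)
  qed (use D in auto)
qed

text \<open>Holomorphy is local; this glues the families given by circles of fixed radius, each
  valid over one disc.\<close>

lemma holomorphic_family_on_UN:
  assumes "\<And>A. A \<in> \<A> \<Longrightarrow> holomorphic_family_on F A" "\<And>A. A \<in> \<A> \<Longrightarrow> open A"
  shows "holomorphic_family_on F (\<Union>\<A>)"
proof -
  have eq: "UNIV \<times> \<Union>\<A> = (\<Union>A\<in>\<A>. UNIV \<times> A)" by auto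
  have "continuous_on (UNIV \<times> \<Union>\<A>) (\<lambda>(x, l). F x l)"
    unfolding eq using assms
    by (intro continuous_on_open_UN) (auto simp: holomorphic_family_on_def intro!: open_Times)
  moreover have "F x holomorphic_on (\<Union>A\<in>\<A>. A)" for x
    using assms by (intro holomorphic_on_UN_open) (auto simp: holomorphic_family_on_def)
  ultimately show ?thesis
    using assms by (auto simp: holomorphic_family_on_def)
qed

lemma holomorphic_family_on_cong:
  assumes "\<And>x l. l \<in> S \<Longrightarrow> F x l = G x l"
  shows "holomorphic_family_on F S \<longleftrightarrow> holomorphic_family_on G S"
proof -
  have "continuous_on (UNIV \<times> S) (\<lambda>(x, l). F x l) \<longleftrightarrow> continuous_on (UNIV \<times> S) (\<lambda>(x, l). G x l)"
    using assms by (intro continuous_on_cong) auto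
  moreover have "F x holomorphic_on S \<longleftrightarrow> G x holomorphic_on S" for x
    using assms by (intro holomorphic_cong) auto
  ultimately show ?thesis
    using assms by (simp add: holomorphic_family_on_def)
qed

text \<open>The circle avoids the puncture, so the integral makes sense also at
  \<open>l = 0\<close>, where \<open>F x\<close> may be singular. \<open>k\<close> will be the
  Cauchy kernel in either chart.\<close>

lemma holomorphic_family_on_circle_integral:
  fixes F :: "complex ^ 'n \<Rightarrow> complex \<Rightarrow> complex"
  assumes F: "holomorphic_family_on F (- {0})" and R: "R > 0" and S: "open S"
    and k: "continuous_on (S \<times> sphere 0 R) (\<lambda>(l, s). k l s)"
    and hk: "\<And>s. s \<in> sphere 0 R \<Longrightarrow> (\<lambda>l. k l s) holomorphic_on S"
  shows "holomorphic_family_on (\<lambda>x l. contour_integral (circlepath 0 R) (\<lambda>s. F x s * k l s)) S"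
proof -
  note D = holomorphic_family_onD[OF F]
  let ?c = "circlepath 0 R"
  have c: "continuous_on X ?c" for X
    unfolding circlepath by (intro continuous_intros)
  have c_in: "?c t \<noteq> 0" "?c t \<in> sphere 0 R" for t
    using R by (auto simp: circlepath norm_mult)
  let ?J = "\<lambda>t :: real. 2 * pi * \<i> * R * exp (2 * of_real pi * \<i> * t)"
  let ?K = "\<lambda>x l t. F x (?c t) * k l (?c t) * ?J t"
  have J: "continuous_on X (\<lambda>p. ?J (snd p))" for X :: "('b::topological_space \<times> real) set"
    by (intro continuous_intros)
  have cs: "continuous_on X (\<lambda>p. ?c (snd p))" for X :: "('b::topological_space \<times> real) set"
    by (rule continuous_on_compose2[OF c[of UNIV]]) (auto intro!: continuous_intros)
  have F': "continuous_on X (\<lambda>p. F (g p) (?c (snd p)))" if "continuous_on X g"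
    for X and g :: "'b::topological_space \<times> real \<Rightarrow> complex ^ 'n"
    using continuous_on_compose2[OF D(1) continuous_on_Pair[OF that cs]] c_in by auto
  have k': "continuous_on X (\<lambda>p. k (g p) (?c (snd p)))" if "continuous_on X g" "g ` X \<subseteq> S"
    for X and g :: "'b::topological_space \<times> real \<Rightarrow> complex"
  proof -
    have "(\<lambda>p. (g p, ?c (snd p))) ` X \<subseteq> S \<times> sphere 0 R" using that(2) c_in(2) by blast
    from continuous_on_compose2[OF k continuous_on_Pair[OF that(1) cs] this] show ?thesis by simp
  qed
  have eq: "contour_integral ?c (\<lambda>s. F x s * k l s) = integral {0..1} (?K x l)" for x l
    by (simp add: contour_integral_circlepath_integral)
  show ?thesis
    unfolding eq holomorphic_family_on_def mholomorphic_on_UNIV_iff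
  proof (intro conjI ballI allI)
    have "continuous_on ((UNIV \<times> S) \<times> cbox 0 1) (\<lambda>(p, t). ?K (fst p) (snd p) t)"
      unfolding case_prod_unfold
      by (intro continuous_on_mult J F' k') (auto intro!: continuous_intros)
    from integral_continuous_on_param[OF this]
    show *: "continuous_on (UNIV \<times> S) (\<lambda>(x, l). integral {0..1} (?K x l))"
      by (simp add: case_prod_unfold)
    show "continuous_on UNIV (\<lambda>x. integral {0..1} (?K x l))" if "l \<in> S" for l
    proof -
      have "continuous_on UNIV (\<lambda>x. (\<lambda>(x, l). integral {0..1} (?K x l)) (x, l))"
        by (rule continuous_on_compose2[OF *]) (use that in \<open>auto intro!: continuous_intros\<close>)
      then show ?thesis by simp
    qed
    show "(\<lambda>s. integral {0..1} (?K (p + axis i s) l)) holomorphic_on UNIV" if "l \<in> S" for l p i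
    proof (rule holomorphic_on_integral_param[OF open_UNIV])
      show "continuous_on (UNIV \<times> {0..1}) (\<lambda>(s, t). ?K (p + axis i s) l t)"
        unfolding case_prod_unfold
        by (intro continuous_on_mult J F' k') (use that in \<open>auto intro!: continuous_intros continuous_on_compose_axis\<close>)
    qed (use D(4) c_in in \<open>auto intro!: holomorphic_intros\<close>)
    show "(\<lambda>l. integral {0..1} (?K x l)) holomorphic_on S" for x
    proof (rule holomorphic_on_integral_param[OF S])
      show "continuous_on (S \<times> {0..1}) (\<lambda>(l, t). ?K x l t)"
        unfolding case_prod_unfold
        by (intro continuous_on_mult J F' k') (auto intro!: continuous_intros)
    qed (use hk c_in in \<open>auto intro!: holomorphic_intros\<close>)
  qed
qed

section \<open>Laurent splitting with parameters\<close>

lemma continuous_on_UNIV_eq_off_zero: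
  fixes f :: "complex \<Rightarrow> complex"
  assumes "continuous_on UNIV f" "continuous_on UNIV g" "\<And>l. l \<noteq> 0 \<Longrightarrow> f l = g l"
  shows "f l = g l"
proof -
  have cl: "closure (- {0 :: complex}) = UNIV"
    by (simp add: closure_complement)
  have "f l - g l = 0"
    by (rule continuous_constant_on_closure[of "- {0}"]) (use assms cl in \<open>auto intro!: continuous_intros\<close>)
  then show ?thesis by simp
qed

text \<open>The pair is a section of O(1). \<open>B\<close> is bounded on the unit disc, so
  \<open>A\<close> grows at most linearly and is a polynomial of degree at most one; continuity
  carries the formula for \<open>B\<close> to \<open>m = 0\<close>.\<close>

lemma Liouville_O1:
  assumes A: "A holomorphic_on UNIV" and B: "B holomorphic_on UNIV"
    and eq: "\<And>l. l \<noteq> 0 \<Longrightarrow> A l = l * B (1 / l)"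
  obtains a b where "\<And>l. A l = a + b * l" "\<And>m. B m = b + a * m"
proof -
  have "bounded (B ` cball 0 1)"
    using B by (intro compact_imp_bounded compact_continuous_image holomorphic_on_imp_continuous_on)
      (auto intro: holomorphic_on_subset)
  then obtain C where "\<forall>w\<in>B ` cball 0 1. norm w \<le> C"
    unfolding bounded_iff by blast
  then have C: "norm (B m) \<le> C" if "norm m \<le> 1" for m
    using that by auto
  have bound: "norm (A z) \<le> C * norm z ^ 1" if "1 \<le> norm z" for z
  proof -
    have "norm (B (1 / z)) \<le> C" using that by (intro C) (auto simp: norm_divide divide_le_eq_1)
    moreover have "norm (A z) = norm z * norm (B (1 / z))"
      using eq[of z] that by (cases "z = 0") (simp_all add: norm_mult)
    ultimately show ?thesis by (simp add: mult.commute[of C] mult_left_mono)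
  qed
  have Al: "A l = A 0 + deriv A 0 * l" for l
    using Liouville_polynomial[OF A bound, where \<xi> = l] by simp
  have "B m = deriv A 0 + A 0 * m" for m
  proof (rule continuous_on_UNIV_eq_off_zero[of B "\<lambda>m. deriv A 0 + A 0 * m"])
    show "B l = deriv A 0 + A 0 * l" if "l \<noteq> 0" for l
      using eq[of "1 / l"] that Al[of "1 / l"] by (simp add: field_simps)
  qed (use B in \<open>auto intro!: continuous_intros holomorphic_on_imp_continuous_on holomorphic_intros\<close>)
  with Al show ?thesis using that by blast
qed

text \<open>Multiplying \<open>B\<close> by \<open>m\<close> makes a section of O(1) out of one of
  O. It vanishes at \<open>m = 0\<close>, which removes the linear term of \<open>A\<close>.\<close>

lemma Liouville_O0:
  assumes A: "A holomorphic_on UNIV" and B: "B holomorphic_on UNIV"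
    and eq: "\<And>l. l \<noteq> 0 \<Longrightarrow> A l = B (1 / l)"
  obtains c where "\<And>l. A l = c" "\<And>m. B m = c"
proof -
  have mB: "(\<lambda>m. m * B m) holomorphic_on UNIV"
    using B by (intro holomorphic_intros)
  obtain a b where ab: "\<And>l. A l = a + b * l" "\<And>m. m * B m = b + a * m"
    by (rule Liouville_O1[OF A mB]) (use eq in auto)
  from ab(2)[of 0] have b: "b = 0" by simp
  have "B m = a" for m
    by (rule continuous_on_UNIV_eq_off_zero[of B "\<lambda>_. a"])
      (use B ab(2) b in \<open>auto intro!: holomorphic_on_imp_continuous_on holomorphic_intros\<close>)
  then show ?thesis using that ab(1) b by simp
qed

text \<open>For \<open>l\<close> inside the circle this is the part of \<open>g\<close> regular at
  0; for \<open>l\<close> outside it is minus the part regular at infinity and vanishing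
  there.\<close>

definition cauchy_circle :: "real \<Rightarrow> (complex \<Rightarrow> complex) \<Rightarrow> complex \<Rightarrow> complex" where
  "cauchy_circle R g l = contour_integral (circlepath 0 R) (\<lambda>s. g s * (1 / (s - l))) / (2 * of_real pi * \<i>)"

text \<open>The difference quotient of \<open>g\<close> at \<open>l\<close> is holomorphic in the punctured plane, so its integral over a
  circle does not depend on the radius.\<close>

lemma cauchy_circle_jump:
  assumes g: "g holomorphic_on - {0}" and l: "l \<noteq> 0"
  obtains J where "\<And>R. norm l < R \<Longrightarrow> cauchy_circle R g l = J + g l"
    "\<And>R. 0 < R \<Longrightarrow> R < norm l \<Longrightarrow> cauchy_circle R g l = J"
proof -
  define h where "h s = (if s = l then deriv g l else (g s - g l) / (s - l))" for s
  have h: "h holomorphic_on UNIV - {0}"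
    unfolding h_def using g l by (intro pole_lemma) (auto simp: Compl_eq_Diff_UNIV interior_open open_delete)
  define J where "J = contour_integral (circlepath 0 1) h / (2 * of_real pi * \<i>)"
  have J: "contour_integral (circlepath 0 R) h / (2 * of_real pi * \<i>) = J" if "R > 0" for R
  proof (cases "R \<le> 1")
    case True
    then show ?thesis
      unfolding J_def using contour_integral_circlepath_eq(3)[OF open_UNIV h \<open>R > 0\<close> True] by simp
  next
    case False
    then have "1 \<le> R" by simp
    then show ?thesis
      unfolding J_def using contour_integral_circlepath_eq(3)[OF open_UNIV h zero_less_one \<open>1 \<le> R\<close>] by simp
  qed
  have hi: "h contour_integrable_on circlepath 0 R" if "R > 0" for R
    using contour_integral_circlepath_eq(1)[OF open_UNIV h, of R R] that by auto
  \<comment> \<open>\<open>k\<close> is 2 pi i for \<open>l\<close> inside the circle and 0 for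
    \<open>l\<close> outside. The jump \<open>g l\<close> comes from this alone, as the integral of
    \<open>h\<close> is the same for all radii.\<close>
  have split: "contour_integral (circlepath 0 R) (\<lambda>s. g s * (1 / (s - l))) =
      contour_integral (circlepath 0 R) h + g l * k"
    if k: "((\<lambda>s. 1 / (s - l)) has_contour_integral k) (circlepath 0 R)" and R: "R > 0" "R \<noteq> norm l" for R k
  proof -
    have "((\<lambda>s. h s + g l * (1 / (s - l))) has_contour_integral
        contour_integral (circlepath 0 R) h + g l * k) (circlepath 0 R)"
      using hi[OF R(1)] by (intro has_contour_integral_add has_contour_integral_lmul k has_contour_integral_integral)
    then have "((\<lambda>s. g s * (1 / (s - l))) has_contour_integral
        contour_integral (circlepath 0 R) h + g l * k) (circlepath 0 R)"
      by (rule has_contour_integral_eq) (use R in \<open>auto simp: h_def diff_divide_distrib\<close>)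
    then show ?thesis by (rule contour_integral_unique)
  qed
  show ?thesis
  proof
    fix R assume R: "norm l < R"
    then have R0: "R > 0" using norm_ge_zero[of l] by linarith
    have "((\<lambda>u. 1 / (u - l)) has_contour_integral (2 * of_real pi * \<i> * 1)) (circlepath 0 R)"
      using R by (intro Cauchy_integral_circlepath_simple) auto
    from split[OF this R0] J[OF R0] R show "cauchy_circle R g l = J + g l"
      by (simp add: cauchy_circle_def add_divide_distrib)
  next
    fix R :: real assume R: "0 < R" "R < norm l"
    have "((\<lambda>u. 1 / (u - l)) has_contour_integral 0) (circlepath 0 R)"
      using R by (intro Cauchy_theorem_disc_simple[of _ 0 "norm l"])
        (auto intro!: holomorphic_intros simp: dist_norm)
    from split[OF this R(1)] J[OF R(1)] R show "cauchy_circle R g l = J"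
      by (simp add: cauchy_circle_def)
  qed
qed

lemma cauchy_circle_indep_zero:
  assumes g: "g holomorphic_on - {0}" and R: "0 < R" "0 < R'"
  shows "cauchy_circle R g 0 = cauchy_circle R' g 0"
proof -
  have h: "(\<lambda>s. g s * (1 / (s - 0))) holomorphic_on UNIV - {0}"
    using g by (auto intro!: holomorphic_intros simp: Compl_eq_Diff_UNIV)
  show ?thesis
  proof (cases "R \<le> R'")
    case True
    from contour_integral_circlepath_eq(3)[OF open_UNIV h R(1) True]
    show ?thesis by (simp add: cauchy_circle_def)
  next
    case False
    then have "R' \<le> R" by simp
    from contour_integral_circlepath_eq(3)[OF open_UNIV h R(2) this]
    show ?thesis by (simp add: cauchy_circle_def)
  qed
qed

text \<open>The jump lemma needs a point of the punctured plane. At \<open>l = 0\<close> the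
  integrand itself is holomorphic off 0, so the circles deform into one another.\<close>

lemma cauchy_circle_indep:
  assumes g: "g holomorphic_on - {0}" and "norm l < R" "norm l < R'"
  shows "cauchy_circle R g l = cauchy_circle R' g l"
proof (cases "l = 0")
  case True
  then show ?thesis using cauchy_circle_indep_zero[OF g, of R R'] assms by auto
next
  case False
  then obtain J where "\<And>R. norm l < R \<Longrightarrow> cauchy_circle R g l = J + g l"
    using cauchy_circle_jump[OF g] by blast
  then show ?thesis using assms(2,3) by simp
qed

text \<open>Radii depending on the point define \<open>P\<close> and \<open>Q\<close> on the whole
  plane at once; over a disc they can be replaced by a fixed radius, for which holomorphy in all
  variables is known.\<close>

lemma laurent_splitting_family:
  fixes F :: "complex ^ 'n \<Rightarrow> complex \<Rightarrow> complex"
  assumes F: "holomorphic_family_on F (- {0})"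
  obtains P Q where "holomorphic_family_on P UNIV" "holomorphic_family_on Q UNIV"
    "\<And>x l. l \<noteq> 0 \<Longrightarrow> F x l = P x l + Q x (1 / l)" "\<And>x. Q x 0 = 0"
proof -
  have g: "F x holomorphic_on - {0}" for x
    by (rule holomorphic_family_onD[OF F])
  define P where "P x l = cauchy_circle (norm l + 1) (F x) l" for x l
  \<comment> \<open>The radius is below \<open>norm (1 / m)\<close>, so \<open>1 / m\<close> lies
    outside the circle. The value 0 at \<open>m = 0\<close> puts the constant Laurent term into
    \<open>P\<close>.\<close>
  define Q where "Q x m = (if m = 0 then 0 else - cauchy_circle (1 / (norm m + 1)) (F x) (1 / m))" for x m
  have div: "holomorphic_family_on (\<lambda>x l. G x l / c) S" if "holomorphic_family_on G S"
    for G :: "complex ^ 'n \<Rightarrow> complex \<Rightarrow> complex" and S c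
    using holomorphic_family_on_mult[OF holomorphic_family_on_base[OF mholomorphic_on_const[of "1 / c"]] that]
    by simp
  have "holomorphic_family_on P (\<Union>(range (ball 0)))"
  proof (rule holomorphic_family_on_UN, safe)
    fix R :: real
    show "holomorphic_family_on P (ball 0 R)"
    proof (cases "R > 0")
      case True
      have "holomorphic_family_on (\<lambda>x l. contour_integral (circlepath 0 R) (\<lambda>s. F x s * (1 / (s - l)))
          / (2 * of_real pi * \<i>)) (ball 0 R)"
        using True by (intro div holomorphic_family_on_circle_integral F)
          (auto simp: case_prod_unfold intro!: continuous_intros holomorphic_intros)
      moreover have "cauchy_circle R (F x) l = P x l" if "l \<in> ball 0 R" for x l
        unfolding P_def using that by (intro cauchy_circle_indep g) auto
      ultimately show ?thesis
        by (subst holomorphic_family_on_cong[symmetric]) (auto simp: cauchy_circle_def)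
    qed (simp add: holomorphic_family_on_def holomorphic_on_def ball_empty not_less)
  qed auto
  moreover have U: "\<Union>(range (ball 0)) = (UNIV :: complex set)"
  proof -
    have "x \<in> ball 0 (norm x + 1)" for x :: complex by simp
    then show ?thesis by blast
  qed
  ultimately have P: "holomorphic_family_on P UNIV" by simp
  have "holomorphic_family_on Q (\<Union>(ball 0 ` {0<..}))"
  proof (rule holomorphic_family_on_UN, safe)
    fix R :: real assume R: "R > 0"
    define r where "r = 1 / R"
    have r: "r > 0" "R = 1 / r" using R by (auto simp: r_def)
    have ne: "1 - s * m \<noteq> 0" if "norm m < R" "norm s = r" for m s :: complex
    proof
      assume "1 - s * m = 0"
      then have "norm (s * m) = 1" by simp
      then show False using that r by (simp add: norm_mult field_simps)
    qed
    \<comment> \<open>In the coordinate \<open>m\<close> the outer Cauchy kernel, with its sign, is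
      \<open>m / (1 - s * m)\<close>, which is regular at \<open>m = 0\<close>.\<close>
    have "holomorphic_family_on (\<lambda>x l. contour_integral (circlepath 0 r) (\<lambda>s. F x s * (l / (1 - s * l)))
        / (2 * of_real pi * \<i>)) (ball 0 R)"
      using r(1) ne by (intro div holomorphic_family_on_circle_integral F)
        (auto simp: case_prod_unfold intro!: continuous_intros holomorphic_intros)
    moreover have "contour_integral (circlepath 0 r) (\<lambda>s. F x s * (m / (1 - s * m)))
        / (2 * of_real pi * \<i>) = Q x m" if m: "m \<in> ball 0 R" for x m
    proof (cases "m = 0")
      case False
      obtain J where J: "\<And>R. 0 < R \<Longrightarrow> R < norm (1 / m) \<Longrightarrow> cauchy_circle R (F x) (1 / m) = J"
        using cauchy_circle_jump[OF g[of x], of "1 / m"] False by (metis divide_eq_0_iff zero_neq_one)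
      have "cauchy_circle r (F x) (1 / m) = J"
        using m False r by (intro J) (auto simp: norm_divide field_simps)
      moreover have "cauchy_circle (1 / (norm m + 1)) (F x) (1 / m) = J"
        using False by (intro J) (auto simp: norm_divide field_simps add_pos_pos)
      ultimately have Qr: "Q x m = - cauchy_circle r (F x) (1 / m)"
        using False by (simp add: Q_def)
      \<comment> \<open>When \<open>1 - s * m = 0\<close> both sides are 0 by the convention on
        division by zero.\<close>
      have "m / (1 - s * m) = - (1 / (s - 1 / m))" for s
        using False by (cases "1 - s * m = 0") (auto simp: field_simps)
      then have "contour_integral (circlepath 0 r) (\<lambda>s. F x s * (m / (1 - s * m))) =
          contour_integral (circlepath 0 r) (\<lambda>s. - (F x s * (1 / (s - 1 / m))))"
        by simp
      also have "\<dots> = - contour_integral (circlepath 0 r) (\<lambda>s. F x s * (1 / (s - 1 / m)))"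
        by (rule contour_integral_neg)
      finally show ?thesis by (simp add: Qr cauchy_circle_def)
    qed (simp add: Q_def)
    ultimately show "holomorphic_family_on Q (ball 0 R)"
      by (subst holomorphic_family_on_cong[symmetric]) auto
  qed auto
  moreover have U: "\<Union>(ball 0 ` {0<..}) = (UNIV :: complex set)"
  proof -
    have "x \<in> ball 0 (norm x + 1)" "norm x + 1 \<in> {0<..}" for x :: complex
      by (simp_all add: add_nonneg_pos)
    then show ?thesis by blast
  qed
  ultimately have Q: "holomorphic_family_on Q UNIV" by simp
  have "F x l = P x l + Q x (1 / l)" if l: "l \<noteq> 0" for x l
  proof -
    obtain J where "\<And>R. norm l < R \<Longrightarrow> cauchy_circle R (F x) l = J + F x l"
      "\<And>R. 0 < R \<Longrightarrow> R < norm l \<Longrightarrow> cauchy_circle R (F x) l = J"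
      using cauchy_circle_jump[OF g[of x] l] by blast
    then show ?thesis
      using l by (simp add: P_def Q_def norm_divide field_simps add_pos_pos)
  qed
  then show ?thesis using that[OF P Q] by (auto simp: Q_def)
qed

section \<open>Power series and Laurent coefficients\<close>

lemma has_sum_power_series:
  fixes a :: "nat \<Rightarrow> complex"
  assumes "\<And>l. (\<lambda>n. a n * l ^ n) sums A l"
  shows "((\<lambda>n. a n * l ^ n) has_sum A l) UNIV"
proof (rule norm_summable_imp_has_sum)
  \<comment> \<open>Convergence at a point of larger modulus gives absolute convergence at
    \<open>l\<close>, hence a sum independent of the order.\<close>
  have "summable (\<lambda>n. a n * (of_real (norm l + 1)) ^ n)"
    using assms sums_summable by blast
  then show "summable (\<lambda>n. norm (a n * l ^ n))"
    by (rule powser_insidea) (simp add: abs_of_pos[OF add_nonneg_pos])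
qed (rule assms)

lemma entire_power_series_sums:
  "A holomorphic_on UNIV \<Longrightarrow> (\<lambda>n. (deriv ^^ n) A 0 / fact n * l ^ n) sums A l"
  using holomorphic_power_series[of A 0 "norm l + 1" l]
  by (auto intro: holomorphic_on_subset)

text \<open>A power series with a nonzero coefficient of positive index has no zeros in a small
  punctured disc about 0; the constant coefficient is the value at 0.\<close>

lemma entire_power_series_unique:
  fixes a :: "nat \<Rightarrow> complex"
  assumes "\<And>l. (\<lambda>n. a n * l ^ n) sums 0"
  shows "a n = 0"
proof (cases n)
  case 0
  then show ?thesis using sums_unique2[OF assms[of 0] powser_sums_zero] by simp
next
  case (Suc m)
  have sm: "norm (x - 0) < 1 \<Longrightarrow> (\<lambda>n. a n * (x - 0) ^ n) sums (\<lambda>_. 0) x" for x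
    using assms by simp
  have "n > 0" using Suc by simp
  show ?thesis
  proof (rule ccontr)
    assume n: "a n \<noteq> 0"
    obtain s where s: "0 < s" "\<And>z. z \<in> cball (0 :: complex) s - {0} \<Longrightarrow> (\<lambda>_. 0 :: complex) z \<noteq> 0"
      by (rule powser_0_nonzero[OF zero_less_one sm refl n \<open>n > 0\<close>]) (assumption | rule that)+
    then have "of_real s \<in> cball (0 :: complex) s - {0}" by simp
    from s(2)[OF this] show False by simp
  qed
qed

lemma has_sum_int_nonneg_iff:
  fixes c :: "int \<Rightarrow> complex"
  shows "((\<lambda>n. c n * l powi n) has_sum A) {0..} \<longleftrightarrow> ((\<lambda>n. c (int n) * l ^ n) has_sum A) UNIV"
proof -
  have "bij_betw int UNIV {0..}" by (rule bij_betwI[of _ _ _ nat]) auto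
  from has_sum_reindex_bij_betw[OF this, of "\<lambda>n. c n * l powi n" A] show ?thesis by simp
qed

lemma has_sum_int_nonpos_iff:
  fixes c :: "int \<Rightarrow> complex"
  shows "((\<lambda>n. c n * m powi (- n)) has_sum A) {..0} \<longleftrightarrow> ((\<lambda>n. c (- int n) * m ^ n) has_sum A) UNIV"
proof -
  have "bij_betw (\<lambda>n. - int n) UNIV {..0}"
    by (rule bij_betwI[of _ _ _ "\<lambda>k. nat (- k)"]) auto
  from has_sum_reindex_bij_betw[OF this, of "\<lambda>n. c n * m powi (- n)" A] show ?thesis by simp
qed

text \<open>The two halves of a convergent Laurent expansion of \<open>0\<close> are entire in \<open>l\<close> and in \<open>1 / l\<close>,
  hence constant.\<close>

lemma laurent_expansion_zero:
  fixes d :: "int \<Rightarrow> complex"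
  assumes d: "\<And>l. l \<noteq> 0 \<Longrightarrow> ((\<lambda>n. d n * l powi n) has_sum 0) UNIV"
  shows "d n = 0"
proof -
  have split: "(\<lambda>n. d n * l powi n) summable_on {0..}" "(\<lambda>n. d n * l powi n) summable_on {..0}" if "l \<noteq> 0" for l
    using has_sum_imp_summable[OF d[OF that]] summable_on_subset_banach by blast+
  have sm1: "\<exists>A. (\<lambda>n. d (int n) * l ^ n) sums A" for l
  proof (cases "l = 0")
    case False
    then obtain A where "((\<lambda>n. d n * l powi n) has_sum A) {0..}"
      using split(1) summable_on_def by blast
    then show ?thesis
      unfolding has_sum_int_nonneg_iff by (blast dest: has_sum_imp_sums)
  qed (use powser_sums_zero[of "\<lambda>n. d (int n)"] in auto)
  have sm2: "\<exists>A. (\<lambda>n. d (- int n) * m ^ n) sums A" for m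
  proof (cases "m = 0")
    case False
    then obtain A where "((\<lambda>n. d n * (1 / m) powi n) has_sum A) {..0}"
      using split(2)[of "1 / m"] summable_on_def by fastforce
    moreover have "(1 / m) powi n = m powi (- n)" for n
      by (simp add: power_int_minus power_int_divide_distrib inverse_eq_divide)
    ultimately show ?thesis
      using has_sum_int_nonpos_iff[of d m A] by (auto dest: has_sum_imp_sums)
  qed (use powser_sums_zero[of "\<lambda>n. d (- int n)"] in auto)
  obtain A B where A: "\<And>l. (\<lambda>n. d (int n) * l ^ n) sums A l" and B: "\<And>m. (\<lambda>n. d (- int n) * m ^ n) sums B m"
    using sm1 sm2 by metis
  have hol: "C holomorphic_on UNIV" if "\<And>l. (\<lambda>n. a n * l ^ n) sums C l" for a and C :: "complex \<Rightarrow> complex"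
  proof -
    have "C holomorphic_on ball 0 r" for r
      by (rule power_series_holomorphic[of _ _ a]) (use that in auto)
    then have "C field_differentiable at l" for l
      using holomorphic_on_imp_differentiable_at[of C "ball 0 (norm l + 1)" l] by simp
    then show ?thesis by (simp add: holomorphic_on_def field_differentiable_at_within)
  qed
  have eq: "A l = d 0 - B (1 / l)" if l: "l \<noteq> 0" for l
  proof -
    have "(1 / (1 / l)) powi n = (1 / l) powi (- n)" for n
      by (simp add: power_int_minus power_int_divide_distrib inverse_eq_divide)
    then have neg: "((\<lambda>n. d n * l powi n) has_sum B (1 / l)) {..0}"
      using has_sum_int_nonpos_iff[of d "1 / l" "B (1 / l)"] has_sum_power_series[OF B] l by simp
    have pos: "((\<lambda>n. d n * l powi n) has_sum A l) {0..}"
      unfolding has_sum_int_nonneg_iff by (rule has_sum_power_series[OF A])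
    \<comment> \<open>The term of index 0 belongs to both halves and has to be taken out of one of
      them.\<close>
    have zero: "((\<lambda>n. d n * l powi n) has_sum d 0) {0}"
      using has_sum_finite[of "{0}" "\<lambda>n. d n * l powi n"] by simp
    have "((\<lambda>n. d n * l powi n) has_sum (B (1 / l) - d 0)) ({..0} - {0})"
      by (intro has_sum_Diff neg zero) auto
    moreover have "{0..} \<inter> ({..0} - {0}) = ({} :: int set)" by auto
    ultimately have "((\<lambda>n. d n * l powi n) has_sum (A l + (B (1 / l) - d 0))) ({0..} \<union> ({..0} - {0}))"
      by (intro has_sum_Un_disjoint pos)
    moreover have "{0..} \<union> ({..0} - {0}) = (UNIV :: int set)" by auto
    ultimately have "A l + (B (1 / l) - d 0) = 0"
      using has_sum_unique d[OF l] by simp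
    then show ?thesis by (simp add: algebra_simps)
  qed
  obtain c where c: "\<And>l. A l = c" "\<And>m. d 0 - B m = c"
    by (rule Liouville_O0[of A "\<lambda>m. d 0 - B m"])
      (use eq hol[OF A] hol[OF B] in \<open>auto intro!: holomorphic_intros\<close>)
  have "A 0 = d 0" "B 0 = d 0"
    using sums_unique2[OF A[of 0] powser_sums_zero[of "\<lambda>n. d (int n)"]]
      sums_unique2[OF B[of 0] powser_sums_zero[of "\<lambda>n. d (- int n)"]] by simp_all
  then have d0: "d 0 = 0" and AB: "A l = 0" "B l = 0" for l
    using c(1)[of 0] c(1)[of l] c(2)[of 0] c(2)[of l] by auto
  have "d (int k) = 0" "d (- int k) = 0" for k
    using entire_power_series_unique[of "\<lambda>n. d (int n)" k] A
      entire_power_series_unique[of "\<lambda>n. d (- int n)" k] B AB by auto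
  then show ?thesis by (cases n rule: int_cases2) auto
qed

text \<open>The definite description is resolved by a witness, the Taylor coefficients of
  \<open>P\<close> and \<open>Q\<close> placed on either side of 0; uniqueness is
  \<open>laurent_expansion_zero\<close> applied to a difference. \<open>Q 0 = 0\<close> makes
  \<open>P 0\<close> the constant coefficient.\<close>

lemma laurent_coeffs_splitting:
  assumes P: "P holomorphic_on UNIV" and Q: "Q holomorphic_on UNIV" "Q 0 = 0"
    and g: "\<And>l. l \<noteq> 0 \<Longrightarrow> g l = P l + Q (1 / l)"
  shows "(\<Sum>\<^sub>\<infinity>n\<in>{1..}. laurent_coeffs g n * l powi n) = P l - P 0"
    and "(\<Sum>\<^sub>\<infinity>n\<in>{..0}. laurent_coeffs g n * m powi (- n)) = P 0 + Q m"
    and "laurent_coeffs g 0 = P 0"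
proof -
  define p where "p n = (deriv ^^ n) P 0 / fact n" for n
  define q where "q n = (deriv ^^ n) Q 0 / fact n" for n
  define c where "c n = (if n \<ge> 0 then p (nat n) else q (nat (- n)))" for n
  have p0: "p 0 = P 0" and q0: "q 0 = 0" by (simp_all add: p_def q_def Q)
  have ps: "((\<lambda>n. p n * l ^ n) has_sum P l) UNIV" for l
    unfolding p_def by (rule has_sum_power_series) (rule entire_power_series_sums[OF P])
  have qs: "((\<lambda>n. q n * m ^ n) has_sum Q m) UNIV" for m
    unfolding q_def by (rule has_sum_power_series) (rule entire_power_series_sums[OF Q(1)])
  have pos: "((\<lambda>n. c n * l powi n) has_sum P l) {0..}" for l
    unfolding has_sum_int_nonneg_iff using ps[of l] by (simp add: c_def)
  have zero: "((\<lambda>n. c n * l powi n) has_sum P 0) {0}" for l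
    using has_sum_finite[of "{0}" "\<lambda>n. c n * l powi n"] p0 by (simp add: c_def)
  have pos1: "((\<lambda>n. c n * l powi n) has_sum (P l - P 0)) {1..}" for l
  proof -
    have "{0..} - {0} = {1 :: int ..}" by auto
    then show ?thesis using has_sum_Diff[OF pos[of l] zero] by simp
  qed
  have neg: "((\<lambda>n. c n * m powi (- n)) has_sum Q m) {..<0}" for m
  proof -
    let ?c = "\<lambda>n. if n = 0 then 0 else c n"
    have "?c (- int n) = q n" for n using q0 by (auto simp: c_def)
    then have "((\<lambda>n. ?c n * m powi (- n)) has_sum Q m) {..0}"
      unfolding has_sum_int_nonpos_iff using qs[of m] by simp
    moreover have "((\<lambda>n. ?c n * m powi (- n)) has_sum 0) {0}"
      using has_sum_finite[of "{0}" "\<lambda>n. ?c n * m powi (- n)"] by simp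
    ultimately have "((\<lambda>n. ?c n * m powi (- n)) has_sum (Q m - 0)) ({..0} - {0})"
      by (intro has_sum_Diff) auto
    moreover have "{..0} - {0} = {..<0 :: int}" by auto
    ultimately have "((\<lambda>n. ?c n * m powi (- n)) has_sum Q m) {..<0}" by simp
    then show ?thesis by (subst has_sum_cong[where g = "\<lambda>n. ?c n * m powi (- n)"]) auto
  qed
  have neg0: "((\<lambda>n. c n * m powi (- n)) has_sum (P 0 + Q m)) {..0}" for m
  proof -
    have "((\<lambda>n. c n * m powi (- n)) has_sum P 0) {0}"
      using has_sum_finite[of "{0}" "\<lambda>n. c n * m powi (- n)"] p0 by (simp add: c_def)
    from has_sum_Un_disjoint[OF this neg[of m]]
    have "((\<lambda>n. c n * m powi (- n)) has_sum (P 0 + Q m)) ({0} \<union> {..<0})" by simp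
    moreover have "{0} \<union> {..<0} = {..0 :: int}" by auto
    ultimately show ?thesis by simp
  qed
  have all: "((\<lambda>n. c n * l powi n) has_sum g l) UNIV" if "l \<noteq> 0" for l
  proof -
    have "(1 / l) powi (- n) = l powi n" for n
      by (simp add: power_int_minus power_int_divide_distrib inverse_eq_divide)
    then have "((\<lambda>n. c n * l powi n) has_sum Q (1 / l)) {..<0}"
      using neg[of "1 / l"] by simp
    moreover have "{0..} \<inter> {..<0 :: int} = {}" by auto
    ultimately
    have "((\<lambda>n. c n * l powi n) has_sum (P l + Q (1 / l))) ({0..} \<union> {..<0})"
      by (intro has_sum_Un_disjoint pos)
    moreover have "{0..} \<union> {..<0} = (UNIV :: int set)" by auto
    ultimately show ?thesis using g[OF that] by simp
  qed
  have "laurent_coeffs g = c"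
    unfolding laurent_coeffs_def
  proof (rule the_equality)
    fix c' assume c': "\<forall>l. l \<noteq> 0 \<longrightarrow> ((\<lambda>n. c' n * l powi n) has_sum g l) UNIV"
    have "c' n - c n = 0" for n
    proof (rule laurent_expansion_zero[of "\<lambda>n. c' n - c n"])
      fix l :: complex assume l: "l \<noteq> 0"
      have "((\<lambda>n. c' n * l powi n + - (c n * l powi n)) has_sum (g l + - g l)) UNIV"
        using c' all l by (intro has_sum_add) (auto simp: has_sum_uminus)
      then show "((\<lambda>n. (c' n - c n) * l powi n) has_sum 0) UNIV"
        by (simp add: algebra_simps)
    qed
    then show "c' = c" by (simp add: fun_eq_iff)
  qed (use all in auto)
  then show "(\<Sum>\<^sub>\<infinity>n\<in>{1..}. laurent_coeffs g n * l powi n) = P l - P 0"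
    and "(\<Sum>\<^sub>\<infinity>n\<in>{..0}. laurent_coeffs g n * m powi (- n)) = P 0 + Q m"
    and "laurent_coeffs g 0 = P 0"
    using infsumI[OF pos1] infsumI[OF neg0] p0 by (auto simp: c_def)
qed

section \<open>Sections and normal bundles\<close>

lemma pullback_holomorphic_family_on:
  assumes f: "(\<lambda>p :: complex ^ 2. f (p $ 1) (p $ 2)) mholomorphic_on {p. p $ 2 \<noteq> 0}"
  shows "holomorphic_family_on (\<lambda>(x :: complex ^ 3) l. f (x $ 2 + x $ 3 * l) l) (- {0})"
    and "l \<noteq> 0 \<Longrightarrow> (\<lambda>Om. f Om l) holomorphic_on UNIV"
proof -
  show f1: "(\<lambda>Om. f Om l) holomorphic_on UNIV" if "l \<noteq> 0" for l
  proof -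
    have "(\<lambda>Om. f Om l) field_differentiable (at Om)" for Om
      using mholomorphic_on_line[OF f, of "vector [0, l]" Om "vector [1, 0]"] that by simp
    then show ?thesis by (simp add: holomorphic_on_def field_differentiable_at_within)
  qed
  have cont: "continuous_on (UNIV \<times> - {0}) (\<lambda>(Om, l). f Om l)"
  proof -
    have v: "(vector [a, b] :: complex ^ 2) = axis 1 a + axis 2 b" for a b
      by (simp add: vec_eq_iff forall_2 axis_def)
    have "continuous_on (UNIV \<times> - {0}) (\<lambda>q. (\<lambda>p :: complex ^ 2. f (p $ 1) (p $ 2)) (vector [fst q, snd q]))"
      unfolding v
      by (intro continuous_on_compose2[OF mholomorphic_on_imp_continuous_on[OF f]]
        continuous_intros continuous_on_compose_axis) (auto simp: axis_def)
    then show ?thesis by (simp add: case_prod_unfold)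
  qed
  show "holomorphic_family_on (\<lambda>(x :: complex ^ 3) l. f (x $ 2 + x $ 3 * l) l) (- {0})"
    unfolding holomorphic_family_on_def mholomorphic_on_UNIV_iff
  proof (intro conjI ballI allI)
    have "continuous_on (UNIV \<times> - {0}) (\<lambda>q :: (complex ^ 3) \<times> complex.
        (\<lambda>(Om, l). f Om l) (fst q $ 2 + fst q $ 3 * snd q, snd q))"
      by (intro continuous_on_compose2[OF cont] continuous_intros) auto
    then show "continuous_on (UNIV \<times> - {0}) (\<lambda>(x :: complex ^ 3, l). f (x $ 2 + x $ 3 * l) l)"
      by (simp add: case_prod_unfold)
    fix l :: complex assume "l \<in> - {0}"
    then have l: "l \<noteq> 0" by simp
    show "continuous_on UNIV (\<lambda>x :: complex ^ 3. f (x $ 2 + x $ 3 * l) l)"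
      by (intro continuous_on_compose2[OF holomorphic_on_imp_continuous_on[OF f1[OF l]]] continuous_intros) auto
    fix i :: 3 and p :: "complex ^ 3"
    have "(\<lambda>s. (p + axis i s) $ k) holomorphic_on UNIV" for k
      using mholomorphic_on_axis_holomorphic_on[OF mholomorphic_on_nth] .
    then have "(\<lambda>s. (p + axis i s) $ 2 + (p + axis i s) $ 3 * l) holomorphic_on UNIV"
      by (intro holomorphic_intros)
    from holomorphic_on_compose_gen[OF this f1[OF l]]
    show "(\<lambda>s. f ((p + axis i s) $ 2 + (p + axis i s) $ 3 * l) l) holomorphic_on UNIV"
      by (simp add: o_def)
  next
    fix x :: "complex ^ 3"
    have "(\<lambda>l. f (x $ 2 + x $ 3 * l) l) field_differentiable (at l)" if "l \<noteq> 0" for l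
      using mholomorphic_on_line[OF f, of "vector [x $ 2, 0]" l "vector [x $ 3, 1]"] that
      by (simp add: mult.commute)
    then show "(\<lambda>l. f (x $ 2 + x $ 3 * l) l) holomorphic_on - {0}"
      by (simp add: holomorphic_on_def field_differentiable_at_within)
  qed
qed

section \<open>Vectors with two or three components and matrices\<close>

lemma vector2_eq_iff: "v = w \<longleftrightarrow> v $ 1 = w $ 1 \<and> v $ 2 = w $ 2" for v w :: "'a ^ 2"
  by (simp add: vec_eq_iff forall_2)

lemma vector3_eq_iff: "v = w \<longleftrightarrow> v $ 1 = w $ 1 \<and> v $ 2 = w $ 2 \<and> v $ 3 = w $ 3" for v w :: "'a ^ 3"
  by (simp add: vec_eq_iff forall_3)

lemma matrix_mult_nth_2: "(A ** B) $ i $ j = A $ i $ 1 * B $ 1 $ j + A $ i $ 2 * B $ 2 $ j"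
  for A B :: "complex ^ 2 ^ 2"
  by (simp add: matrix_matrix_mult_def sum_2)

lemma matrix_vector_mult_nth_2: "(A *v u) $ i = A $ i $ 1 * u $ 1 + A $ i $ 2 * u $ 2"
  for A :: "complex ^ 2 ^ 2"
  by (simp add: matrix_vector_mult_def sum_2)

lemma mat_nth_2: "(mat k :: complex ^ 2 ^ 2) $ 1 $ 1 = k" "(mat k :: complex ^ 2 ^ 2) $ 1 $ 2 = 0"
  "(mat k :: complex ^ 2 ^ 2) $ 2 $ 1 = 0" "(mat k :: complex ^ 2 ^ 2) $ 2 $ 2 = k"
  by (simp_all add: mat_def)

lemmas matrix2_simps = vector2_eq_iff matrix_mult_nth_2 matrix_vector_mult_nth_2 mat_nth_2

lemma matrix_inv_eqI:
  fixes A B :: "complex ^ 'n ^ 'n"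
  assumes "A ** B = mat 1" "B ** A = mat 1"
  shows "matrix_inv A = B" "invertible A"
proof -
  show inv: "invertible A" using assms by (auto simp: invertible_def)
  have "A ** matrix_inv A = mat 1"
    using someI_ex[of "\<lambda>A'. A ** A' = mat 1 \<and> A' ** A = mat 1"] assms by (auto simp: matrix_inv_def)
  then have "B ** (A ** matrix_inv A) = B" by simp
  then show "matrix_inv A = B" by (simp add: matrix_mul_assoc assms)
qed

lemma matrix_inv_mult:
  fixes A :: "complex ^ 'n ^ 'n"
  assumes "invertible A"
  shows "A ** matrix_inv A = mat 1" "matrix_inv A ** A = mat 1"
  using someI_ex[of "\<lambda>A'. A ** A' = mat 1 \<and> A' ** A = mat 1"] assms
  by (auto simp: matrix_inv_def invertible_def)

abbreviation matrix2 :: "complex \<Rightarrow> complex \<Rightarrow> complex \<Rightarrow> complex \<Rightarrow> complex ^ 2 ^ 2" where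
  "matrix2 a b c d \<equiv> vector [vector [a, b], vector [c, d]]"

text \<open>\<open>P x l\<close> collects the terms \<open>\<gamma>\<^sub>n l\<^sup>n\<close> with \<open>n \<ge> 0\<close>, and \<open>Q x (1 / l)\<close> those with \<open>n < 0\<close>.\<close>

locale twistor_family =
  fixes f :: "complex \<Rightarrow> complex \<Rightarrow> complex" and P Q :: "complex ^ 3 \<Rightarrow> complex \<Rightarrow> complex"
  assumes f_hol: "\<And>l. l \<noteq> 0 \<Longrightarrow> (\<lambda>Om. f Om l) holomorphic_on UNIV"
    and P: "holomorphic_family_on P UNIV" and Q: "holomorphic_family_on Q UNIV"
    and split: "\<And>x l. l \<noteq> 0 \<Longrightarrow> f (x $ 2 + x $ 3 * l) l = P x l + Q x (1 / l)"
    and Q_0: "\<And>x. Q x 0 = 0"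
begin

definition dP where "dP i x l = partial i (\<lambda>x. P x l) x"
definition dQ where "dQ i x m = partial i (\<lambda>x. Q x m) x"
text \<open>\<open>R x (1 / l) / l\<close> is the part of \<open>\<partial>f/\<partial>y\<close> with negative powers of \<open>l\<close>.\<close>

definition R where "R x m = dQ 3 x m + dP 3 x 0"

lemma dP: "holomorphic_family_on (dP i) UNIV"
  unfolding dP_def[abs_def] by (rule holomorphic_family_on_partial[OF P open_UNIV])

lemma dQ: "holomorphic_family_on (dQ i) UNIV"
  unfolding dQ_def[abs_def] by (rule holomorphic_family_on_partial[OF Q open_UNIV])

lemmas P_mhol = holomorphic_family_onD(2)[OF P UNIV_I]
lemmas Q_mhol = holomorphic_family_onD(2)[OF Q UNIV_I]
lemmas dP_mhol = holomorphic_family_onD(2)[OF dP UNIV_I]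

lemma R: "holomorphic_family_on R UNIV"
  unfolding R_def[abs_def]
  by (intro holomorphic_family_on_add dQ holomorphic_family_on_base dP_mhol)

lemmas R_mhol = holomorphic_family_onD(2)[OF R UNIV_I]

lemma dQ_0: "dQ i x 0 = 0"
  by (simp add: dQ_def Q_0)

lemma pullback_partial:
  assumes l: "l \<noteq> 0"
  shows "dP i x l + dQ i x (1 / l) =
    (if i = 1 then 0 else if i = 2 then 1 else l) * deriv (\<lambda>Om. f Om l) (x $ 2 + x $ 3 * l)"
proof -
  \<comment> \<open>The derivative of \<open>x $ 2 + x $ 3 * l\<close> in the direction
    \<open>i\<close>.\<close>
  let ?k = "if i = 1 then 0 else if i = 2 then 1 else l"
  have "dP i x l + dQ i x (1 / l) = partial i (\<lambda>x. P x l + Q x (1 / l)) x"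
    unfolding dP_def dQ_def by (rule partial_add[symmetric]) (rule P_mhol Q_mhol)+
  also have "\<dots> = partial i (\<lambda>x. f (x $ 2 + x $ 3 * l) l) x"
    using split[OF l] by simp
  also have "\<dots> = ?k * deriv (\<lambda>Om. f Om l) (x $ 2 + x $ 3 * l)"
    unfolding partial_def
  proof (rule DERIV_imp_deriv)
    have "((\<lambda>s. (x + axis i s) $ 2 + (x + axis i s) $ 3 * l) has_field_derivative ?k) (at 0)"
      using exhaust_3[of i] by (auto simp: axis_def intro!: derivative_eq_intros)
    from DERIV_chain2[OF holomorphic_derivI[OF f_hol[OF l] open_UNIV UNIV_I] this]
    show "((\<lambda>s. f ((x + axis i s) $ 2 + (x + axis i s) $ 3 * l) l) has_field_derivative
        ?k * deriv (\<lambda>Om. f Om l) (x $ 2 + x $ 3 * l)) (at 0)"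
      by (simp add: mult.commute)
  qed
  finally show ?thesis .
qed

text \<open>\<open>P\<close> is known only as one half of a splitting of a function without
  \<open>t\<close>. The t-derivatives of the two halves cancel, so they are constant in
  \<open>l\<close> by Liouville, and \<open>Q x 0 = 0\<close> makes the constant 0.\<close>

lemma dP_1: "dP 1 x l = 0"
proof -
  have "dP 1 x l = - dQ 1 x (1 / l)" if "l \<noteq> 0" for l
    using pullback_partial[OF that, of 1 x] by (simp add: add_eq_0_iff2)
  then obtain c where c: "\<And>l. dP 1 x l = c" "\<And>m. - dQ 1 x m = c"
    using Liouville_O0[of "dP 1 x" "\<lambda>m. - dQ 1 x m"] holomorphic_family_onD(3)[OF dP]
      holomorphic_family_onD(3)[OF dQ] by (metis holomorphic_on_minus)
  then have "c = 0" using dQ_0[of 1 x] by (metis neg_equal_0_iff_equal)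
  then show ?thesis using c(1)[of l] by simp
qed

text \<open>Since \<open>\<partial>f/\<partial>z = l \<partial>f/\<partial>y\<close> along the sections, the coefficients satisfy
  \<open>\<partial>\<gamma>\<^sub>n/\<partial>z = \<partial>\<gamma>\<^sub>n\<^sub>-\<^sub>1/\<partial>y\<close>.\<close>

lemma dP_3: "dP 3 x l = dP 3 x 0 + l * dP 2 x l" and dQ_2: "dQ 2 x m = m * R x m"
proof -
  have eq: "dP 3 x l - l * dP 2 x l = l * (dQ 2 x (1 / l) - 1 / l * dQ 3 x (1 / l))" if "l \<noteq> 0" for l
  proof -
    have "dP 3 x l + dQ 3 x (1 / l) = l * (dP 2 x l + dQ 2 x (1 / l))"
      using pullback_partial[OF that, of 2 x] pullback_partial[OF that, of 3 x] by simp
    then show ?thesis using that by (simp add: algebra_simps)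
  qed
  have h: "(\<lambda>l. dP 3 x l - l * dP 2 x l) holomorphic_on UNIV"
    "(\<lambda>m. dQ 2 x m - m * dQ 3 x m) holomorphic_on UNIV"
    by (intro holomorphic_intros holomorphic_family_onD(3)[OF dP] holomorphic_family_onD(3)[OF dQ])+
  obtain a b where ab: "\<And>l. dP 3 x l - l * dP 2 x l = a + b * l"
      "\<And>m. dQ 2 x m - m * dQ 3 x m = b + a * m"
    by (rule Liouville_O1[OF h eq]) (assumption | rule that)+
  \<comment> \<open>Evaluation at 0 in each chart: \<open>b\<close> vanishes since \<open>dQ\<close>
    does there, and \<open>a\<close> is the constant carried over into \<open>R\<close>.\<close>
  have "b = 0" using ab(2)[of 0] dQ_0 by simp
  moreover have "a = dP 3 x 0" using ab(1)[of 0] by simp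
  ultimately show "dP 3 x l = dP 3 x 0 + l * dP 2 x l" "dQ 2 x m = m * R x m"
    using ab(1)[of l] ab(2)[of m] by (simp_all add: R_def algebra_simps)
qed

lemma deriv_f: "l \<noteq> 0 \<Longrightarrow> deriv (\<lambda>Om. f Om l) (x $ 2 + x $ 3 * l) = dP 2 x l + R x (1 / l) / l"
  using pullback_partial[of l 2 x] dQ_2[of x "1 / l"] by simp

lemma gam_sums:
  "(\<Sum>\<^sub>\<infinity>n\<in>{1..}. gam f n (x $ 2) (x $ 3) * l powi n) = P x l - P x 0"
  "(\<Sum>\<^sub>\<infinity>n\<in>{..0}. gam f n (x $ 2) (x $ 3) * m powi (- n)) = P x 0 + Q x m"
  "gam f 0 (x $ 2) (x $ 3) = P x 0"
proof -
  note splitting = laurent_coeffs_splitting[OF holomorphic_family_onD(3)[OF P] holomorphic_family_onD(3)[OF Q] Q_0 split]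
  show "(\<Sum>\<^sub>\<infinity>n\<in>{1..}. gam f n (x $ 2) (x $ 3) * l powi n) = P x l - P x 0"
    "(\<Sum>\<^sub>\<infinity>n\<in>{..0}. gam f n (x $ 2) (x $ 3) * m powi (- n)) = P x 0 + Q x m"
    "gam f 0 (x $ 2) (x $ 3) = P x 0"
    unfolding gam_def by (rule splitting; assumption)+
qed

lemma sec_eq: "sec f x l = vector [x $ 1 - P x l + P x 0, x $ 2 + x $ 3 * l]"
  by (simp add: sec_def gam_sums vector2_eq_iff)

lemma sec_hat_eq: "sec_hat f x m = vector [x $ 1 + P x 0 + Q x m, x $ 2 * m + x $ 3]"
  by (simp add: sec_hat_def gam_sums vector2_eq_iff)

lemma dgam0_eq: "dgam0 f x = dP 2 x 0"
proof -
  have "gam f 0 (x $ 2 + s) (x $ 3) = P (x + axis 2 s) 0" for s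
    using gam_sums(3)[of "x + axis 2 s"] by (simp add: axis_def)
  then show ?thesis
    unfolding dgam0_def dP_def partial_def by (subst deriv_shift_0) (simp add: o_def)
qed

lemma dsec_eq: "dsec f x l a =
  vector [(if a = 1 then 1 else 0) - dP a x l + dP a x 0, if a = 1 then 0 else if a = 2 then 1 else l]"
proof -
  have "partial a (\<lambda>x. x $ 1 - P x l + P x 0) x = (if a = 1 then 1 else 0) - dP a x l + dP a x 0"
    unfolding dP_def
    by (simp add: partial_add partial_diff partial_nth mholomorphic_on_diff P_mhol)
  moreover have "partial a (\<lambda>x. x $ 2 + x $ 3 * l) x = (if a = 1 then 0 else if a = 2 then 1 else l)"
    using exhaust_3[of a]
    by (subst partial_add) (auto simp: partial_nth partial_mult intro!: mholomorphic_on_mult)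
  ultimately show ?thesis
    by (simp add: dsec_def sec_eq vector2_eq_iff)
qed

text \<open>The components of the \<open>\<O>(1)\<close>-valued form \<open>dy + l dz\<close>.\<close>

definition fr :: "complex \<Rightarrow> 3 \<Rightarrow> complex" where
  "fr l a = (if a = 1 then 0 else if a = 2 then 1 else l)"

definition \<theta>0 :: "complex ^ 3 \<Rightarrow> complex ^ 3" where
  "\<theta>0 x = vector [1, dP 2 x 0, 0]"

lemma \<theta>0_nth [simp]: "\<theta>0 x $ 1 = 1" "\<theta>0 x $ 2 = dP 2 x 0" "\<theta>0 x $ 3 = 0"
  by (simp_all add: \<theta>0_def)

lemma fr_nth [simp]: "fr l 1 = 0" "fr l 2 = 1" "fr l 3 = l"
  by (simp_all add: fr_def)

text \<open>By \<open>dP_3\<close> the l-dependent parts of the dy and dz coefficients of dT combine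
  into a single multiple of dy + l dz; what remains is \<open>\<theta>0\<close>, free of
  \<open>l\<close>.\<close>

lemma dsec_frame: "dsec f x l a = vector [\<theta>0 x $ a - dP 2 x l * fr l a, fr l a]"
  using exhaust_3[of a] dP_3[of x l] by (auto simp: dsec_eq vector2_eq_iff dP_1)

lemma normal_patch_eq:
  assumes l: "l \<noteq> 0"
  shows "normal_patch f x l = vector [vector [1, dP 2 x l + R x (1 / l) / l], vector [0, 1 / l]]"
proof -
  let ?T = "sec f x l $ 1" and ?O = "x $ 2 + x $ 3 * l"
  have "deriv (\<lambda>s. ?T + s + f ?O l) 0 = 1"
    by (rule DERIV_imp_deriv) (auto intro!: derivative_eq_intros)
  moreover have "deriv (\<lambda>s. ?T + f (?O + s) l) 0 = dP 2 x l + R x (1 / l) / l"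
  proof (rule DERIV_imp_deriv)
    have "((\<lambda>Om. f Om l) has_field_derivative deriv (\<lambda>Om. f Om l) ?O) (at (0 + ?O))"
      by (simp add: holomorphic_derivI[OF f_hol[OF l]])
    then have "((\<lambda>s. f (?O + s) l) has_field_derivative deriv (\<lambda>Om. f Om l) ?O) (at 0)"
      unfolding DERIV_shift by (simp add: add.commute)
    then show "((\<lambda>s. ?T + f (?O + s) l) has_field_derivative dP 2 x l + R x (1 / l) / l) (at 0)"
      using deriv_f[OF l, of x] by (auto intro!: derivative_eq_intros)
  qed
  moreover have "deriv (\<lambda>s. (?O + s) / l) 0 = 1 / l"
    using l by (intro DERIV_imp_deriv) (auto intro!: derivative_eq_intros)
  ultimately show ?thesis
    by (simp add: normal_patch_def twistor_patch_def vector2_eq_iff partial_def axis_def sec_eq)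
qed

end

section \<open>Clocks and connections\<close>

lemma holomorphic_matrix_iff:
  "holomorphic_matrix A \<longleftrightarrow> (\<lambda>l. A l $ 1 $ 1) holomorphic_on UNIV \<and> (\<lambda>l. A l $ 1 $ 2) holomorphic_on UNIV \<and>
     (\<lambda>l. A l $ 2 $ 1) holomorphic_on UNIV \<and> (\<lambda>l. A l $ 2 $ 2) holomorphic_on UNIV"
  by (auto simp: holomorphic_matrix_def forall_2)

text \<open>The entries are sections of the Hom bundles between the summands: O on the diagonal,
  O(1) below it, and above it O(-1), whose only section is 0.\<close>

lemma endomorphism_O_O1:
  assumes "k11 holomorphic_on UNIV" "k12 holomorphic_on UNIV" "k21 holomorphic_on UNIV" "k22 holomorphic_on UNIV"
    and "h11 holomorphic_on UNIV" "h12 holomorphic_on UNIV" "h21 holomorphic_on UNIV" "h22 holomorphic_on UNIV"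
    and "\<And>l. l \<noteq> 0 \<Longrightarrow> k11 l = h11 (1 / l)" "\<And>l. l \<noteq> 0 \<Longrightarrow> k12 l = h12 (1 / l) / l"
    and "\<And>l. l \<noteq> 0 \<Longrightarrow> k21 l = l * h21 (1 / l)" "\<And>l. l \<noteq> 0 \<Longrightarrow> k22 l = h22 (1 / l)"
  obtains a c0 c1 d where "\<And>l. k11 l = a" "\<And>l. k12 l = 0" "\<And>l. k21 l = c0 + c1 * l" "\<And>l. k22 l = d"
proof -
  obtain a where a: "\<And>l. k11 l = a"
    by (rule Liouville_O0[OF assms(1,5,9)]) (assumption | rule that)+
  obtain d where d: "\<And>l. k22 l = d"
    by (rule Liouville_O0[OF assms(4,8,12)]) (assumption | rule that)+
  obtain c0 c1 where c: "\<And>l. k21 l = c0 + c1 * l"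
    by (rule Liouville_O1[OF assms(3,7,11)]) (assumption | rule that)+
  have k12: "k12 l = 0" for l
  proof -
    \<comment> \<open>A section of O(-1) is treated as a section of O vanishing at infinity.\<close>
    have "(\<lambda>m. m * h12 m) holomorphic_on UNIV" using assms(6) by (intro holomorphic_intros)
    moreover have "k12 l = 1 / l * h12 (1 / l)" if "l \<noteq> 0" for l
      using assms(10)[OF that] by simp
    ultimately obtain c where c: "\<And>l. k12 l = c" "\<And>m. m * h12 m = c"
      by (rule Liouville_O0[OF assms(2)]) (assumption | rule that)+
    from c(2)[of 0] c(1) show ?thesis by simp
  qed
  show ?thesis by (rule that[OF a k12 c d])
qed

context twistor_family
begin

lemmas dP_hol [holomorphic_intros] = holomorphic_family_onD(3)[OF dP]
lemmas R_hol [holomorphic_intros] = holomorphic_family_onD(3)[OF R]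

text \<open>The factor \<open>k\<close> turns the clock into \<open>\<theta>0\<close> divided by
  \<open>k\<close>; \<open>k = exp (- \<phi> x)\<close> will give all clocks. \<open>R\<close>
  replaces \<open>- dP 2\<close> in the other chart because the two are the halves of the
  off-diagonal patching entry.\<close>

lemma normal_splitting_scaled:
  fixes k :: complex and x :: "complex ^ 3"
  assumes k: "k \<noteq> 0"
  defines "H \<equiv> \<lambda>l. matrix2 k (- dP 2 x l) 0 1"
  shows "normal_splitting f x H (\<lambda>m. matrix2 k (R x m) 0 1)"
    and "matrix_inv (H l) = matrix2 (1 / k) (dP 2 x l / k) 0 1"
proof -
  have H: "matrix_inv (H l) = matrix2 (1 / k) (dP 2 x l / k) 0 1" "invertible (H l)" for l
    using k by (intro matrix_inv_eqI[of _ "matrix2 (1 / k) (dP 2 x l / k) 0 1"]; simp add: H_def matrix2_simps)+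
  then show "matrix_inv (H l) = matrix2 (1 / k) (dP 2 x l / k) 0 1" by blast
  have Hh: "invertible (matrix2 k (R x m) 0 1)" for m
    using k by (intro matrix_inv_eqI(2)[of _ "matrix2 (1 / k) (- R x m / k) 0 1"]; simp add: matrix2_simps)
  show "normal_splitting f x H (\<lambda>m. matrix2 k (R x m) 0 1)"
    unfolding normal_splitting_def H(1)
  proof (intro conjI allI impI)
    show "holomorphic_matrix H" "holomorphic_matrix (\<lambda>m. matrix2 k (R x m) 0 1)"
      by (auto simp: holomorphic_matrix_iff H_def intro!: holomorphic_intros)
    show "normal_patch f x l = matrix2 k (R x (1 / l)) 0 1 ** matrix2 1 0 0 (1 / l) **
        matrix2 (1 / k) (dP 2 x l / k) 0 1" if "l \<noteq> 0" for l
      using k by (simp add: normal_patch_eq[OF that] matrix2_simps)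
  qed (use H Hh in auto)
qed

text \<open>Relative to the splitting with \<open>k = 1\<close>, \<open>H\<close> becomes an
  endomorphism of the sum of O and O(1), with first row \<open>(a, 0)\<close> and \<open>a\<close>
  constant in \<open>l\<close>. So the first component of a frame section sees \<open>H\<close> only
  through \<open>a\<close>.\<close>

lemma normal_splitting_first_row:
  assumes "normal_splitting f x H Hh"
  obtains a where "\<And>l u w. H l *v u = w \<Longrightarrow> a * u $ 1 = w $ 1 + dP 2 x l * w $ 2"
proof -
  have hol: "holomorphic_matrix H" "holomorphic_matrix Hh"
    and inv: "\<And>l. invertible (H l)"
    and N: "\<And>l. l \<noteq> 0 \<Longrightarrow> normal_patch f x l = Hh (1 / l) ** matrix2 1 0 0 (1 / l) ** matrix_inv (H l)"
    using assms by (auto simp: normal_splitting_def)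
  have NH: "normal_patch f x l ** H l = Hh (1 / l) ** matrix2 1 0 0 (1 / l)" if "l \<noteq> 0" for l
    unfolding N[OF that] by (simp add: matrix_mul_assoc[symmetric] matrix_inv_mult[OF inv])
  have e: "H l $ 1 $ 1 + (dP 2 x l + R x (1 / l) / l) * H l $ 2 $ 1 = Hh (1 / l) $ 1 $ 1"
    "H l $ 1 $ 2 + (dP 2 x l + R x (1 / l) / l) * Hh (1 / l) $ 2 $ 2 = Hh (1 / l) $ 1 $ 2 / l"
    "H l $ 2 $ 1 / l = Hh (1 / l) $ 2 $ 1" "H l $ 2 $ 2 = Hh (1 / l) $ 2 $ 2" if "l \<noteq> 0" for l
    using arg_cong[OF NH[OF that], of "\<lambda>A :: complex ^ 2 ^ 2. A $ 1 $ 1"] arg_cong[OF NH[OF that], of "\<lambda>A :: complex ^ 2 ^ 2. A $ 1 $ 2"]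
      arg_cong[OF NH[OF that], of "\<lambda>A :: complex ^ 2 ^ 2. A $ 2 $ 1"] arg_cong[OF NH[OF that], of "\<lambda>A :: complex ^ 2 ^ 2. A $ 2 $ 2"] that
    by (simp_all add: normal_patch_eq[OF that] matrix_mult_nth_2)
  obtain a c0 c1 d where K: "\<And>l. H l $ 1 $ 1 + dP 2 x l * H l $ 2 $ 1 = a"
    "\<And>l. H l $ 1 $ 2 + dP 2 x l * H l $ 2 $ 2 = 0" "\<And>l. H l $ 2 $ 1 = c0 + c1 * l" "\<And>l. H l $ 2 $ 2 = d"
  \<comment> \<open>Entries of \<open>H\<close> and \<open>Hh\<close> multiplied from the left by
    the inverse standard splittings, with rows \<open>(1, dP 2 x l)\<close>, \<open>(0, 1)\<close>
    and \<open>(1, - R x m)\<close>, \<open>(0, 1)\<close>.\<close>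
  proof (rule endomorphism_O_O1[of "\<lambda>l. H l $ 1 $ 1 + dP 2 x l * H l $ 2 $ 1" "\<lambda>l. H l $ 1 $ 2 + dP 2 x l * H l $ 2 $ 2"
      "\<lambda>l. H l $ 2 $ 1" "\<lambda>l. H l $ 2 $ 2"
      "\<lambda>m. Hh m $ 1 $ 1 - R x m * Hh m $ 2 $ 1" "\<lambda>m. Hh m $ 1 $ 2 - R x m * Hh m $ 2 $ 2"
      "\<lambda>m. Hh m $ 2 $ 1" "\<lambda>m. Hh m $ 2 $ 2"])
    fix l :: complex assume l: "l \<noteq> 0"
    show "H l $ 1 $ 1 + dP 2 x l * H l $ 2 $ 1 = Hh (1 / l) $ 1 $ 1 - R x (1 / l) * Hh (1 / l) $ 2 $ 1"
      using e(1)[OF l] unfolding e(3)[OF l, symmetric] by (simp add: algebra_simps)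
    show "H l $ 1 $ 2 + dP 2 x l * H l $ 2 $ 2 = (Hh (1 / l) $ 1 $ 2 - R x (1 / l) * Hh (1 / l) $ 2 $ 2) / l"
      using e(2,4)[OF l] l by (simp add: diff_divide_distrib) (simp add: algebra_simps)
    show "H l $ 2 $ 1 = l * Hh (1 / l) $ 2 $ 1" "H l $ 2 $ 2 = Hh (1 / l) $ 2 $ 2"
      using e(3,4)[OF l] l by (simp_all add: field_simps)
  qed (use hol in \<open>auto simp: holomorphic_matrix_iff intro!: holomorphic_intros\<close>)
  have "a * u $ 1 = w $ 1 + dP 2 x l * w $ 2" if "H l *v u = w" for l and u w :: "complex ^ 2"
  proof -
    have "w $ 1 + dP 2 x l * w $ 2 =
        (H l $ 1 $ 1 + dP 2 x l * H l $ 2 $ 1) * u $ 1 + (H l $ 1 $ 2 + dP 2 x l * H l $ 2 $ 2) * u $ 2"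
      unfolding that[symmetric] matrix_vector_mult_nth_2 by (simp add: algebra_simps)
    then show ?thesis unfolding K(1,2) by simp
  qed
  then show ?thesis using that by blast
qed

lemma \<theta>0_mhol: "(\<lambda>x. \<theta>0 x $ a) mholomorphic_on UNIV"
  using exhaust_3[of a] dP_mhol by auto

text \<open>The splitting may vary with \<open>x\<close> without any regularity, but
  \<open>\<theta>0\<close> has first component 1, so the factor is \<open>\<theta> x $ 1\<close>:
  holomorphic, nowhere zero, and hence an exponential.\<close>

lemma frame_clock_iff:
  "frame_clock f \<theta> \<longleftrightarrow> (\<exists>\<phi>. \<phi> mholomorphic_on UNIV \<and> \<theta> = (\<lambda>x. exp (\<phi> x) *s \<theta>0 x))"
proof
  assume "frame_clock f \<theta>"
  then obtain H Hh where \<theta>: "holomorphic_one_form \<theta>" and split: "\<And>x. normal_splitting f x (H x) (Hh x)"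
    and v: "\<And>x l a. (matrix_inv (H x l) *v dsec f x l a) $ 1 = \<theta> x $ a"
    by (auto simp: frame_clock_def)
  have "\<exists>k. \<forall>a. k * \<theta> x $ a = \<theta>0 x $ a" for x
  proof -
    obtain k where k: "\<And>l u w. H x l *v u = w \<Longrightarrow> k * u $ 1 = w $ 1 + dP 2 x l * w $ 2"
      using normal_splitting_first_row[OF split[of x]] by blast
    have "k * \<theta> x $ a = \<theta>0 x $ a" for a
    proof -
      have "H x 0 *v (matrix_inv (H x 0) *v dsec f x 0 a) = dsec f x 0 a"
        using split[of x] by (simp add: normal_splitting_def matrix_vector_mul_assoc matrix_inv_mult)
      from k[OF this] have "k * \<theta> x $ a = dsec f x 0 a $ 1 + dP 2 x 0 * dsec f x 0 a $ 2"
        unfolding v .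
      then show ?thesis by (simp add: dsec_frame)
    qed
    then show ?thesis by blast
  qed
  then obtain k where k: "\<And>x a. k x * \<theta> x $ a = \<theta>0 x $ a" by metis
  have nz: "\<theta> x $ 1 \<noteq> 0" for x
    using k[of x 1] by auto
  have \<theta>_eq: "\<theta> x $ a = \<theta> x $ 1 * \<theta>0 x $ a" for x a
  proof -
    have "\<theta> x $ 1 * \<theta>0 x $ a = (k x * \<theta> x $ 1) * \<theta> x $ a"
      by (simp only: k[of x a, symmetric] mult_ac)
    then show ?thesis using k[of x 1] by simp
  qed
  have "(\<lambda>x. \<theta> x $ 1) mholomorphic_on UNIV" using \<theta> by (simp add: holomorphic_one_form_def)
  then obtain \<phi> where \<phi>: "\<phi> mholomorphic_on UNIV" "\<And>x. \<theta> x $ 1 = exp (\<phi> x)"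
    using mholomorphic_logarithm nz by blast
  have "\<theta> x $ a = (exp (\<phi> x) *s \<theta>0 x) $ a" for x a
    unfolding vector_smult_component \<phi>(2)[symmetric] by (rule \<theta>_eq)
  then have "\<theta> = (\<lambda>x. exp (\<phi> x) *s \<theta>0 x)"
    by (simp add: fun_eq_iff vec_eq_iff)
  with \<phi>(1) show "\<exists>\<phi>. \<phi> mholomorphic_on UNIV \<and> \<theta> = (\<lambda>x. exp (\<phi> x) *s \<theta>0 x)"
    by blast
next
  assume "\<exists>\<phi>. \<phi> mholomorphic_on UNIV \<and> \<theta> = (\<lambda>x. exp (\<phi> x) *s \<theta>0 x)"
  then obtain \<phi> where \<phi>: "\<phi> mholomorphic_on UNIV" and \<theta>: "\<theta> = (\<lambda>x. exp (\<phi> x) *s \<theta>0 x)" by blast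
  have "holomorphic_one_form \<theta>"
    unfolding holomorphic_one_form_def \<theta>
    by (auto intro!: mholomorphic_on_mult mholomorphic_on_exp \<phi> \<theta>0_mhol)
  moreover have "(matrix_inv (matrix2 (exp (- \<phi> x)) (- dP 2 x l) 0 1) *v dsec f x l a) $ 1 = \<theta> x $ a" for x l a
    unfolding normal_splitting_scaled(2)[OF exp_not_eq_zero]
    by (simp add: dsec_frame matrix2_simps \<theta> exp_minus divide_inverse) (simp add: algebra_simps)
  moreover have "normal_splitting f x (\<lambda>l. matrix2 (exp (- \<phi> x)) (- dP 2 x l) 0 1)
      (\<lambda>m. matrix2 (exp (- \<phi> x)) (R x m) 0 1)" for x
    by (rule normal_splitting_scaled(1)) simp
  ultimately show "frame_clock f \<theta>"
    unfolding frame_clock_def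
    by (intro conjI exI[of _ "\<lambda>x l. matrix2 (exp (- \<phi> x)) (- dP 2 x l) 0 1"]
      exI[of _ "\<lambda>x m. matrix2 (exp (- \<phi> x)) (R x m) 0 1"] allI)
qed

definition ddP where "ddP b x l = partial b (\<lambda>x. dP 2 x l) x"
definition dR where "dR b x m = partial b (\<lambda>x. R x m) x"

lemma ddP_hol [holomorphic_intros]: "ddP b x holomorphic_on UNIV"
  using holomorphic_family_onD(3)[OF holomorphic_family_on_partial[OF dP open_UNIV], of b 2 x]
  by (simp add: ddP_def[abs_def])

lemma dR_hol [holomorphic_intros]: "dR b x holomorphic_on UNIV"
  using holomorphic_family_onD(3)[OF holomorphic_family_on_partial[OF R open_UNIV], of b x]
  by (simp add: dR_def[abs_def])

lemma partial_\<theta>0: "partial b (\<lambda>x. \<theta>0 x $ a) x = (if a = 2 then ddP b x 0 else 0)"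
  using exhaust_3[of a] by (auto simp: ddP_def)

lemma partial_normal_patch:
  assumes "l \<noteq> 0"
  shows "(\<chi> \<mu> \<nu>. partial b (\<lambda>x. normal_patch f x l $ \<mu> $ \<nu>) x) = matrix2 0 (ddP b x l + dR b x (1 / l) / l) 0 0"
proof -
  have "partial b (\<lambda>x. dP 2 x l + 1 / l * R x (1 / l)) x = ddP b x l + 1 / l * dR b x (1 / l)"
    unfolding ddP_def dR_def
    by (simp only: partial_add partial_cmult dP_mhol R_mhol mholomorphic_on_mult mholomorphic_on_const)
  then show ?thesis by (simp add: normal_patch_eq[OF assms] vector2_eq_iff)
qed

lemma ddsec_eq: "ddsec f x l a b = vector [partial a (\<lambda>x. \<theta>0 x $ b) x - ddP a x l * fr l b, 0]"
proof -
  have "partial a (\<lambda>x. \<theta>0 x $ b - dP 2 x l * fr l b) x = partial a (\<lambda>x. \<theta>0 x $ b) x - ddP a x l * fr l b"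
    by (simp add: partial_diff partial_mult \<theta>0_mhol dP_mhol mholomorphic_on_mult ddP_def)
  then show ?thesis by (simp add: ddsec_def dsec_frame vector2_eq_iff)
qed

text \<open>Second derivatives of T along the section commute. The connection symbols contain the
  derivative of the component \<open>a\<close> in the direction \<open>b\<close>, whereas
  \<open>ddsec f x l a b\<close> yields the other order.\<close>

lemma ddsec_symmetric:
  "partial a (\<lambda>x. \<theta>0 x $ b) x - ddP a x l * fr l b = partial b (\<lambda>x. \<theta>0 x $ a) x - ddP b x l * fr l a"
proof -
  let ?T = "\<lambda>x. sec f x l $ 1"
  have "?T mholomorphic_on UNIV"
    by (simp add: sec_eq mholomorphic_on_add mholomorphic_on_diff P_mhol)
  from partial_commute[OF this]
  have "ddsec f x l a b $ 1 = ddsec f x l b a $ 1"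
    by (simp add: ddsec_def dsec_def)
  then show ?thesis by (simp add: ddsec_eq)
qed

text \<open>The contraction with \<open>\<theta>0\<close> is prescribed as the derivative of
  \<open>\<theta>0\<close> plus \<open>\<alpha> x b\<close> times \<open>\<theta>0\<close>. Solving
  it for the t-symbol subtracts \<open>dP 2 x 0\<close> times the y-symbol.\<close>

definition Xi_connection ::
    "(complex ^ 3 \<Rightarrow> 3 \<Rightarrow> complex) \<Rightarrow> (complex ^ 3 \<Rightarrow> 3 \<Rightarrow> complex) \<Rightarrow> (complex ^ 3 \<Rightarrow> 3 \<Rightarrow> complex) \<Rightarrow>
     (complex ^ 3 \<Rightarrow> 3 \<Rightarrow> complex) \<Rightarrow> connection" where
  "Xi_connection \<alpha> \<beta> \<gamma> \<delta> x c a b =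
     (let \<Gamma>y = \<beta> x b * \<theta>0 x $ a + (if a = 2 then \<delta> x b else 0);
          \<Gamma>z = \<gamma> x b * \<theta>0 x $ a + (if a = 3 then \<delta> x b else 0);
          \<Gamma>t = partial b (\<lambda>x. \<theta>0 x $ a) x + \<alpha> x b * \<theta>0 x $ a - dP 2 x 0 * \<Gamma>y
      in if c = 1 then \<Gamma>t else if c = 2 then \<Gamma>y else \<Gamma>z)"

lemma Xi_connection_nth:
  "Xi_connection \<alpha> \<beta> \<gamma> \<delta> x 1 a b = partial b (\<lambda>x. \<theta>0 x $ a) x + \<alpha> x b * \<theta>0 x $ a
      - dP 2 x 0 * (\<beta> x b * \<theta>0 x $ a + (if a = 2 then \<delta> x b else 0))"
  "Xi_connection \<alpha> \<beta> \<gamma> \<delta> x 2 a b = \<beta> x b * \<theta>0 x $ a + (if a = 2 then \<delta> x b else 0)"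
  "Xi_connection \<alpha> \<beta> \<gamma> \<delta> x 3 a b = \<gamma> x b * \<theta>0 x $ a + (if a = 3 then \<delta> x b else 0)"
  by (simp_all add: Xi_connection_def)

lemma holomorphic_connection_Xi:
  assumes "\<And>b. (\<lambda>x. \<alpha> x b) mholomorphic_on UNIV" "\<And>b. (\<lambda>x. \<beta> x b) mholomorphic_on UNIV"
    "\<And>b. (\<lambda>x. \<gamma> x b) mholomorphic_on UNIV" "\<And>b. (\<lambda>x. \<delta> x b) mholomorphic_on UNIV"
  shows "holomorphic_connection (Xi_connection \<alpha> \<beta> \<gamma> \<delta>)"
proof -
  have p: "(\<lambda>x. partial b (\<lambda>x. \<theta>0 x $ a) x) mholomorphic_on UNIV" for a b
    using mholomorphic_on_partial[OF \<theta>0_mhol[of a], of b] by simp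
  have d: "(\<lambda>x. if a = (k :: 3) then \<delta> x b else 0) mholomorphic_on UNIV" for a k b
    using assms(4) by (cases "a = k") auto
  have "(\<lambda>x. Xi_connection \<alpha> \<beta> \<gamma> \<delta> x c a b) mholomorphic_on UNIV" for a b c
    using exhaust_3[of c]
    by (elim disjE; simp only: Xi_connection_nth)
      (intro mholomorphic_on_add mholomorphic_on_diff mholomorphic_on_mult \<theta>0_mhol p d assms dP_mhol)+
  then show ?thesis by (simp add: holomorphic_connection_def)
qed

text \<open>Because \<open>\<theta>0\<close> has first component 1, the symbols with
  \<open>a = 1\<close> expose \<open>\<beta>\<close>, \<open>\<gamma>\<close> and then
  \<open>\<alpha>\<close>; the symbol with \<open>c = a = 2\<close> yields
  \<open>\<delta>\<close>.\<close>

lemma holomorphic_connection_XiD: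
  assumes "holomorphic_connection (Xi_connection \<alpha> \<beta> \<gamma> \<delta>)"
  shows "(\<lambda>x. \<alpha> x b) mholomorphic_on UNIV" "(\<lambda>x. \<beta> x b) mholomorphic_on UNIV"
    "(\<lambda>x. \<gamma> x b) mholomorphic_on UNIV" "(\<lambda>x. \<delta> x b) mholomorphic_on UNIV"
proof -
  have G: "(\<lambda>x. Xi_connection \<alpha> \<beta> \<gamma> \<delta> x c a b) mholomorphic_on UNIV" for c a b
    using assms by (simp add: holomorphic_connection_def)
  show \<beta>: "(\<lambda>x. \<beta> x b) mholomorphic_on UNIV"
    using G[of 2 1 b] by (simp add: Xi_connection_nth)
  show "(\<lambda>x. \<gamma> x b) mholomorphic_on UNIV"
    using G[of 3 1 b] by (simp add: Xi_connection_nth)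
  show "(\<lambda>x. \<alpha> x b) mholomorphic_on UNIV"
    using mholomorphic_on_add[OF G[of 1 1 b] mholomorphic_on_mult[OF dP_mhol[of 2 0] \<beta>]]
    by (simp add: Xi_connection_nth)
  show "(\<lambda>x. \<delta> x b) mholomorphic_on UNIV"
    using mholomorphic_on_diff[OF G[of 2 2 b] mholomorphic_on_mult[OF \<beta> dP_mhol[of 2 0]]]
    by (simp add: Xi_connection_nth)
qed

text \<open>Conjugating by the splitting turns \<open>\<rho>\<close>, relative to the solution with only entry
  \<open>\<partial>\<^sub>b\<partial>P/\<partial>y\<close>, into an endomorphism of \<open>\<O> \<oplus> \<O>(1)\<close>; the latter's entries are \<open>\<alpha>\<close>, \<open>\<beta> + \<gamma> l\<close>, \<open>\<delta>\<close>.\<close>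

lemma normal_connection_entries:
  fixes r rh :: "complex \<Rightarrow> complex ^ 2 ^ 2"
  assumes \<rho>: "holomorphic_matrix r" "holomorphic_matrix rh"
    and eq: "\<And>l. l \<noteq> 0 \<Longrightarrow> (\<chi> \<mu> \<nu>. partial b (\<lambda>x. normal_patch f x l $ \<mu> $ \<nu>) x) =
        - (rh (1 / l) ** normal_patch f x l) + normal_patch f x l ** r l"
  obtains \<alpha> \<beta> \<gamma> \<delta> where
    "\<And>l. r l $ 1 $ 1 + dP 2 x l * r l $ 2 $ 1 = \<alpha>"
    "\<And>l. r l $ 1 $ 2 - ddP b x l + dP 2 x l * r l $ 2 $ 2
       - dP 2 x l * (r l $ 1 $ 1 + dP 2 x l * r l $ 2 $ 1) = 0"
    "\<And>l. r l $ 2 $ 1 = \<beta> + \<gamma> * l" "\<And>l. r l $ 2 $ 2 - dP 2 x l * r l $ 2 $ 1 = \<delta>"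
proof (rule endomorphism_O_O1[of
    "\<lambda>l. r l $ 1 $ 1 + dP 2 x l * r l $ 2 $ 1"
    "\<lambda>l. r l $ 1 $ 2 - ddP b x l + dP 2 x l * r l $ 2 $ 2
       - dP 2 x l * (r l $ 1 $ 1 + dP 2 x l * r l $ 2 $ 1)"
    "\<lambda>l. r l $ 2 $ 1" "\<lambda>l. r l $ 2 $ 2 - dP 2 x l * r l $ 2 $ 1"
    "\<lambda>m. rh m $ 1 $ 1 - R x m * rh m $ 2 $ 1"
    "\<lambda>m. rh m $ 1 $ 2 + dR b x m - R x m * rh m $ 2 $ 2
       + R x m * (rh m $ 1 $ 1 - R x m * rh m $ 2 $ 1)"
    "\<lambda>m. rh m $ 2 $ 1" "\<lambda>m. rh m $ 2 $ 2 + R x m * rh m $ 2 $ 1"])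
  fix l :: complex assume l: "l \<noteq> 0"
  let ?P = "dP 2 x l" and ?Q = "R x (1 / l) / l"
  define g where "g = ?P + ?Q"
  have N: "normal_patch f x l = matrix2 1 g 0 (1 / l)"
    using normal_patch_eq[OF l] by (simp add: g_def)
  note e = eq[OF l, unfolded partial_normal_patch[OF l] N]
  have e11: "rh (1 / l) $ 1 $ 1 = r l $ 1 $ 1 + g * r l $ 2 $ 1"
    using arg_cong[OF e, of "\<lambda>A :: complex ^ 2 ^ 2. A $ 1 $ 1"] by (simp add: matrix_mult_nth_2 algebra_simps)
  have e12: "rh (1 / l) $ 1 $ 2 / l = r l $ 1 $ 2 + g * r l $ 2 $ 2 - rh (1 / l) $ 1 $ 1 * g
      - (ddP b x l + dR b x (1 / l) / l)"
    using arg_cong[OF e, of "\<lambda>A :: complex ^ 2 ^ 2. A $ 1 $ 2"] by (simp add: matrix_mult_nth_2 algebra_simps)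
  have e21: "rh (1 / l) $ 2 $ 1 = r l $ 2 $ 1 / l"
    using arg_cong[OF e, of "\<lambda>A :: complex ^ 2 ^ 2. A $ 2 $ 1"] by (simp add: matrix_mult_nth_2 algebra_simps)
  have e22: "rh (1 / l) $ 2 $ 2 = r l $ 2 $ 2 - r l $ 2 $ 1 * g"
    using arg_cong[OF e, of "\<lambda>A :: complex ^ 2 ^ 2. A $ 2 $ 2"] l
    by (simp add: matrix_mult_nth_2 e21 field_simps)
  have K11: "rh (1 / l) $ 1 $ 1 - R x (1 / l) * rh (1 / l) $ 2 $ 1 = r l $ 1 $ 1 + ?P * r l $ 2 $ 1"
    unfolding e11 e21 g_def by (simp add: algebra_simps)
  show "r l $ 1 $ 1 + ?P * r l $ 2 $ 1 = rh (1 / l) $ 1 $ 1 - R x (1 / l) * rh (1 / l) $ 2 $ 1"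
    by (simp only: K11)
  have s: "(a + d - k * c + k * e) / l = a / l + d / l - k / l * c + k / l * e" for a d k c e
    by (simp add: add_divide_distrib diff_divide_distrib)
  \<comment> \<open>The \<open>(1, 2)\<close> entry as a polynomial identity: \<open>p\<close> and
    \<open>q\<close> stand for the two parts of the off-diagonal patching entry, \<open>d\<close>
    and \<open>e\<close> for their derivatives.\<close>
  have t: "(a12 + (p + q) * a22 - (a11 + (p + q) * a21) * (p + q) - (d + e)) + e
      - q * (a22 - a21 * (p + q)) + q * (a11 + p * a21) = a12 - d + p * a22 - p * (a11 + p * a21)"
    for a11 a12 a21 a22 p q d e :: complex
    by (simp add: algebra_simps)
  show "r l $ 1 $ 2 - ddP b x l + ?P * r l $ 2 $ 2 - ?P * (r l $ 1 $ 1 + ?P * r l $ 2 $ 1) =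
    (rh (1 / l) $ 1 $ 2 + dR b x (1 / l) - R x (1 / l) * rh (1 / l) $ 2 $ 2
       + R x (1 / l) * (rh (1 / l) $ 1 $ 1 - R x (1 / l) * rh (1 / l) $ 2 $ 1)) / l"
    unfolding s unfolding K11 unfolding e12 e22 unfolding e11 g_def by (rule t[symmetric])
  show "r l $ 2 $ 1 = l * rh (1 / l) $ 2 $ 1" using l by (simp add: e21)
  show "r l $ 2 $ 2 - ?P * r l $ 2 $ 1 = rh (1 / l) $ 2 $ 2 + R x (1 / l) * rh (1 / l) $ 2 $ 1"
    unfolding e22 e21 g_def by (simp add: algebra_simps)
qed (use \<rho> that in \<open>auto simp: holomorphic_matrix_iff intro!: holomorphic_intros\<close>)

text \<open>The second component of the defining equation is affine in \<open>l\<close>, so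
  \<open>l = 0\<close> and \<open>l = 1\<close> give the y- and z-symbols; the first component at
  \<open>l = 0\<close> gives the t-symbol. The coefficients are found for each \<open>x\<close> and
  \<open>b\<close> and collected by choice; \<open>holomorphic_connection_XiD\<close> later recovers
  their holomorphy.\<close>

lemma torsion_Xi_connectionD:
  assumes "torsion_Xi_connection f \<Gamma>"
  obtains \<alpha> \<beta> \<gamma> \<delta> where "\<Gamma> = Xi_connection \<alpha> \<beta> \<gamma> \<delta>"
proof -
  obtain \<rho> \<rho>h where hol: "\<And>x b. holomorphic_matrix (\<rho> x b)" "\<And>x b. holomorphic_matrix (\<rho>h x b)"
    and eq: "\<And>x b l. l \<noteq> 0 \<Longrightarrow> (\<chi> \<mu> \<nu>. partial b (\<lambda>x. normal_patch f x l $ \<mu> $ \<nu>) x) =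
             - (\<rho>h x b (1 / l) ** normal_patch f x l) + normal_patch f x l ** \<rho> x b l"
    and \<Gamma>: "\<And>x l a b. (\<Sum>c\<in>UNIV. \<Gamma> x c a b *s dsec f x l c) = ddsec f x l a b + \<rho> x b l *v dsec f x l a"
    using assms unfolding torsion_Xi_connection_def by blast
  have "\<exists>\<alpha> \<beta> \<gamma> \<delta>. \<forall>c a. \<Gamma> x c a b =
      Xi_connection (\<lambda>_ _. \<alpha>) (\<lambda>_ _. \<beta>) (\<lambda>_ _. \<gamma>) (\<lambda>_ _. \<delta>) x c a b" for x b
  proof -
    obtain \<alpha> \<beta> \<gamma> \<delta> where
      e1: "\<And>l. \<rho> x b l $ 1 $ 1 + dP 2 x l * \<rho> x b l $ 2 $ 1 = \<alpha>" and
      e2: "\<And>l. \<rho> x b l $ 1 $ 2 - ddP b x l + dP 2 x l * \<rho> x b l $ 2 $ 2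
         - dP 2 x l * (\<rho> x b l $ 1 $ 1 + dP 2 x l * \<rho> x b l $ 2 $ 1) = 0" and
      r21: "\<And>l. \<rho> x b l $ 2 $ 1 = \<beta> + \<gamma> * l" and
      e4: "\<And>l. \<rho> x b l $ 2 $ 2 - dP 2 x l * \<rho> x b l $ 2 $ 1 = \<delta>"
      by (rule normal_connection_entries[OF hol eq]) (assumption | rule that)+
    have r11: "\<rho> x b l $ 1 $ 1 = \<alpha> - dP 2 x l * (\<beta> + \<gamma> * l)" for l
      using e1[of l] unfolding r21 by (simp only: eq_diff_eq)
    have r22: "\<rho> x b l $ 2 $ 2 = \<delta> + dP 2 x l * (\<beta> + \<gamma> * l)" for l
      using e4[of l] unfolding r21 by (simp only: diff_eq_eq)
    have r12: "\<rho> x b l $ 1 $ 2 = ddP b x l - dP 2 x l * \<rho> x b l $ 2 $ 2 + dP 2 x l * \<alpha>" for l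
      using e2[of l] unfolding e1 by algebra
    have two: "\<Gamma> x 2 a b + l * \<Gamma> x 3 a b = (\<beta> + \<gamma> * l) * \<theta>0 x $ a + \<delta> * fr l a" for l a
    proof -
      have "\<Gamma> x 2 a b + l * \<Gamma> x 3 a b = (\<Sum>c\<in>UNIV. \<Gamma> x c a b *s dsec f x l c) $ 2"
        by (simp add: sum_3 dsec_frame)
      also have "\<dots> = \<rho> x b l $ 2 $ 1 * (\<theta>0 x $ a - dP 2 x l * fr l a) + \<rho> x b l $ 2 $ 2 * fr l a"
        unfolding \<Gamma> by (simp add: ddsec_eq dsec_frame matrix_vector_mult_nth_2)
      also have "\<dots> = (\<beta> + \<gamma> * l) * \<theta>0 x $ a + \<delta> * fr l a"
        unfolding r21 r22 by (simp add: algebra_simps)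
      finally show ?thesis .
    qed
    have \<Gamma>2: "\<Gamma> x 2 a b = \<beta> * \<theta>0 x $ a + (if a = 2 then \<delta> else 0)" for a
      using two[of a 0] exhaust_3[of a] by auto
    have \<Gamma>3: "\<Gamma> x 3 a b = \<gamma> * \<theta>0 x $ a + (if a = 3 then \<delta> else 0)" for a
      using two[of a 1] \<Gamma>2[of a] exhaust_3[of a] by (auto simp: algebra_simps)
    have one: "\<Gamma> x 1 a b = \<rho> x b 0 $ 1 $ 1 * (\<theta>0 x $ a - dP 2 x 0 * fr 0 a) + \<rho> x b 0 $ 1 $ 2 * fr 0 a" for a
    proof -
      \<comment> \<open>At \<open>l = 0\<close> the coordinate T of the section is \<open>t\<close>
        itself: its first derivatives single out the t-symbol and its second derivatives
        vanish.\<close>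
      have "\<Gamma> x 1 a b = (\<Sum>c\<in>UNIV. \<Gamma> x c a b *s dsec f x 0 c) $ 1"
        by (simp add: sum_3 dsec_frame)
      also have "\<dots> = \<rho> x b 0 $ 1 $ 1 * (\<theta>0 x $ a - dP 2 x 0 * fr 0 a) + \<rho> x b 0 $ 1 $ 2 * fr 0 a"
        unfolding \<Gamma> using exhaust_3[of b]
        by (auto simp: ddsec_eq dsec_frame matrix_vector_mult_nth_2 partial_\<theta>0)
      finally show ?thesis .
    qed
    have \<Gamma>1: "\<Gamma> x 1 a b = partial b (\<lambda>x. \<theta>0 x $ a) x + \<alpha> * \<theta>0 x $ a
        - dP 2 x 0 * (\<beta> * \<theta>0 x $ a + (if a = 2 then \<delta> else 0))" for a
      unfolding one r12 r11 r22 using exhaust_3[of a] by (auto simp: partial_\<theta>0 algebra_simps)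
    have "\<Gamma> x c a b = Xi_connection (\<lambda>_ _. \<alpha>) (\<lambda>_ _. \<beta>) (\<lambda>_ _. \<gamma>) (\<lambda>_ _. \<delta>) x c a b" for c a
      using exhaust_3[of c] \<Gamma>1 \<Gamma>2 \<Gamma>3 by (auto simp: Xi_connection_nth)
    then show ?thesis by blast
  qed
  then obtain \<alpha> \<beta> \<gamma> \<delta> where "\<And>x b c a. \<Gamma> x c a b =
      Xi_connection (\<lambda>_ _. \<alpha> x b) (\<lambda>_ _. \<beta> x b) (\<lambda>_ _. \<gamma> x b) (\<lambda>_ _. \<delta> x b) x c a b"
    by metis
  then have "\<Gamma> = Xi_connection \<alpha> \<beta> \<gamma> \<delta>"
    by (simp add: fun_eq_iff Xi_connection_def)
  then show ?thesis using that by blast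
qed

lemma torsion_Xi_connectionI:
  assumes hol: "\<And>b. (\<lambda>x. \<alpha> x b) mholomorphic_on UNIV" "\<And>b. (\<lambda>x. \<beta> x b) mholomorphic_on UNIV"
    "\<And>b. (\<lambda>x. \<gamma> x b) mholomorphic_on UNIV" "\<And>b. (\<lambda>x. \<delta> x b) mholomorphic_on UNIV"
  shows "torsion_Xi_connection f (Xi_connection \<alpha> \<beta> \<gamma> \<delta>)"
  unfolding torsion_Xi_connection_def
proof (intro conjI exI allI impI)
  show "holomorphic_connection (Xi_connection \<alpha> \<beta> \<gamma> \<delta>)"
    by (rule holomorphic_connection_Xi) (rule hol)+
  let ?C = "\<lambda>x b l. \<beta> x b + \<gamma> x b * l" and ?Ch = "\<lambda>x b m. \<beta> x b * m + \<gamma> x b"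
  \<comment> \<open>Both matrices solve the relations of \<open>normal_connection_entries\<close>,
    each in its chart, for the entries of \<open>r\<close> and \<open>rh\<close>; \<open>?C\<close>
    and \<open>?Ch\<close> are the two expressions of a section of O(1).\<close>
  define \<rho> where "\<rho> x b l = matrix2 (\<alpha> x b - dP 2 x l * ?C x b l)
    (ddP b x l - dP 2 x l * (\<delta> x b + dP 2 x l * ?C x b l) + dP 2 x l * \<alpha> x b)
    (?C x b l) (\<delta> x b + dP 2 x l * ?C x b l)" for x b l
  define \<rho>h where "\<rho>h x b m = matrix2 (\<alpha> x b + R x m * ?Ch x b m)
    (- dR b x m + R x m * (\<delta> x b - R x m * ?Ch x b m) - R x m * \<alpha> x b)
    (?Ch x b m) (\<delta> x b - R x m * ?Ch x b m)" for x b m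
  show "holomorphic_matrix (\<rho> x b)" "holomorphic_matrix (\<rho>h x b)" for x b
    by (auto simp: holomorphic_matrix_iff \<rho>_def \<rho>h_def intro!: holomorphic_intros)
  show "(\<chi> \<mu> \<nu>. partial b (\<lambda>x. normal_patch f x l $ \<mu> $ \<nu>) x) =
        - (\<rho>h x b (1 / l) ** normal_patch f x l) + normal_patch f x l ** \<rho> x b l" if l: "l \<noteq> 0" for x b l
  proof -
    define C where "C = ?Ch x b (1 / l)"
    have C: "?C x b l = l * C" "?Ch x b (1 / l) = C" using l by (simp_all add: C_def field_simps)
    show ?thesis
      unfolding partial_normal_patch[OF l] unfolding normal_patch_eq[OF l] \<rho>_def \<rho>h_def C
      using l by (simp add: matrix2_simps field_simps)
  qed
  show "(\<Sum>c\<in>UNIV. Xi_connection \<alpha> \<beta> \<gamma> \<delta> x c a b *s dsec f x l c) =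
      ddsec f x l a b + \<rho> x b l *v dsec f x l a" for x l a b
    unfolding ddsec_eq ddsec_symmetric[of a b]
    using exhaust_3[of a]
    by (auto simp: vector2_eq_iff sum_3 dsec_frame matrix_vector_mult_nth_2 Xi_connection_nth \<rho>_def algebra_simps)
qed

end

section \<open>Metrics and the classification\<close>

text \<open>The rows of \<open>G\<close> must be vectors with squares \<open>p\<close>,
  \<open>r\<close> and product \<open>q\<close>. If \<open>p\<close> or \<open>r\<close> is nonzero,
  one row can lie along an axis; otherwise both are isotropic. The square of the determinant of
  \<open>G\<close> is then the given discriminant.\<close>

lemma complex_symmetric_factorization:
  fixes p q r :: complex
  assumes "p * r - q\<^sup>2 \<noteq> 0"
  obtains G :: "complex ^ 2 ^ 2" where "invertible G" "G ** transpose G = matrix2 p q q r"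
proof -
  have "\<exists>a b c d. a\<^sup>2 + b\<^sup>2 = p \<and> a * c + b * d = q \<and> c\<^sup>2 + d\<^sup>2 = r"
  proof -
    consider "p \<noteq> 0" | "p = 0" "r \<noteq> 0" | "p = 0" "r = 0" by blast
    then show ?thesis
    proof cases
      case 1
      define a where "a = csqrt p"
      have a: "a\<^sup>2 = p" "a \<noteq> 0" using 1 by (simp_all add: a_def)
      show ?thesis
        using a by (intro exI[of _ a] exI[of _ 0] exI[of _ "q / a"] exI[of _ "csqrt (r - (q / a)\<^sup>2)"]) simp
    next
      case 2
      define a where "a = csqrt r"
      have a: "a\<^sup>2 = r" "a \<noteq> 0" using 2 by (simp_all add: a_def)
      show ?thesis
        using a by (intro exI[of _ "q / a"] exI[of _ "csqrt (p - (q / a)\<^sup>2)"] exI[of _ a] exI[of _ 0]) simp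
    next
      \<comment> \<open>Isotropic rows: (1, i) and a multiple of (1, -i), where the factor q / 2
        gives the right product.\<close>
      case 3
      have "1\<^sup>2 + \<i>\<^sup>2 = p" "1 * (q / 2) + \<i> * (- (\<i> * q / 2)) = q"
        "(q / 2)\<^sup>2 + (- (\<i> * q / 2))\<^sup>2 = r"
        using 3 by (simp_all add: power_divide power_mult_distrib)
      then show ?thesis by blast
    qed
  qed
  then obtain a b c d where abcd: "a\<^sup>2 + b\<^sup>2 = p" "a * c + b * d = q" "c\<^sup>2 + d\<^sup>2 = r" by blast
  let ?G = "matrix2 a b c d"
  have G: "?G ** transpose ?G = matrix2 p q q r"
    using abcd by (simp add: matrix2_simps transpose_def power2_eq_square mult.commute)
  have "det ?G * det ?G = det (?G ** transpose ?G)"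
    by (simp add: det_mul det_transpose)
  also have "\<dots> = p * r - q\<^sup>2"
    unfolding G by (simp add: det_2 power2_eq_square)
  finally have "invertible ?G"
    using assms by (auto simp: invertible_det_nz)
  with G show ?thesis using that by blast
qed

text \<open>\<open>g\<close> will be \<open>dP 2 x 0\<close>, so that the vector is
  \<open>\<theta>0 x\<close>. Symmetry and the kernel leave only the block with indices 2, 3
  free.\<close>

locale degenerate_bivector =
  fixes h :: "complex ^ 3 ^ 3" and g :: complex
  assumes sym: "transpose h = h" and ker: "h *v vector [1, g, 0] = 0"
begin

lemma nth_commute: "h $ a $ b = h $ b $ a"
proof -
  have "transpose h $ a $ b = h $ b $ a" by (simp add: transpose_def)
  then show ?thesis unfolding sym .
qed

lemma nth_1: "h $ a $ 1 = - (g * h $ a $ 2)"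
proof -
  have "(h *v vector [1, g, 0]) $ a = 0" using ker by simp
  then show ?thesis by (simp add: matrix_vector_mult_def sum_3 add_eq_0_iff2 mult.commute)
qed

text \<open>The first row is a multiple of the second. In the other two the first entry is
  \<open>- g\<close> times the second entry, so they are dependent exactly when the block is
  singular.\<close>

lemma rank_2_iff: "rank h = 2 \<longleftrightarrow> h $ 2 $ 2 * h $ 3 $ 3 - (h $ 2 $ 3)\<^sup>2 \<noteq> 0"
proof -
  have r1: "h $ 1 = (- g) *s h $ 2"
    using nth_1[of 1] nth_1[of 2] nth_1[of 3] nth_commute[of 1 2] nth_commute[of 1 3] nth_commute[of 3 2]
    by (simp add: vector3_eq_iff)
  have "rows h = {h $ 1, h $ 2, h $ 3}"
    by (auto simp: rows_def row_def UNIV_3 full_SetCompr_eq vec_nth_inverse)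
  then have "rank h = vec.dim (insert (h $ 1) {h $ 2, h $ 3})"
    by (simp add: row_rank_def_gen)
  also have "\<dots> = vec.dim {h $ 2, h $ 3}"
    unfolding vec.dim_insert r1 by (simp add: vec.span_base vec.span_scale vec.span_neg)
  also have "\<dots> = 2 \<longleftrightarrow> h $ 3 \<noteq> 0 \<and> h $ 2 \<notin> vec.span {h $ 3}"
    by (auto simp: vec.dim_insert)
  also have "\<dots> \<longleftrightarrow> h $ 2 $ 2 * h $ 3 $ 3 - (h $ 2 $ 3)\<^sup>2 \<noteq> 0"
  proof (intro iffI conjI notI)
    assume d: "h $ 2 $ 2 * h $ 3 $ 3 - (h $ 2 $ 3)\<^sup>2 \<noteq> 0"
    { assume "h $ 3 = 0"
      then show False using d nth_commute[of 2 3] by simp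
    }
    assume "h $ 2 \<in> vec.span {h $ 3}"
    then obtain k where "h $ 2 = k *s h $ 3" by (auto simp: vec.span_singleton)
    then have "h $ 2 $ 2 = k * h $ 3 $ 2" "h $ 2 $ 3 = k * h $ 3 $ 3"
      by (metis vector_smult_component)+
    then show False using d nth_commute[of 3 2] by (simp add: power2_eq_square)
  next
    assume n: "h $ 3 \<noteq> 0 \<and> h $ 2 \<notin> vec.span {h $ 3}"
      and d: "h $ 2 $ 2 * h $ 3 $ 3 - (h $ 2 $ 3)\<^sup>2 = 0"
    have "h $ 3 $ 3 \<noteq> 0"
    proof
      assume z: "h $ 3 $ 3 = 0"
      then have "h $ 3 $ 2 = 0" using d nth_commute[of 3 2] by simp
      then have "h $ 3 = 0" using z nth_1[of 3] by (simp add: vector3_eq_iff)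
      then show False using n by simp
    qed
    then have "h $ 2 $ 2 = h $ 2 $ 3 / h $ 3 $ 3 * h $ 3 $ 2" "h $ 2 $ 3 = h $ 2 $ 3 / h $ 3 $ 3 * h $ 3 $ 3"
      using d nth_commute[of 3 2] by (simp_all add: field_simps power2_eq_square)
    then have "h $ 2 = (h $ 2 $ 3 / h $ 3 $ 3) *s h $ 3"
      unfolding vector3_eq_iff vector_smult_component using nth_1[of 2] nth_1[of 3] by (metis mult.left_commute mult_minus_right)
    then show False using n by (metis vec.span_base vec.span_scale singletonI)
  qed
  finally show ?thesis .
qed

text \<open>On the quotient by the kernel vector, with coordinates
  \<open>\<alpha> $ 2 - g * \<alpha> $ 1\<close> and \<open>\<alpha> $ 3\<close>, \<open>h\<close>
  acts by its block, which the rank makes invertible.\<close>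

lemma kernel_eq:
  assumes "rank h = 2"
  shows "{\<alpha>. h *v \<alpha> = 0} = range (\<lambda>k. k *s vector [1, g, 0])"
proof (intro equalityI subsetI)
  fix \<alpha> :: "complex ^ 3" assume "\<alpha> \<in> {\<alpha>. h *v \<alpha> = 0}"
  then have "(h *v \<alpha>) $ 2 = 0" "(h *v \<alpha>) $ 3 = 0" by auto
  then have e: "h $ 2 $ 2 * (\<alpha> $ 2 - g * \<alpha> $ 1) + h $ 2 $ 3 * \<alpha> $ 3 = 0"
    "h $ 2 $ 3 * (\<alpha> $ 2 - g * \<alpha> $ 1) + h $ 3 $ 3 * \<alpha> $ 3 = 0"
    using nth_1[of 2] nth_1[of 3] nth_commute[of 3 2]
    by (simp_all add: matrix_vector_mult_def sum_3 algebra_simps)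
  let ?d = "h $ 2 $ 2 * h $ 3 $ 3 - (h $ 2 $ 3)\<^sup>2"
  have "?d * (\<alpha> $ 2 - g * \<alpha> $ 1) = 0" "?d * \<alpha> $ 3 = 0"
    using e by algebra+
  then have "\<alpha> $ 2 - g * \<alpha> $ 1 = 0" "\<alpha> $ 3 = 0" using assms rank_2_iff by auto
  then have "\<alpha> = \<alpha> $ 1 *s vector [1, g, 0]" by (simp add: vector3_eq_iff)
  then show "\<alpha> \<in> range (\<lambda>k. k *s vector [1, g, 0])" by blast
next
  fix \<alpha> :: "complex ^ 3" assume "\<alpha> \<in> range (\<lambda>k. k *s vector [1, g, 0])"
  then show "\<alpha> \<in> {\<alpha>. h *v \<alpha> = 0}"
    using ker by (auto simp: vector_scalar_commute)
qed

end

context twistor_family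
begin

lemma param_clock_eq: "param_clock f \<phi> = (\<lambda>x. exp (\<phi> x) *s \<theta>0 x)"
  by (simp add: fun_eq_iff param_clock_def \<theta>0_def dgam0_eq)

lemma partial_scaled_clock:
  assumes "\<phi> mholomorphic_on UNIV"
  shows "partial b (\<lambda>x. exp (\<phi> x) * \<theta>0 x $ a) x =
    exp (\<phi> x) * (partial b \<phi> x * \<theta>0 x $ a + partial b (\<lambda>x. \<theta>0 x $ a) x)"
  by (simp add: partial_mult partial_exp mholomorphic_on_exp \<theta>0_mhol assms algebra_simps)

text \<open>\<open>A\<close> and \<open>B\<close> are taken relative to the clock, so passing to
  \<open>\<theta>0\<close> multiplies them by its factor; the derivative of that factor produces
  \<open>\<alpha>\<close>.\<close>

lemma param_connection_eq:
  assumes "\<phi> mholomorphic_on UNIV"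
  shows "param_connection f A B \<phi> \<psi> = Xi_connection (\<lambda>x b. partial b \<phi> x)
    (\<lambda>x b. A x $ b * exp (\<phi> x)) (\<lambda>x b. B x $ b * exp (\<phi> x)) (\<lambda>x b. partial b \<psi> x)"
proof (intro ext)
  fix x c a b
  have "exp (- \<phi> x) * partial b (\<lambda>x. exp (\<phi> x) * \<theta>0 x $ a) x =
      partial b (\<lambda>x. \<theta>0 x $ a) x + partial b \<phi> x * \<theta>0 x $ a"
    unfolding partial_scaled_clock[OF assms] mult.assoc[symmetric] exp_add[symmetric]
    by (simp add: add.commute)
  then show "param_connection f A B \<phi> \<psi> x c a b = Xi_connection (\<lambda>x b. partial b \<phi> x)
    (\<lambda>x b. A x $ b * exp (\<phi> x)) (\<lambda>x b. B x $ b * exp (\<phi> x)) (\<lambda>x b. partial b \<psi> x) x c a b"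
    by (simp add: param_connection_def Xi_connection_def Let_def param_clock_eq dgam0_eq mult.assoc)
qed

lemma parallel_clock_iff:
  assumes "\<phi> mholomorphic_on UNIV"
  shows "parallel_one_form (Xi_connection \<alpha> \<beta> \<gamma> \<delta>) (\<lambda>x. exp (\<phi> x) *s \<theta>0 x) \<longleftrightarrow>
    (\<forall>x b. \<alpha> x b = partial b \<phi> x)"
proof -
  have "(\<Sum>c\<in>UNIV. Xi_connection \<alpha> \<beta> \<gamma> \<delta> x c a b * (exp (\<phi> x) * \<theta>0 x $ c)) =
      exp (\<phi> x) * (partial b (\<lambda>x. \<theta>0 x $ a) x + \<alpha> x b * \<theta>0 x $ a)" for x a b
    by (simp add: sum_3 Xi_connection_nth algebra_simps)
  then have "parallel_one_form (Xi_connection \<alpha> \<beta> \<gamma> \<delta>) (\<lambda>x. exp (\<phi> x) *s \<theta>0 x) \<longleftrightarrow>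
    (\<forall>x a b. exp (\<phi> x) * ((partial b \<phi> x - \<alpha> x b) * \<theta>0 x $ a) = 0)"
    by (simp add: parallel_one_form_def partial_scaled_clock[OF assms] algebra_simps del: mult_eq_0_iff)
  also have "\<dots> \<longleftrightarrow> (\<forall>x b. \<alpha> x b = partial b \<phi> x)"
    by (auto simp: forall_3)
  finally show ?thesis .
qed

text \<open>\<open>\<alpha>\<close>, \<open>\<beta>\<close> and \<open>\<gamma>\<close> multiply
  \<open>\<theta>0\<close>, which \<open>h\<close> annihilates. The equations with an index 1 follow
  from those of the block: the derivative of \<open>dP 2 x 0\<close> in \<open>h x $ 1 $ j\<close>
  cancels against that of \<open>\<theta>0\<close> in the t-symbol.\<close>

lemma parallel_bivector_iff:
  assumes hol: "holomorphic_bivector h"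
    and sym: "\<And>x. transpose (h x) = h x" and ker: "\<And>x. h x *v \<theta>0 x = 0"
  shows "parallel_bivector (Xi_connection \<alpha> \<beta> \<gamma> \<delta>) h \<longleftrightarrow>
    (\<forall>x c. \<forall>i\<in>{2, 3}. \<forall>j\<in>{2, 3}. partial c (\<lambda>x. h x $ i $ j) x = - 2 * \<delta> x c * h x $ i $ j)"
proof -
  interpret h: degenerate_bivector "h x" "dP 2 x 0" for x
    using sym ker by unfold_locales (simp_all add: \<theta>0_def)
  have hm: "(\<lambda>x. h x $ a $ b) mholomorphic_on UNIV" for a b
    using hol by (simp add: holomorphic_bivector_def)
  have k1: "h x $ 1 $ j = - (dP 2 x 0 * h x $ 2 $ j)" for x j
    using h.nth_1[of x j] h.nth_commute by metis
  let ?V = "\<lambda>x c a b. \<Sum>d\<in>UNIV. Xi_connection \<alpha> \<beta> \<gamma> \<delta> x a d c * h x $ d $ b"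
  have V2: "?V x c 2 b = \<delta> x c * h x $ 2 $ b" and V3: "?V x c 3 b = \<delta> x c * h x $ 3 $ b"
    and V1: "?V x c 1 b = ddP c x 0 * h x $ 2 $ b - dP 2 x 0 * \<delta> x c * h x $ 2 $ b" for x c b
    by (simp_all add: sum_3 Xi_connection_nth k1 partial_\<theta>0 algebra_simps)
  have V': "(\<Sum>d\<in>UNIV. Xi_connection \<alpha> \<beta> \<gamma> \<delta> x b d c * h x $ a $ d) = ?V x c b a" for x a b c
    using h.nth_commute by (intro sum.cong refl) metis
  have par: "parallel_bivector (Xi_connection \<alpha> \<beta> \<gamma> \<delta>) h \<longleftrightarrow>
      (\<forall>x a b c. partial c (\<lambda>x. h x $ a $ b) x + ?V x c a b + ?V x c b a = 0)"
    unfolding parallel_bivector_def V' ..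
  have d1: "partial c (\<lambda>x. h x $ 1 $ j) x =
      - (ddP c x 0 * h x $ 2 $ j + dP 2 x 0 * partial c (\<lambda>x. h x $ 2 $ j) x)" for c j x
    unfolding k1 by (simp add: partial_minus partial_mult mholomorphic_on_mult hm dP_mhol ddP_def)
  show ?thesis
    unfolding par
  proof (intro iffI allI ballI)
    fix x c and i j :: 3
    assume "\<forall>x a b c. partial c (\<lambda>x. h x $ a $ b) x + ?V x c a b + ?V x c b a = 0"
      and ij: "i \<in> {2, 3}" "j \<in> {2, 3}"
    then have "partial c (\<lambda>x. h x $ i $ j) x + ?V x c i j + ?V x c j i = 0" by blast
    moreover have "?V x c i j = \<delta> x c * h x $ i $ j" "?V x c j i = \<delta> x c * h x $ i $ j"
      using ij V2 V3 h.nth_commute[of x j i] by auto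
    ultimately show "partial c (\<lambda>x. h x $ i $ j) x = - 2 * \<delta> x c * h x $ i $ j"
      by (simp add: algebra_simps eq_neg_iff_add_eq_0)
  next
    fix x a b c
    assume "\<forall>x c. \<forall>i\<in>{2, 3}. \<forall>j\<in>{2, 3}. partial c (\<lambda>x. h x $ i $ j) x = - 2 * \<delta> x c * h x $ i $ j"
    then have p: "partial c (\<lambda>x. h x $ 2 $ 2) x = - 2 * \<delta> x c * h x $ 2 $ 2"
      "partial c (\<lambda>x. h x $ 2 $ 3) x = - 2 * \<delta> x c * h x $ 2 $ 3"
      "partial c (\<lambda>x. h x $ 3 $ 3) x = - 2 * \<delta> x c * h x $ 3 $ 3" by blast+
    have fs: "(\<lambda>x. h x $ 2 $ 1) = (\<lambda>x. h x $ 1 $ 2)" "(\<lambda>x. h x $ 3 $ 1) = (\<lambda>x. h x $ 1 $ 3)"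
      "(\<lambda>x. h x $ 3 $ 2) = (\<lambda>x. h x $ 2 $ 3)"
      using h.nth_commute by (auto simp: fun_eq_iff)
    note s = fs[THEN fun_cong, of x]
    show "partial c (\<lambda>x. h x $ a $ b) x + ?V x c a b + ?V x c b a = 0"
      using exhaust_3[of a] exhaust_3[of b]
      by (elim disjE; simp only: V1 V2 V3 fs s d1 p)
        (simp_all add: s k1 algebra_simps)
  qed
qed

section \<open>The moduli space of sections and its tangent spaces\<close>

lemma PQ_cong:
  assumes "x $ 2 = x' $ 2" "x $ 3 = x' $ 3"
  shows "P x l = P x' l" "Q x m = Q x' m"
proof -
  \<comment> \<open>The Laurent coefficients depend on \<open>y\<close> and \<open>z\<close> only,
    and they determine \<open>P\<close>.\<close>
  show 1: "P x l = P x' l" for l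
    using gam_sums(1)[of x l] gam_sums(1)[of x' l] gam_sums(3)[of x] gam_sums(3)[of x'] assms by simp
  show "Q x m = Q x' m"
    using gam_sums(2)[of x m] gam_sums(2)[of x' m] 1[of 0] assms by simp
qed

lemma bij_betw_global_sections: "bij_betw (\<lambda>x. (sec f x, sec_hat f x)) UNIV (global_sections f)"
proof (rule bij_betw_imageI)
  show "inj (\<lambda>x. (sec f x, sec_hat f x))"
  proof (rule injI)
    fix x x' assume "(sec f x, sec_hat f x) = (sec f x', sec_hat f x')"
    then have "sec f x 0 = sec f x' 0" "sec f x 1 = sec f x' 1" by simp_all
    then show "x = x'" by (simp add: sec_eq vector2_eq_iff vector3_eq_iff)
  qed
  show "range (\<lambda>x. (sec f x, sec_hat f x)) = global_sections f"
  proof (intro equalityI subsetI)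
    fix X assume "X \<in> range (\<lambda>x. (sec f x, sec_hat f x))"
    then obtain x where X: "X = (sec f x, sec_hat f x)" by blast
    have "(\<lambda>l. sec f x l $ \<mu>) holomorphic_on UNIV" "(\<lambda>l. sec_hat f x l $ \<mu>) holomorphic_on UNIV" for \<mu>
      using exhaust_2[of \<mu>] holomorphic_family_onD(3)[OF P] holomorphic_family_onD(3)[OF Q]
      by (auto simp: sec_eq sec_hat_eq intro!: holomorphic_intros)
    moreover have "sec_hat f x (1 / l) = twistor_patch f l (sec f x l)" if "l \<noteq> 0" for l
      using that by (simp add: sec_eq sec_hat_eq twistor_patch_def split[OF that] vector2_eq_iff add_divide_distrib)
    ultimately show "X \<in> global_sections f"
      by (simp add: global_sections_def X)
  next
    fix X assume "X \<in> global_sections f"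
    then obtain W Wh where X: "X = (W, Wh)" and hol: "\<And>\<mu>. (\<lambda>l. W l $ \<mu>) holomorphic_on UNIV"
        "\<And>\<mu>. (\<lambda>m. Wh m $ \<mu>) holomorphic_on UNIV"
      and eq: "\<And>l. l \<noteq> 0 \<Longrightarrow> Wh (1 / l) = twistor_patch f l (W l)"
      by (auto simp: global_sections_def)
    have "W l $ 2 = l * Wh (1 / l) $ 2" if "l \<noteq> 0" for l
      using eq[OF that] that by (simp add: twistor_patch_def)
    then obtain y z where yz: "\<And>l. W l $ 2 = y + z * l" "\<And>m. Wh m $ 2 = z + y * m"
      by (rule Liouville_O1[OF hol(1)[of 2] hol(2)[of 2]]) (assumption | rule that)+
    \<comment> \<open>A provisional point with \<open>t = 0\<close>: \<open>P\<close> and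
      \<open>Q\<close> depend on \<open>y\<close> and \<open>z\<close> only, and \<open>t\<close> is
      known once the constant \<open>c\<close> is found.\<close>
    let ?x = "vector [0, y, z] :: complex ^ 3"
    have eq1: "W l $ 1 + P ?x l = Wh (1 / l) $ 1 - Q ?x (1 / l)" if "l \<noteq> 0" for l
      using eq[OF that] split[OF that, of ?x] by (simp add: twistor_patch_def yz)
    have hol1: "(\<lambda>l. W l $ 1 + P ?x l) holomorphic_on UNIV" "(\<lambda>m. Wh m $ 1 - Q ?x m) holomorphic_on UNIV"
      using hol holomorphic_family_onD(3)[OF P] holomorphic_family_onD(3)[OF Q]
      by (auto intro!: holomorphic_intros)
    obtain c where c: "\<And>l. W l $ 1 + P ?x l = c" "\<And>m. Wh m $ 1 - Q ?x m = c"
      by (rule Liouville_O0[OF hol1 eq1]) (assumption | rule that)+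
    \<comment> \<open>The first component of \<open>sec\<close> plus \<open>P x l\<close> is
      \<open>t + P x 0\<close>, which has to be \<open>c\<close>.\<close>
    define x where "x = (vector [c - P ?x 0, y, z] :: complex ^ 3)"
    have PQ: "P x l = P ?x l" "Q x m = Q ?x m" for l m
      by (rule PQ_cong; simp add: x_def)+
    have "W l = sec f x l" for l
      using c(1)[of l] by (simp add: sec_eq PQ vector2_eq_iff yz) (simp add: x_def eq_diff_eq)
    moreover have "Wh m = sec_hat f x m" for m
      using c(2)[of m] by (simp add: sec_hat_eq PQ vector2_eq_iff yz diff_eq_eq) (simp add: x_def)
    ultimately show "X \<in> range (\<lambda>x. (sec f x, sec_hat f x))"
      by (auto simp: X fun_eq_iff)
  qed
qed

lemma normal_section_eq:
  "(\<Sum>a\<in>UNIV. u $ a *s dsec f x l a) =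
    vector [u $ 1 + u $ 2 * dP 2 x 0 - dP 2 x l * (u $ 2 + u $ 3 * l), u $ 2 + u $ 3 * l]"
  by (simp add: vector2_eq_iff sum_3 dsec_frame algebra_simps)

text \<open>This is the Kodaira map on tangent vectors \<open>u\<close>. In the standard splitting a
  normal section is a constant together with an affine function of \<open>l\<close>, three
  parameters that match the components of \<open>u\<close>.\<close>

lemma bij_betw_normal_sections:
  "bij_betw (\<lambda>u l. \<Sum>a\<in>UNIV. u $ a *s dsec f x l a) UNIV (normal_sections f x)"
  unfolding normal_section_eq
proof (rule bij_betw_imageI)
  let ?s = "\<lambda>u l. vector [u $ 1 + u $ 2 * dP 2 x 0 - dP 2 x l * (u $ 2 + u $ 3 * l), u $ 2 + u $ 3 * l] :: complex ^ 2"
  show "inj (\<lambda>u :: complex ^ 3. ?s u)"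
  proof (rule injI)
    fix u v :: "complex ^ 3" assume "?s u = ?s v"
    then have "?s u 0 = ?s v 0" "?s u 1 = ?s v 1" by metis+
    then show "u = v" by (simp add: vector2_eq_iff vector3_eq_iff)
  qed
  show "range (\<lambda>u :: complex ^ 3. ?s u) = normal_sections f x"
  proof (intro equalityI subsetI)
    fix s assume "s \<in> range (\<lambda>u :: complex ^ 3. ?s u)"
    then obtain u :: "complex ^ 3" where s: "s = ?s u" by blast
    let ?sh = "\<lambda>m. vector [u $ 1 + u $ 2 * dP 2 x 0 + R x m * (u $ 2 * m + u $ 3), u $ 2 * m + u $ 3] :: complex ^ 2"
    have "(\<lambda>l. s l $ \<mu>) holomorphic_on UNIV" "(\<lambda>m. ?sh m $ \<mu>) holomorphic_on UNIV" for \<mu>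
      using exhaust_2[of \<mu>] by (auto simp: s intro!: holomorphic_intros)
    moreover have "?sh (1 / l) = normal_patch f x l *v s l" if "l \<noteq> 0" for l
      using that by (simp add: s normal_patch_eq matrix2_simps field_simps)
    ultimately show "s \<in> normal_sections f x"
      unfolding normal_sections_def by (intro CollectI conjI exI[of _ ?sh]) auto
  next
    fix s assume "s \<in> normal_sections f x"
    then obtain sh where hol: "\<And>\<mu>. (\<lambda>l. s l $ \<mu>) holomorphic_on UNIV" "\<And>\<mu>. (\<lambda>m. sh m $ \<mu>) holomorphic_on UNIV"
      and eq: "\<And>l. l \<noteq> 0 \<Longrightarrow> sh (1 / l) = normal_patch f x l *v s l"
      by (auto simp: normal_sections_def)
    have e: "sh (1 / l) $ 1 = s l $ 1 + (dP 2 x l + R x (1 / l) / l) * s l $ 2" "sh (1 / l) $ 2 = s l $ 2 / l"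
      if "l \<noteq> 0" for l
      using eq[OF that] by (simp_all add: normal_patch_eq[OF that] matrix2_simps)
    have "s l $ 2 = l * sh (1 / l) $ 2" if "l \<noteq> 0" for l
      using e(2)[OF that] that by simp
    then obtain a b where ab: "\<And>l. s l $ 2 = a + b * l" "\<And>m. sh m $ 2 = b + a * m"
      by (rule Liouville_O1[OF hol(1)[of 2] hol(2)[of 2]]) (assumption | rule that)+
    \<comment> \<open>The O-component of \<open>s\<close> under the standard splitting, expressed in
      both charts.\<close>
    have eq1: "s l $ 1 + dP 2 x l * s l $ 2 = sh (1 / l) $ 1 - R x (1 / l) * sh (1 / l) $ 2" if "l \<noteq> 0" for l
      unfolding e[OF that] by (simp add: algebra_simps)
    have hol1: "(\<lambda>l. s l $ 1 + dP 2 x l * s l $ 2) holomorphic_on UNIV"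
      "(\<lambda>m. sh m $ 1 - R x m * sh m $ 2) holomorphic_on UNIV"
      using hol by (auto intro!: holomorphic_intros)
    obtain c where c: "\<And>l. s l $ 1 + dP 2 x l * s l $ 2 = c"
      by (rule Liouville_O0[OF hol1 eq1]) (assumption | rule that)+
    \<comment> \<open>\<open>c\<close> is the value of \<open>\<theta>0\<close> on the tangent
      vector, which fixes its t-component.\<close>
    have "s l = ?s (vector [c - a * dP 2 x 0, a, b] :: complex ^ 3) l" for l
      using c[of l] by (simp add: vector2_eq_iff ab eq_diff_eq)
    then have "s = ?s (vector [c - a * dP 2 x 0, a, b] :: complex ^ 3)" by (rule ext)
    with rangeI[of "\<lambda>u :: complex ^ 3. ?s u" "vector [c - a * dP 2 x 0, a, b]"]
    show "s \<in> range (\<lambda>u :: complex ^ 3. ?s u)" by (simp only:)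
  qed
qed

lemma holomorphic_family_sec: "holomorphic_family (\<lambda>x l. sec f x l $ \<mu>)"
proof (rule holomorphic_family_on_imp_holomorphic_family)
  show "holomorphic_family_on (\<lambda>x l. sec f x l $ \<mu>) UNIV"
    using exhaust_2[of \<mu>]
    by (auto simp: sec_eq intro!: holomorphic_family_on_add holomorphic_family_on_diff holomorphic_family_on_mult
      P holomorphic_family_on_base P_mhol mholomorphic_on_add holomorphic_family_on_fibre holomorphic_intros)
qed

lemma holomorphic_family_sec_hat: "holomorphic_family (\<lambda>x m. sec_hat f x m $ \<mu>)"
proof (rule holomorphic_family_on_imp_holomorphic_family)
  show "holomorphic_family_on (\<lambda>x m. sec_hat f x m $ \<mu>) UNIV"
    using exhaust_2[of \<mu>]
    by (auto simp: sec_hat_eq intro!: holomorphic_family_on_add holomorphic_family_on_diff holomorphic_family_on_mult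
      Q holomorphic_family_on_base P_mhol mholomorphic_on_add holomorphic_family_on_fibre holomorphic_intros)
qed

section \<open>Parametrised structures and the classification\<close>

lemma param_metric_nth:
  fixes G :: "complex ^ 2 ^ 2"
  defines "M \<equiv> G ** transpose G"
  shows "param_metric f \<psi> G x $ 2 $ 2 = exp (- 2 * \<psi> x) * M $ 1 $ 1"
    "param_metric f \<psi> G x $ 2 $ 3 = exp (- 2 * \<psi> x) * M $ 1 $ 2"
    "param_metric f \<psi> G x $ 3 $ 3 = exp (- 2 * \<psi> x) * M $ 2 $ 2"
    "transpose (param_metric f \<psi> G x) = param_metric f \<psi> G x"
    "param_metric f \<psi> G x *v \<theta>0 x = 0"
proof -
  have M: "M $ 2 $ 1 = M $ 1 $ 2"
    by (simp add: M_def matrix_mult_nth_2 transpose_def mult.commute)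
  show "param_metric f \<psi> G x $ 2 $ 2 = exp (- 2 * \<psi> x) * M $ 1 $ 1"
    "param_metric f \<psi> G x $ 2 $ 3 = exp (- 2 * \<psi> x) * M $ 1 $ 2"
    "param_metric f \<psi> G x $ 3 $ 3 = exp (- 2 * \<psi> x) * M $ 2 $ 2"
    "transpose (param_metric f \<psi> G x) = param_metric f \<psi> G x"
    "param_metric f \<psi> G x *v \<theta>0 x = 0"
    unfolding param_metric_def M_def[symmetric] Let_def dgam0_eq
    by (simp_all add: matrix_matrix_mult_def[where 'n = 2] matrix_vector_mult_def sum_2 sum_3 transpose_def
      vector3_eq_iff M algebra_simps)
qed

lemma holomorphic_param_metric:
  assumes \<psi>: "\<psi> mholomorphic_on UNIV"
  shows "holomorphic_bivector (param_metric f \<psi> G)"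
proof -
  interpret h: degenerate_bivector "param_metric f \<psi> G x" "dP 2 x 0" for x
    using param_metric_nth(4,5) by unfold_locales (simp_all add: \<theta>0_def)
  have e: "(\<lambda>x. exp (- 2 * \<psi> x) * k) mholomorphic_on UNIV" for k
    by (intro mholomorphic_on_mult mholomorphic_on_exp mholomorphic_on_const \<psi>)
  have n: "(\<lambda>x. param_metric f \<psi> G x $ a $ 2) mholomorphic_on UNIV \<Longrightarrow>
      (\<lambda>x. param_metric f \<psi> G x $ a $ 1) mholomorphic_on UNIV" for a
    unfolding h.nth_1 by (intro mholomorphic_on_minus mholomorphic_on_mult dP_mhol)
  have 22: "(\<lambda>x. param_metric f \<psi> G x $ 2 $ 2) mholomorphic_on UNIV"
    and 23: "(\<lambda>x. param_metric f \<psi> G x $ 2 $ 3) mholomorphic_on UNIV"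
    and 33: "(\<lambda>x. param_metric f \<psi> G x $ 3 $ 3) mholomorphic_on UNIV"
    unfolding param_metric_nth by (rule e)+
  have c: "(\<lambda>x. param_metric f \<psi> G x $ a $ b) = (\<lambda>x. param_metric f \<psi> G x $ b $ a)" for a b
    using h.nth_commute by (simp add: fun_eq_iff)
  have 32: "(\<lambda>x. param_metric f \<psi> G x $ 3 $ 2) mholomorphic_on UNIV"
    using 23 by (subst c)
  have 12: "(\<lambda>x. param_metric f \<psi> G x $ 1 $ 2) mholomorphic_on UNIV"
    using n[OF 22] by (subst c)
  have 13: "(\<lambda>x. param_metric f \<psi> G x $ 1 $ 3) mholomorphic_on UNIV"
    using n[OF 32] by (subst c)
  have "(\<lambda>x. param_metric f \<psi> G x $ a $ b) mholomorphic_on UNIV" for a b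
    using exhaust_3[of a] exhaust_3[of b] 22 23 33 32 12 13 n[OF 22] n[OF 32] n[OF 12] by auto
  then show ?thesis by (simp add: holomorphic_bivector_def)
qed

lemma param_in_induced_structures:
  assumes A: "holomorphic_one_form A" and B: "holomorphic_one_form B"
    and \<phi>: "\<phi> mholomorphic_on UNIV" and \<psi>: "\<psi> mholomorphic_on UNIV" and G: "invertible G"
  shows "(param_metric f \<psi> G, param_clock f \<phi>, param_connection f A B \<phi> \<psi>) \<in> induced_structures f"
proof -
  let ?h = "param_metric f \<psi> G" and ?M = "G ** transpose G"
  interpret h: degenerate_bivector "?h x" "dP 2 x 0" for x
    using param_metric_nth(4,5) by unfold_locales (simp_all add: \<theta>0_def)
  have M: "?M $ 2 $ 1 = ?M $ 1 $ 2"
    by (simp add: matrix_mult_nth_2 transpose_def mult.commute)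
  have "?M $ 1 $ 1 * ?M $ 2 $ 2 - (?M $ 1 $ 2)\<^sup>2 = det ?M"
    by (simp add: det_2 M power2_eq_square)
  also have "\<dots> \<noteq> 0" using G by (simp add: det_mul det_transpose invertible_det_nz)
  finally have dM: "?M $ 1 $ 1 * ?M $ 2 $ 2 - (?M $ 1 $ 2)\<^sup>2 \<noteq> 0" .
  have "rank (?h x) = 2" for x
  proof -
    have "?h x $ 2 $ 2 * ?h x $ 3 $ 3 - (?h x $ 2 $ 3)\<^sup>2 =
        (exp (- 2 * \<psi> x))\<^sup>2 * (?M $ 1 $ 1 * ?M $ 2 $ 2 - (?M $ 1 $ 2)\<^sup>2)"
      unfolding param_metric_nth by (simp add: power2_eq_square algebra_simps)
    then show ?thesis using dM h.rank_2_iff[of x] by simp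
  qed
  then have "metric ?h"
    using holomorphic_param_metric[OF \<psi>] param_metric_nth(4) by (simp add: metric_def)
  moreover have "?h x *v param_clock f \<phi> x = 0" for x
    by (simp add: param_clock_eq vector_scalar_commute param_metric_nth(5))
  moreover have "parallel_bivector (param_connection f A B \<phi> \<psi>) ?h"
    unfolding param_connection_eq[OF \<phi>]
      parallel_bivector_iff[OF holomorphic_param_metric[OF \<psi>] param_metric_nth(4,5)]
  proof (intro allI ballI)
    fix x c and i j :: 3 assume ij: "i \<in> {2, 3}" "j \<in> {2, 3}"
    have d: "partial c (\<lambda>x. exp (- 2 * \<psi> x) * k) x = - 2 * partial c \<psi> x * (exp (- 2 * \<psi> x) * k)" for k
      by (simp add: partial_mult partial_exp partial_minus mholomorphic_on_mult mholomorphic_on_minus mholomorphic_on_exp \<psi>)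
    have c32: "?h x $ 3 $ 2 = ?h x $ 2 $ 3" for x by (rule h.nth_commute)
    show "partial c (\<lambda>x. ?h x $ i $ j) x = - 2 * partial c \<psi> x * ?h x $ i $ j"
      using ij by (elim insertE emptyE; simp only: c32 param_metric_nth d)
  qed
  moreover have "frame_clock f (param_clock f \<phi>)"
    using \<phi> by (auto simp: frame_clock_iff param_clock_eq)
  moreover have "torsion_Xi_connection f (param_connection f A B \<phi> \<psi>)"
    unfolding param_connection_eq[OF \<phi>]
    using mholomorphic_on_partial[OF \<phi>] mholomorphic_on_partial[OF \<psi>] A B
    by (intro torsion_Xi_connectionI mholomorphic_on_mult mholomorphic_on_exp \<phi>)
      (auto simp: holomorphic_one_form_def)
  moreover have "parallel_one_form (param_connection f A B \<phi> \<psi>) (param_clock f \<phi>)"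
    by (simp add: param_connection_eq[OF \<phi>] param_clock_eq parallel_clock_iff[OF \<phi>])
  ultimately show ?thesis
    by (simp add: induced_structures_def)
qed

lemma induced_structuresE:
  assumes "(h, \<theta>, \<Gamma>) \<in> induced_structures f"
  obtains A B \<phi> \<psi> G where "h = param_metric f \<psi> G" "\<theta> = param_clock f \<phi>" "\<Gamma> = param_connection f A B \<phi> \<psi>"
    "holomorphic_one_form A" "holomorphic_one_form B" "\<phi> mholomorphic_on UNIV" "\<psi> mholomorphic_on UNIV" "invertible G"
proof -
  have clock: "frame_clock f \<theta>" and conn: "torsion_Xi_connection f \<Gamma>" and par\<theta>: "parallel_one_form \<Gamma> \<theta>"
    and met: "metric h" and ker: "\<And>x. h x *v \<theta> x = 0" and parh: "parallel_bivector \<Gamma> h"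
    using assms by (auto simp: induced_structures_def)
  obtain \<phi> where \<phi>: "\<phi> mholomorphic_on UNIV" and \<theta>: "\<theta> = (\<lambda>x. exp (\<phi> x) *s \<theta>0 x)"
    using clock frame_clock_iff by blast
  obtain \<alpha> \<beta> \<gamma> \<delta> where \<Gamma>: "\<Gamma> = Xi_connection \<alpha> \<beta> \<gamma> \<delta>"
    by (rule torsion_Xi_connectionD[OF conn])
  have "holomorphic_connection (Xi_connection \<alpha> \<beta> \<gamma> \<delta>)"
    using conn by (simp add: torsion_Xi_connection_def \<Gamma>)
  note hol = holomorphic_connection_XiD[OF this]
  have \<alpha>: "\<alpha> = (\<lambda>x b. partial b \<phi> x)"
    using par\<theta> unfolding \<Gamma> \<theta> parallel_clock_iff[OF \<phi>] by (simp add: fun_eq_iff)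
  have hhol: "holomorphic_bivector h" and sym: "\<And>x. transpose (h x) = h x" and rk: "\<And>x. rank (h x) = 2"
    using met by (auto simp: metric_def)
  have ker0: "h x *v \<theta>0 x = 0" for x
    using ker[of x] by (simp add: \<theta> vector_scalar_commute)
  interpret h: degenerate_bivector "h x" "dP 2 x 0" for x
    using sym ker0 by unfold_locales (simp_all add: \<theta>0_def)
  have hm: "(\<lambda>x. h x $ a $ b) mholomorphic_on UNIV" for a b
    using hhol by (simp add: holomorphic_bivector_def)
  have dh: "partial c (\<lambda>x. h x $ i $ j) x = - 2 * \<delta> x c * h x $ i $ j"
    if "i \<in> {2, 3}" "j \<in> {2, 3}" for x c and i j :: 3
    using parh that unfolding \<Gamma> parallel_bivector_iff[OF hhol sym ker0] by blast
  \<comment> \<open>Quadratic in the block entries, so it satisfies their equation with 4 in place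
    of 2; unlike the single entries it vanishes nowhere, so it has a logarithm.\<close>
  define D where "D x = h x $ 2 $ 2 * h x $ 3 $ 3 - h x $ 2 $ 3 * h x $ 2 $ 3" for x
  have Dm: "D mholomorphic_on UNIV"
    unfolding D_def[abs_def] by (intro mholomorphic_on_diff mholomorphic_on_mult hm)
  have Dnz: "D x \<noteq> 0" for x
    using h.rank_2_iff[of x] rk[of x] by (simp add: D_def power2_eq_square)
  have dD: "partial c D x = - 4 * \<delta> x c * D x" for c x
    unfolding D_def[abs_def]
    by (simp add: partial_diff partial_mult mholomorphic_on_mult hm dh algebra_simps)
  obtain \<eta> where \<eta>: "\<eta> mholomorphic_on UNIV" "\<And>x. D x = exp (\<eta> x)"
    using mholomorphic_logarithm[OF Dm Dnz] by blast
  define \<psi> where "\<psi> x = - 1 / 4 * \<eta> x" for x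
  have \<psi>: "\<psi> mholomorphic_on UNIV"
    unfolding \<psi>_def[abs_def] by (intro mholomorphic_on_mult mholomorphic_on_const \<eta>)
  have \<delta>: "\<delta> = (\<lambda>x c. partial c \<psi> x)"
  proof (intro ext)
    fix x c
    have "D = (\<lambda>x. exp (\<eta> x))" using \<eta>(2) by (rule ext)
    then have "partial c D x = D x * partial c \<eta> x"
      using partial_exp[OF \<eta>(1), of c x] by simp
    then have "D x * partial c \<eta> x = D x * (- 4 * \<delta> x c)"
      by (simp add: dD mult.commute)
    then have "partial c \<eta> x = - 4 * \<delta> x c"
      using Dnz[of x] by (simp only: mult_cancel_left) simp
    then show "\<delta> x c = partial c \<psi> x"
      unfolding \<psi>_def[abs_def] partial_cmult[OF \<eta>(1)] by simp
  qed
  \<comment> \<open>First integrals: the exponential cancels the factor that \<open>\<delta>\<close>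
    contributes to the derivative of the block entries.\<close>
  define k where "k i j x = exp (2 * \<psi> x) * h x $ i $ j" for x and i j :: 3
  have k_const: "k i j x = k i j 0" if ij: "i \<in> {2, 3}" "j \<in> {2, 3}" for i j x
  proof (rule mholomorphic_partial_zero_imp_const)
    have e: "(\<lambda>x. exp (2 * \<psi> x)) mholomorphic_on UNIV"
      by (intro mholomorphic_on_mult mholomorphic_on_exp mholomorphic_on_const \<psi>)
    show "k i j mholomorphic_on UNIV"
      unfolding k_def[abs_def] by (intro mholomorphic_on_mult e hm)
    show "partial c (k i j) p = 0" for c p
      unfolding k_def[abs_def]
      by (simp add: partial_mult[OF e hm] partial_exp mholomorphic_on_mult partial_cmult \<psi> dh[OF ij] \<delta>)
  qed
  have h_eq: "h x $ i $ j = exp (- 2 * \<psi> x) * k i j 0" if "i \<in> {2, 3}" "j \<in> {2, 3}" for i j x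
  proof -
    have "exp (- 2 * \<psi> x) * k i j x = h x $ i $ j"
      unfolding k_def mult.assoc[symmetric] exp_add[symmetric] by simp
    then show ?thesis using k_const[OF that, of x] by simp
  qed
  have "k 2 2 0 * k 3 3 0 - (k 2 3 0)\<^sup>2 = (exp (2 * \<psi> 0))\<^sup>2 * D 0"
    by (simp add: k_def D_def power2_eq_square algebra_simps)
  then have "k 2 2 0 * k 3 3 0 - (k 2 3 0)\<^sup>2 \<noteq> 0" using Dnz[of 0] by simp
  then obtain G :: "complex ^ 2 ^ 2" where G: "invertible G"
    and GG: "G ** transpose G = matrix2 (k 2 2 0) (k 2 3 0) (k 2 3 0) (k 3 3 0)"
    by (rule complex_symmetric_factorization)
  have h: "h = param_metric f \<psi> G"
  proof
    fix x
    interpret p: degenerate_bivector "param_metric f \<psi> G x" "dP 2 x 0"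
      using param_metric_nth(4,5) by unfold_locales (simp_all add: \<theta>0_def)
    have e: "h x $ 2 $ 2 = param_metric f \<psi> G x $ 2 $ 2" "h x $ 2 $ 3 = param_metric f \<psi> G x $ 2 $ 3"
      "h x $ 3 $ 3 = param_metric f \<psi> G x $ 3 $ 3"
      by (simp_all only: param_metric_nth GG) (simp_all add: h_eq)
    have e32: "h x $ 3 $ 2 = param_metric f \<psi> G x $ 3 $ 2"
      using e(2) h.nth_commute[of x 3 2] p.nth_commute[of 3 2] by simp
    \<comment> \<open>Agreement on the block spreads to the first column by the kernel and to the
      first row by symmetry.\<close>
    have e1: "h x $ a $ 1 = param_metric f \<psi> G x $ a $ 1" if "h x $ a $ 2 = param_metric f \<psi> G x $ a $ 2" for a
      unfolding h.nth_1 p.nth_1 that ..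
    have e12: "h x $ 1 $ a = param_metric f \<psi> G x $ 1 $ a" if "h x $ a $ 1 = param_metric f \<psi> G x $ a $ 1" for a
      using that h.nth_commute[of x a 1] p.nth_commute[of a 1] by simp
    show "h x = param_metric f \<psi> G x"
      unfolding vector3_eq_iff
      using e e32 e1[OF e(1)] e1[OF e32] e12[OF e1[OF e(1)]] e12[OF e1[OF e32]] e1[OF e12[OF e1[OF e(1)]]] by blast
  qed
  define A where "A x = (\<chi> b. \<beta> x b * exp (- \<phi> x))" for x :: "complex ^ 3"
  define B where "B x = (\<chi> b. \<gamma> x b * exp (- \<phi> x))" for x :: "complex ^ 3"
  have AB: "holomorphic_one_form A" "holomorphic_one_form B"
    unfolding holomorphic_one_form_def A_def B_def
    by (auto intro!: mholomorphic_on_mult mholomorphic_on_exp mholomorphic_on_minus hol \<phi>)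
  have "\<beta> = (\<lambda>x b. A x $ b * exp (\<phi> x))" "\<gamma> = (\<lambda>x b. B x $ b * exp (\<phi> x))"
    by (simp_all add: A_def B_def fun_eq_iff mult.assoc flip: exp_add)
  then have "\<Gamma> = param_connection f A B \<phi> \<psi>"
    unfolding param_connection_eq[OF \<phi>] \<Gamma> \<alpha> \<delta> by simp
  then show ?thesis
    using that h \<theta> AB \<phi> \<psi> G by (auto simp: param_clock_eq)
qed

lemma induced_structures_eq:
  "induced_structures f =
     {(param_metric f \<psi> G, param_clock f \<phi>, param_connection f A B \<phi> \<psi>) | A B \<phi> \<psi> G.
        holomorphic_one_form A \<and> holomorphic_one_form B \<and>
        \<phi> mholomorphic_on UNIV \<and> \<psi> mholomorphic_on UNIV \<and> invertible G}" (is "_ = ?S")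
proof (intro equalityI subsetI)
  fix X assume X: "X \<in> induced_structures f"
  obtain h \<theta> \<Gamma> where eq: "X = (h, \<theta>, \<Gamma>)" by (cases X)
  show "X \<in> ?S"
    by (rule induced_structuresE[OF X[unfolded eq]]) (use eq in blast)
qed (use param_in_induced_structures in auto)

text \<open>An induced metric is only asked to annihilate the clock. Rank two makes the kernel
  one-dimensional, and the clock, a nonzero multiple of \<open>\<theta>0\<close>, spans it.\<close>

lemma torsional_newton_cartan_induced:
  assumes "(h, \<theta>, \<Gamma>) \<in> induced_structures f"
  shows "torsional_newton_cartan h \<theta> \<Gamma>"
proof -
  have clock: "frame_clock f \<theta>" and conn: "torsion_Xi_connection f \<Gamma>" and met: "metric h"
    and ker: "\<And>x. h x *v \<theta> x = 0" and par: "parallel_one_form \<Gamma> \<theta>" "parallel_bivector \<Gamma> h"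
    using assms by (auto simp: induced_structures_def)
  obtain \<phi> where \<theta>: "\<theta> = (\<lambda>x. exp (\<phi> x) *s \<theta>0 x)"
    using clock frame_clock_iff by blast
  have "{\<alpha>. h x *v \<alpha> = 0} = range (\<lambda>k. k *s \<theta> x)" for x
  proof -
    have "h x *v \<theta>0 x = 0" using ker[of x] by (simp add: \<theta> vector_scalar_commute)
    then interpret degenerate_bivector "h x" "dP 2 x 0"
      using met by unfold_locales (simp_all add: \<theta>0_def metric_def)
    have "{\<alpha>. h x *v \<alpha> = 0} = range (\<lambda>k. k *s \<theta>0 x)"
      using kernel_eq met by (simp add: \<theta>0_def metric_def)
    also have "\<dots> = range (\<lambda>k. k *s \<theta> x)"
    proof (intro equalityI subsetI)
      fix v assume "v \<in> range (\<lambda>k. k *s \<theta>0 x)"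
      then obtain k where "v = k *s \<theta>0 x" by blast
      then have "v = (k * exp (- \<phi> x)) *s \<theta> x"
        by (simp add: \<theta> mult.assoc flip: exp_add)
      then show "v \<in> range (\<lambda>k. k *s \<theta> x)" by blast
    qed (auto simp: \<theta>)
    finally show ?thesis .
  qed
  then show ?thesis
    using clock conn met par
    by (simp add: torsional_newton_cartan_def frame_clock_def torsion_Xi_connection_def)
qed

end

theorem theorem3p3:
  fixes f :: "complex \<Rightarrow> complex \<Rightarrow> complex"
  assumes "(\<lambda>p :: complex ^ 2. f (p $ 1) (p $ 2)) mholomorphic_on {p. p $ 2 \<noteq> 0}"
  shows
    \<comment> \<open>the moduli space of global sections is a complex three-manifold with coordinates \<open>x\<close>\<close>
    "bij_betw (\<lambda>x. (sec f x, sec_hat f x)) UNIV (global_sections f) \<and>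
     (\<forall>\<mu>. holomorphic_family (\<lambda>x l. sec f x l $ \<mu>)) \<and>
     (\<forall>\<mu>. holomorphic_family (\<lambda>x m. sec_hat f x m $ \<mu>)) \<and>
     (\<forall>x. bij_betw (\<lambda>u l. \<Sum>a\<in>UNIV. u $ a *s dsec f x l a) UNIV (normal_sections f x)) \<and>
     (\<forall>x. \<exists>H Hh. normal_splitting f x H Hh) \<and>
     (\<forall>(h, \<theta>, \<Gamma>) \<in> induced_structures f. torsional_newton_cartan h \<theta> \<Gamma>) \<and>
     induced_structures f =
       {(param_metric f \<psi> G, param_clock f \<phi>, param_connection f A B \<phi> \<psi>) | A B \<phi> \<psi> G.
          holomorphic_one_form A \<and> holomorphic_one_form B \<and>
          \<phi> mholomorphic_on UNIV \<and> \<psi> mholomorphic_on UNIV \<and> invertible G}"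
proof -
  obtain P Q :: "complex ^ 3 \<Rightarrow> complex \<Rightarrow> complex" where
    "holomorphic_family_on P UNIV" "holomorphic_family_on Q UNIV"
    "\<And>x l. l \<noteq> 0 \<Longrightarrow> f (x $ 2 + x $ 3 * l) l = P x l + Q x (1 / l)" "\<And>x. Q x 0 = 0"
    by (rule laurent_splitting_family[OF pullback_holomorphic_family_on(1)[OF assms]]) (assumption | rule that)+
  then interpret twistor_family f P Q
    by unfold_locales (auto intro: pullback_holomorphic_family_on(2)[OF assms])
  have "\<exists>H Hh. normal_splitting f x H Hh" for x
    using normal_splitting_scaled(1)[of 1 x] by auto
  then show ?thesis
    using bij_betw_global_sections holomorphic_family_sec holomorphic_family_sec_hat bij_betw_normal_sections
      torsional_newton_cartan_induced induced_structures_eq by auto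
qed

end
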